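(* Let $q$ be a prime power. a) If $R$ is a primefree atomic domain which is an $\mathbb{F}_q$-algebra and not a field, then $R$ has at least $q+1$ atoms. b) For all integers $n \geq 3$ there is a primefree $\mathrm{CK}(n;2)$-domain. c) If $q$ is even, then for all integers $n \geq 2q^2-q$ there is a primefree $\mathrm{CK}(n;q)$-domain. d) If $q$ is odd, then for all integers $n \geq 2q^2-q+1$ there is a primefree $\mathrm{CK}(n;q)$-domain.
   Context: A domain is a commutative ring (with $1 \neq 0$) without zero-divisors. For a domain $R$, let $R^{\times}$ be its unit group and $R^{\circ} = R \setminus (\{0\} \cup R^{\times})$. An element $p \in R^{\circ}$ is prime if the ideal $(p)$ is prime; $p \in R^{\circ}$ is an atom if for all $x,y \in R$, $p = xy$ implies $x \in R^{\times}$ or $y \in R^{\times}$. $R$ is atomic if every $x \in R^{\circ}$ is a finite product of atoms. $R$ is primefree if it has no prime elements. "$R$ has $\kappa$ atoms" ($\kappa$ a possibly infinite cardinal) means there is a set $\mathcal{P}$ of atoms of $R$ of cardinality $\kappa$ such that every atom of $R$ is associate to a unique $p \in \mathcal{P}$. For $n \in \mathbb{Z}^+$ and a prime power $q$, a $\mathrm{CK}(n;q)$-domain is an atomic domain with exactly $n$ atoms which is also an $\mathbb{F}_q$-algebra. *)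

theory Defs
  imports
    "HOL-Algebra.Ring_Divisibility"
    "HOL-Algebra.Module"
    "HOL-Number_Theory.Prime_Powers"
begin

definition nonzero_nonunits :: "('a, 'm) ring_scheme \<Rightarrow> 'a set" where
  "nonzero_nonunits R = carrier R - ({\<zero>\<^bsub>R\<^esub>} \<union> Units R)"

definition prime_element :: "('a, 'm) ring_scheme \<Rightarrow> 'a \<Rightarrow> bool" where
  "prime_element R p \<longleftrightarrow> p \<in> nonzero_nonunits R \<and> primeideal (PIdl\<^bsub>R\<^esub> p) R"

definition atom :: "('a, 'm) ring_scheme \<Rightarrow> 'a \<Rightarrow> bool" where
  "atom R p \<longleftrightarrow> p \<in> nonzero_nonunits R \<and>
     (\<forall>x\<in>carrier R. \<forall>y\<in>carrier R. p = x \<otimes>\<^bsub>R\<^esub> y \<longrightarrow> x \<in> Units R \<or> y \<in> Units R)"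

text \<open>On domains the two notions above agree with those of the library.\<close>

lemma (in domain) prime_element_iff_ring_prime:
  "prime_element R p \<longleftrightarrow> p \<in> carrier R \<and> ring_prime p"
  unfolding prime_element_def nonzero_nonunits_def
  using primeideal_iff_prime[of p] by (auto simp: ring_prime_def Divisibility.prime_def)

lemma (in domain) atom_iff_ring_irreducible:
  "atom R p \<longleftrightarrow> p \<in> carrier R \<and> ring_irreducible p"
  unfolding atom_def nonzero_nonunits_def
  using ring_irreducibleI[of p] ring_irreducibleE[of p] by auto

definition atomic :: "('a, 'm) ring_scheme \<Rightarrow> bool" where
  "atomic R \<longleftrightarrow> (\<forall>x\<in>nonzero_nonunits R.
     \<exists>ps. (\<forall>p\<in>set ps. atom R p) \<and> x = foldr (\<otimes>\<^bsub>R\<^esub>) ps \<one>\<^bsub>R\<^esub>)"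

definition primefree :: "('a, 'm) ring_scheme \<Rightarrow> bool" where
  "primefree R \<longleftrightarrow> \<not> (\<exists>p. prime_element R p)"

definition atom_transversal :: "('a, 'm) ring_scheme \<Rightarrow> 'a set \<Rightarrow> bool" where
  "atom_transversal R P \<longleftrightarrow> (\<forall>p\<in>P. atom R p) \<and>
     (\<forall>a. atom R a \<longrightarrow> (\<exists>!p. p \<in> P \<and> a \<sim>\<^bsub>R\<^esub> p))"

definition has_exactly_atoms :: "('a, 'm) ring_scheme \<Rightarrow> nat \<Rightarrow> bool" where
  "has_exactly_atoms R n \<longleftrightarrow> (\<exists>P. atom_transversal R P \<and> finite P \<and> card P = n)"

definition has_at_least_atoms :: "('a, 'm) ring_scheme \<Rightarrow> nat \<Rightarrow> bool" where
  "has_at_least_atoms R n \<longleftrightarrow> (\<exists>P. atom_transversal R P \<and> (infinite P \<or> n \<le> card P))"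

text \<open>
  \<open>R\<close> is an algebra over the field \<open>F\<close> with \<open>q\<close> elements via a scalar multiplication \<open>s\<close>.
  The elements of \<open>F\<close> may be taken to be natural numbers, because every finite field is
  isomorphic to one whose carrier is a set of naturals.
\<close>

definition Fq_algebra :: "nat \<Rightarrow> ('a, 'm) ring_scheme \<Rightarrow> bool" where
  "Fq_algebra q R \<longleftrightarrow> (\<exists>(F :: nat ring) (s :: nat \<Rightarrow> 'a \<Rightarrow> 'a).
     field F \<and> finite (carrier F) \<and> card (carrier F) = q \<and>
     algebra F \<lparr>carrier = carrier R, mult = mult R, one = one R,
                zero = zero R, add = add R, smult = s\<rparr>)"

definition CK_domain :: "nat \<Rightarrow> nat \<Rightarrow> ('a, 'm) ring_scheme \<Rightarrow> bool" where
  "CK_domain n q R \<longleftrightarrow>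
     0 < n \<and> domain R \<and> atomic R \<and> has_exactly_atoms R n \<and> Fq_algebra q R"

text \<open>
  An assertion that a domain with some property exists has to name a type for its elements.
  Below this type is \<^typ>\<open>nat \<Rightarrow> nat\<close>; since carriers are arbitrary subsets, its rings are, up to
  isomorphism, all rings of cardinality at most the continuum.
\<close>

end

theory Submission
  imports
    Defs
    "HOL-Algebra.Algebraic_Closure"
    "HOL-Algebra.UnivPoly"
    "HOL-Library.Countable_Set"
    "HOL-Number_Theory.Residues"
begin

text \<open>
  Lower bound: if there are at most \<open>q\<close> atoms, a maximal ideal is the union of the at most \<open>q\<close>
  principal ideals generated by the atoms it contains; an \<open>F\<^sub>q\<close>-space is not a union of \<open>q\<close> proper
  subspaces, so the maximal ideal is principal, generated by a prime element.

  Constructions: for finite fields \<open>k \<subseteq> K\<close> the local ring \<open>k + t\<^sup>s K[[t]]\<close> has as atoms the elements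
  of valuation \<open>s, \<dots>, 2s - 1\<close>, and two of them are associate iff their first \<open>s\<close> coefficients agree up to
  a factor from \<open>k - {0}\<close>. This gives \<open>q + 1\<close>, \<open>2q\<close> and \<open>q\<^sup>2 + q + 1\<close> atoms, and \<open>5\<close> atoms for
  the pair of fields with \<open>4\<close> and \<open>16\<close> elements. Local rings are glued inside their product: a
  countable subring generated by elements that are transcendental in every component embeds into each factor,
  and those elements can be prescribed up to associates because a power series ring has uncountably many units
  but only countably many elements are algebraic over the previous ones. The elements of the product that are
  quotients of this subring form a domain whose divisibility is componentwise, so that the numbers of atoms
  add up. What remains is the coin problem for \<open>q + 1\<close> and \<open>2q\<close>.
\<close>

section \<open>Atoms up to associates\<close>

text \<open>A product of several local rings has zero divisors, and the glued ring has to meet two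
  opposite demands: it must embed into every factor, so that it is a domain, and it must contain, up
  to associates, every tuple with an atom in one place and units elsewhere. Countability reconciles
  them, because over a countable subring almost all unit multiples of such a tuple are generic in
  each component. It also brings the result into the prescribed element type. If \<open>k\<close>
  and \<open>K\<close> have \<open>Q\<close> and \<open>M\<close> elements, the local ring has
  \<open>s * (M - 1) * M^(s - 1) / (Q - 1)\<close> atoms. The numbers arise from (Q, M, s) = (q,
  q^2, 1), (q, q, 2), (q, q^3, 1) and (4, 16, 1). No atom is prime once there are at least two
  classes of each order: an element of the same order in another class is not divisible by the atom,
  but its square is. For odd \<open>q\<close> both \<open>q + 1\<close> and \<open>2 q\<close> are
  even, so an odd total needs the odd number \<open>q^2 + q + 1\<close>. For \<open>q = 2\<close>
  the three general numbers are 3, 4 and 7; from 3 on their sums miss exactly 5, hence the extra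
  ring over the field with 4 elements, which is also an algebra over the field with 2.\<close>

lemma atom_in_carrier: "atom R a \<Longrightarrow> a \<in> carrier R"
  by (auto simp: atom_def nonzero_nonunits_def)

text \<open>Counting atoms reduces to finding a complete invariant \<open>f\<close> of the associate
  classes: one atom chosen for each value gives a transversal, and \<open>f\<close> itself is the
  bijection.\<close>

lemma atom_transversal_by_invariant:
  assumes R: "domain R"
    and inv: "\<And>a b. atom R a \<Longrightarrow> atom R b \<Longrightarrow> a \<sim>\<^bsub>R\<^esub> b \<longleftrightarrow> f a = f b"
    and Y: "f ` {a. atom R a} = Y"
  shows "\<exists>P. atom_transversal R P \<and> bij_betw f P Y"
proof -
  define g where "g y = (SOME a. atom R a \<and> f a = y)" for y
  have g: "atom R (g y) \<and> f (g y) = y" if "y \<in> Y" for y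
    unfolding g_def by (rule someI_ex) (use that Y in auto)
  have "atom_transversal R (g ` Y)"
    unfolding atom_transversal_def
  proof (intro conjI ballI allI impI)
    fix a assume a: "atom R a"
    then have "f a \<in> Y" using Y by auto
    then show "\<exists>!p. p \<in> g ` Y \<and> a \<sim>\<^bsub>R\<^esub> p"
      using g inv a by (intro ex1I[of _ "g (f a)"]) auto
  qed (use g in auto)
  moreover have "bij_betw f (g ` Y) Y"
    using g by (intro bij_betwI[of _ _ _ g]) auto
  ultimately show ?thesis by blast
qed

lemma has_exactly_atoms_by_invariant:
  assumes "domain R"
    and "\<And>a b. atom R a \<Longrightarrow> atom R b \<Longrightarrow> a \<sim>\<^bsub>R\<^esub> b \<longleftrightarrow> f a = f b"
    and "f ` {a. atom R a} = Y" and "finite Y"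
  shows "has_exactly_atoms R (card Y)"
  using atom_transversal_by_invariant[OF assms(1-3)] assms(4)
  by (auto simp: has_exactly_atoms_def bij_betw_same_card bij_betw_finite)

lemma atom_transversal_exists:
  assumes "domain R"
  shows "\<exists>P. atom_transversal R P"
proof -
  interpret domain R by fact
  \<comment> \<open>The associate class of an atom is a complete invariant in every domain.\<close>
  define f where "f a = {b. atom R b \<and> a \<sim>\<^bsub>R\<^esub> b}" for a
  have "a \<sim>\<^bsub>R\<^esub> b \<longleftrightarrow> f a = f b" if "atom R a" "atom R b" for a b
  proof
    assume "a \<sim>\<^bsub>R\<^esub> b"
    then show "f a = f b" unfolding f_def using that atom_in_carrier[of R]
      by (auto intro: associated_trans associated_sym)
  next
    assume "f a = f b"
    moreover have "b \<in> f b" unfolding f_def using that atom_in_carrier by auto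
    ultimately show "a \<sim>\<^bsub>R\<^esub> b" unfolding f_def by auto
  qed
  from atom_transversal_by_invariant[OF assms this refl] show ?thesis by blast
qed

section \<open>The lower bound\<close>

text \<open>Induction on the family. If \<open>V\<close> is covered neither by \<open>U\<close> nor
  by the others, take \<open>x\<close> in \<open>V\<close> outside the others, hence in
  \<open>U\<close>, and \<open>y\<close> in \<open>V\<close> outside \<open>U\<close>. The line of
  all \<open>y + a x\<close> misses \<open>U\<close>, and its points outnumber the remaining
  subspaces.\<close>

lemma (in module) subspace_cover:
  assumes F: "field R" "finite (carrier R)"
    and V: "V \<subseteq> carrier M" "\<And>x y. x \<in> V \<Longrightarrow> y \<in> V \<Longrightarrow> x \<oplus>\<^bsub>M\<^esub> y \<in> V"
      "\<And>a x. a \<in> carrier R \<Longrightarrow> x \<in> V \<Longrightarrow> a \<odot>\<^bsub>M\<^esub> x \<in> V"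
    and W: "\<And>W x y. W \<in> \<W> \<Longrightarrow> x \<in> W \<Longrightarrow> y \<in> W \<Longrightarrow> x \<oplus>\<^bsub>M\<^esub> y \<in> W"
      "\<And>W a x. W \<in> \<W> \<Longrightarrow> a \<in> carrier R \<Longrightarrow> x \<in> W \<Longrightarrow> a \<odot>\<^bsub>M\<^esub> x \<in> W"
    and fin: "finite \<W>" and card: "card \<W> \<le> card (carrier R)"
    and "V \<noteq> {}" "V \<subseteq> \<Union>\<W>"
  shows "\<exists>W\<in>\<W>. V \<subseteq> W"
  using fin W card \<open>V \<subseteq> \<Union>\<W>\<close>
proof (induction \<W>)
  case empty
  then show ?case using \<open>V \<noteq> {}\<close> by auto
next
  case (insert U \<W>)
  interpret F: field R by fact
  show ?case
  proof (cases "V \<subseteq> \<Union>\<W> \<or> V \<subseteq> U")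
    case True
    then show ?thesis using insert by auto
  next
    case False
    then obtain x y where x: "x \<in> V" "x \<notin> \<Union>\<W>" and y: "y \<in> V" "y \<notin> U" by auto
    have xU: "x \<in> U" using x insert.prems(4) by auto
    have car: "x \<in> carrier M" "y \<in> carrier M" using x y V by auto
    have diff: "(y \<oplus>\<^bsub>M\<^esub> a \<odot>\<^bsub>M\<^esub> x) \<oplus>\<^bsub>M\<^esub> (\<ominus> \<one>) \<odot>\<^bsub>M\<^esub> (y \<oplus>\<^bsub>M\<^esub> b \<odot>\<^bsub>M\<^esub> x) = (a \<ominus> b) \<odot>\<^bsub>M\<^esub> x"
      if "a \<in> carrier R" "b \<in> carrier R" for a b
      using that car by (simp add: smult_l_minus smult_l_distr R.minus_eq M.minus_add M.a_ac M.r_neg M.r_neg2 M.r_neg1)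
    have "\<exists>W\<in>\<W>. y \<oplus>\<^bsub>M\<^esub> a \<odot>\<^bsub>M\<^esub> x \<in> W" if a: "a \<in> carrier R" for a
    proof -
      have "y \<oplus>\<^bsub>M\<^esub> a \<odot>\<^bsub>M\<^esub> x \<in> V" using V x y a by blast
      moreover have "y \<oplus>\<^bsub>M\<^esub> a \<odot>\<^bsub>M\<^esub> x \<notin> U"
      proof
        assume "y \<oplus>\<^bsub>M\<^esub> a \<odot>\<^bsub>M\<^esub> x \<in> U"
        moreover have "(\<ominus> a) \<odot>\<^bsub>M\<^esub> x \<in> U" using insert.prems(2)[of U "\<ominus> a" x] a xU by auto
        ultimately have "y \<oplus>\<^bsub>M\<^esub> a \<odot>\<^bsub>M\<^esub> x \<oplus>\<^bsub>M\<^esub> (\<ominus> a) \<odot>\<^bsub>M\<^esub> x \<in> U"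
          using insert.prems(1)[of U] by auto
        moreover have "y \<oplus>\<^bsub>M\<^esub> a \<odot>\<^bsub>M\<^esub> x \<oplus>\<^bsub>M\<^esub> (\<ominus> a) \<odot>\<^bsub>M\<^esub> x = y"
          using a car by (simp add: smult_l_minus M.a_assoc M.r_neg)
        ultimately show False using y by simp
      qed
      ultimately show ?thesis using insert.prems(4) by blast
    qed
    \<comment> \<open>Two of the vectors \<open>y + a x\<close> lie in the same subspace other than \<open>U\<close>, which then contains \<open>x\<close>.\<close>
    then obtain g where g: "\<And>a. a \<in> carrier R \<Longrightarrow> g a \<in> \<W> \<and> y \<oplus>\<^bsub>M\<^esub> a \<odot>\<^bsub>M\<^esub> x \<in> g a"
      by metis
    have "card (g ` carrier R) \<le> card \<W>"
      using g insert.hyps by (intro card_mono) auto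
    then have "card (g ` carrier R) < card (carrier R)"
      using insert.prems(3) insert.hyps by simp
    then have "\<not> inj_on g (carrier R)"
      using pigeonhole by blast
    then obtain a b where ab: "a \<in> carrier R" "b \<in> carrier R" "a \<noteq> b" "g a = g b"
      unfolding inj_on_def by auto
    define c where "c = a \<ominus> b"
    have c: "c \<in> carrier R" "c \<noteq> \<zero>" using ab unfolding c_def by auto
    have "(\<ominus> \<one>) \<odot>\<^bsub>M\<^esub> (y \<oplus>\<^bsub>M\<^esub> b \<odot>\<^bsub>M\<^esub> x) \<in> g a"
      using g[OF ab(2)] ab(4) insert.prems(2)[of "g a" "\<ominus> \<one>"] by auto
    then have "c \<odot>\<^bsub>M\<^esub> x \<in> g a"
      using diff[OF ab(1,2)] insert.prems(1)[of "g a"] g[OF ab(1)] unfolding c_def by force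
    then have "inv c \<odot>\<^bsub>M\<^esub> (c \<odot>\<^bsub>M\<^esub> x) \<in> g a"
      using insert.prems(2)[of "g a" "inv c"] g[OF ab(1)] c F.field_Units by auto
    then have "x \<in> g a"
      using c car F.field_Units by (simp flip: smult_assoc1)
    then show ?thesis using x(2) g[OF ab(1)] by auto
  qed
qed

lemma (in cring) nonunit_in_maximalideal:
  assumes a: "a \<in> carrier R" "a \<notin> Units R"
  shows "\<exists>I. maximalideal I R \<and> a \<in> I"
proof -
  let ?S = "{I. ideal I R \<and> a \<in> I \<and> \<one> \<notin> I}"
  have "PIdl a \<in> ?S"
    using a cgenideal_ideal cgenideal_self unfolding cgenideal_def Units_def
    by (auto simp: m_comm)
  moreover have "\<Union>C \<in> ?S" if C: "C \<noteq> {}" "subset.chain ?S C" for C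
  proof -
    have "subset.chain {I. ideal I R} C" using C(2) unfolding pred_on.chain_def by auto
    from chain_Union_is_ideal[OF this] have "ideal (\<Union>C) R" using C(1) by (simp split: if_splits)
    then show ?thesis using C unfolding pred_on.chain_def by auto
  qed
  ultimately have "\<exists>I\<in>?S. \<forall>J\<in>?S. I \<subseteq> J \<longrightarrow> J = I"
    by (intro subset_Zorn_nonempty) blast+
  then obtain I where I: "I \<in> ?S" "\<And>J. J \<in> ?S \<Longrightarrow> I \<subseteq> J \<Longrightarrow> J = I"
    by blast
  have "maximalideal I R"
  proof (rule maximalidealI)
    show "ideal I R" using I by auto
    show "carrier R \<noteq> I" using I by auto
    fix J assume J: "ideal J R" "I \<subseteq> J" "J \<subseteq> carrier R"
    show "J = I \<or> J = carrier R"
    proof (cases "\<one> \<in> J")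
      case True
      then show ?thesis using ideal.one_imp_carrier[OF J(1)] by auto
    next
      case False
      then show ?thesis using I J by auto
    qed
  qed
  then show ?thesis using I by auto
qed

lemma (in primeideal) prod_list_mem:
  assumes "set ps \<subseteq> carrier R" "foldr (\<otimes>) ps \<one> \<in> I"
  shows "\<exists>p\<in>set ps. p \<in> I"
  using assms
proof (induction ps)
  case Nil
  then show ?case using one_imp_carrier I_notcarr by auto
next
  case (Cons p ps)
  have "foldr (\<otimes>) ps \<one> \<in> carrier R" using Cons.prems by (induction ps) auto
  then show ?case using Cons I_prime[of p "foldr (\<otimes>) ps \<one>"] by auto
qed

lemma atoms_lower_bound:
  assumes R: "domain R" "atomic R" "primefree R" "Fq_algebra q R" "\<not> field R"
  shows "has_at_least_atoms R (q + 1)"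
proof -
  interpret domain R by fact
  obtain P where P: "atom_transversal R P" using atom_transversal_exists R by blast
  have "infinite P \<or> q + 1 \<le> card P"
  proof (rule ccontr)
    assume "\<not> ?thesis"
    then have P_small: "finite P" "card P \<le> q" by auto
    obtain F :: "nat ring" and s where F: "field F" "finite (carrier F)" "card (carrier F) = q"
      and alg: "algebra F \<lparr>carrier = carrier R, mult = mult R, one = one R,
                zero = zero R, add = add R, smult = s\<rparr>" (is "algebra F ?M")
      using R(4) unfolding Fq_algebra_def by blast
    interpret M: algebra F ?M by fact
    have s_mult: "s a (x \<otimes>\<^bsub>R\<^esub> y) = s a x \<otimes>\<^bsub>R\<^esub> y"
      if "a \<in> carrier F" "x \<in> carrier R" "y \<in> carrier R" for a x y
      using M.smult_assoc2[of a x y] that by simp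
    \<comment> \<open>A scalar acts as multiplication by its image in \<open>R\<close>, so ideals
      are subspaces.\<close>
    have s_ideal: "s a x \<in> I" if "ideal I R" "a \<in> carrier F" "x \<in> I" for a x I
    proof -
      have x: "x \<in> carrier R" using that ideal.Icarr by fast
      have "s a \<one>\<^bsub>R\<^esub> \<otimes>\<^bsub>R\<^esub> x \<in> I"
        using that M.smult_closed[of a "\<one>\<^bsub>R\<^esub>"] ideal.I_l_closed by fastforce
      then show ?thesis using s_mult[of a "\<one>\<^bsub>R\<^esub>" x] that x by simp
    qed
    have zero_not_unit: "\<zero>\<^bsub>R\<^esub> \<notin> Units R"
      using one_not_zero Units_closed by (auto simp: Units_def)
    \<comment> \<open>That \<open>R\<close> is not a field enters here; it provides a maximal ideal
      with a nonzero element.\<close>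
    obtain a where a: "a \<in> carrier R" "a \<notin> Units R" "a \<noteq> \<zero>\<^bsub>R\<^esub>"
    proof (rule ccontr)
      assume "\<not> thesis"
      then have "Units R = carrier R - {\<zero>\<^bsub>R\<^esub>}" using that Units_closed zero_not_unit by blast
      then show False using R(5) R(1) by (simp add: field.intro field_axioms.intro)
    qed
    then obtain I where I: "maximalideal I R" "a \<in> I" using nonunit_in_maximalideal by blast
    interpret I: primeideal I R using maximalideal_prime I by blast
    \<comment> \<open>Some atom in a factorisation of \<open>x\<close> lies in the prime ideal
      \<open>I\<close>; its representative in \<open>P\<close> lies there too and divides
      \<open>x\<close>.\<close>
    have cover: "\<exists>p\<in>P \<inter> I. x \<in> PIdl\<^bsub>R\<^esub> p" if x: "x \<in> I" "x \<noteq> \<zero>\<^bsub>R\<^esub>" for x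
    proof -
      have "x \<in> carrier R" using x I.Icarr by auto
      have "x \<notin> Units R" using x I.I_notcarr ideal.one_imp_carrier I.I_r_closed Units_inv_closed Units_r_inv
        by (metis I.is_ideal)
      then have "x \<in> nonzero_nonunits R" using x \<open>x \<in> carrier R\<close> unfolding nonzero_nonunits_def by auto
      then obtain ps where ps: "\<forall>p\<in>set ps. atom R p" "x = foldr (\<otimes>\<^bsub>R\<^esub>) ps \<one>\<^bsub>R\<^esub>"
        using R(2) unfolding atomic_def by blast
      have psc: "set ps \<subseteq> carrier R" using ps by (blast intro: atom_in_carrier)
      then obtain b where b: "b \<in> set ps" "b \<in> I"
        using I.prod_list_mem[OF psc] ps(2) x(1) by blast
      then obtain p where p: "p \<in> P" "b \<sim>\<^bsub>R\<^esub> p"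
        using ps P unfolding atom_transversal_def by blast
      have pc: "p \<in> carrier R" "b \<in> carrier R" using p P psc b unfolding atom_transversal_def by (auto intro: atom_in_carrier)
      have "p \<in> I" using p pc b I.I_r_closed unfolding associated_def factor_def by auto
      have "b divides\<^bsub>R\<^esub> x"
        using b(1) psc unfolding ps(2)
      proof (induction ps)
        case (Cons c ps)
        have [simp]: "foldr (\<otimes>\<^bsub>R\<^esub>) ps \<one>\<^bsub>R\<^esub> \<in> carrier R" using Cons.prems by (induction ps) auto
        show ?case
        proof (cases "b = c")
          case True
          then show ?thesis using Cons.prems by (auto simp: factor_def)
        next
          case False
          then show ?thesis using Cons by (auto intro: divides_prod_l)
        qed
      qed auto
      then have "p divides\<^bsub>R\<^esub> x" using p pc by (meson associated_def divides_trans)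
      then have "x \<in> PIdl\<^bsub>R\<^esub> p" using pc unfolding factor_def cgenideal_def by (auto simp: m_comm)
      then show ?thesis using p \<open>p \<in> I\<close> by auto
    qed
    have "\<exists>W\<in>(\<lambda>p. PIdl\<^bsub>R\<^esub> p) ` (P \<inter> I). I \<subseteq> W"
    proof (rule M.subspace_cover)
      have pid: "ideal (PIdl\<^bsub>R\<^esub> p) R" if "p \<in> P" for p
        using that P cgenideal_ideal unfolding atom_transversal_def by (auto intro: atom_in_carrier)
      show "field F" "finite (carrier F)" by fact+
      show "I \<subseteq> carrier ?M" "I \<noteq> {}" using I.Icarr I by auto
      show "x \<oplus>\<^bsub>?M\<^esub> y \<in> I" if "x \<in> I" "y \<in> I" for x y using that by simp
      show "b \<odot>\<^bsub>?M\<^esub> x \<in> I" if "b \<in> carrier F" "x \<in> I" for b x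
        using s_ideal[OF I.is_ideal] that by simp
      show "x \<oplus>\<^bsub>?M\<^esub> y \<in> W" if "W \<in> (\<lambda>p. PIdl\<^bsub>R\<^esub> p) ` (P \<inter> I)" "x \<in> W" "y \<in> W" for W x y
        using that pid by (auto intro: additive_subgroup.a_closed ideal.axioms)
      show "b \<odot>\<^bsub>?M\<^esub> x \<in> W" if "W \<in> (\<lambda>p. PIdl\<^bsub>R\<^esub> p) ` (P \<inter> I)" "b \<in> carrier F" "x \<in> W" for W b x
        using that s_ideal pid by auto
      show "finite ((\<lambda>p. PIdl\<^bsub>R\<^esub> p) ` (P \<inter> I))" using P_small by auto
      have "card ((\<lambda>p. PIdl\<^bsub>R\<^esub> p) ` (P \<inter> I)) \<le> card (P \<inter> I)" by (rule card_image_le) (use P_small in auto)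
      also have "\<dots> \<le> card P" by (rule card_mono) (use P_small in auto)
      finally show "card ((\<lambda>p. PIdl\<^bsub>R\<^esub> p) ` (P \<inter> I)) \<le> card (carrier F)"
        using P_small F by simp
      have "\<zero>\<^bsub>R\<^esub> \<in> PIdl\<^bsub>R\<^esub> p" if "p \<in> P" for p
        using pid[OF that] by (auto intro: additive_subgroup.zero_closed ideal.axioms)
      \<comment> \<open>\<open>cover\<close> is silent about zero. Zero lies in every principal
        ideal, but at least one representative must lie in \<open>I\<close>; the nonzero element
        \<open>a\<close> supplies it.\<close>
      moreover obtain p where "p \<in> P \<inter> I" using cover[OF I(2) a(3)] by blast
      ultimately have "\<exists>p\<in>P \<inter> I. x \<in> PIdl\<^bsub>R\<^esub> p" if "x \<in> I" for x
        using cover[OF that] by (cases "x = \<zero>\<^bsub>R\<^esub>") blast+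
      then show "I \<subseteq> \<Union>((\<lambda>p. PIdl\<^bsub>R\<^esub> p) ` (P \<inter> I))" by blast
    qed
    then obtain p where p: "p \<in> P" "p \<in> I" "I \<subseteq> PIdl\<^bsub>R\<^esub> p" by auto
    then have "I = PIdl\<^bsub>R\<^esub> p" using cgenideal_minimal[OF I.is_ideal p(2)] by auto
    then have "prime_element R p"
      using p P I.primeideal_axioms unfolding prime_element_def atom_transversal_def atom_def by auto
    then show False using R(3) unfolding primefree_def by blast
  qed
  then show ?thesis using P unfolding has_at_least_atoms_def by auto
qed

section \<open>Finite fields\<close>

lemma (in cring) binomial:
  assumes [simp]: "x \<in> carrier R" "y \<in> carrier R"
  shows "(x \<oplus> y) [^] n = (\<Oplus>k\<in>{..n}. [(n choose k)] \<cdot> (x [^] k \<otimes> y [^] (n - k)))"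
proof (induction n)
  case (Suc n)
  \<comment> \<open>\<open>t m k\<close> has exponent \<open>k\<close>, total degree
    \<open>Suc n\<close> and coefficient \<open>n choose m\<close>. Multiplication by
    \<open>x\<close> produces the terms with \<open>m = k - 1\<close>, multiplication by
    \<open>y\<close> those with \<open>m = k\<close>, and Pascal's rule adds them.\<close>
  define t where "t m k = [(n choose m)] \<cdot> (x [^] k \<otimes> y [^] (Suc n - k))" for m k :: nat
  have [simp]: "t m k \<in> carrier R" for m k unfolding t_def by simp
  have shift1: "[(n choose k)] \<cdot> (x [^] k \<otimes> y [^] (n - k)) \<otimes> x = t k (Suc k)" for k
    unfolding t_def by (simp add: add_pow_ldistr) (simp add: m_assoc m_comm[of "y [^] (n - k)" x])
  have shift2: "[(n choose k)] \<cdot> (x [^] k \<otimes> y [^] (n - k)) \<otimes> y = t k k" if "k \<le> n" for k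
    unfolding t_def using that by (simp add: add_pow_ldistr Suc_diff_le m_assoc)
  have [simp]: "t (Suc n) k = \<zero>" for k unfolding t_def by (simp add: binomial_eq_0 add.nat_pow_0)
  have "(x \<oplus> y) [^] Suc n =
      (\<Oplus>k\<in>{..n}. [(n choose k)] \<cdot> (x [^] k \<otimes> y [^] (n - k))) \<otimes> x \<oplus>
      (\<Oplus>k\<in>{..n}. [(n choose k)] \<cdot> (x [^] k \<otimes> y [^] (n - k))) \<otimes> y"
    using Suc.IH by (simp add: r_distr Suc[symmetric])
  also have "(\<Oplus>k\<in>{..n}. [(n choose k)] \<cdot> (x [^] k \<otimes> y [^] (n - k))) \<otimes> x
      = (\<Oplus>k\<in>{..n}. [(n choose k)] \<cdot> (x [^] k \<otimes> y [^] (n - k)) \<otimes> x)"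
    by (rule finsum_ldistr) auto
  also have "\<dots> = (\<Oplus>k\<in>{..n}. t k (Suc k))"
    using shift1 by (intro finsum_cong') auto
  \<comment> \<open>A vanishing term at index 0 is supplied so that the sum can be reindexed by
    \<open>Suc k\<close>.\<close>
  also have "\<dots> = (\<Oplus>k\<in>{..n}. (if Suc k = 0 then \<zero> else t (Suc k - 1) (Suc k))) \<oplus> (if 0 = (0::nat) then \<zero> else t (0 - 1) 0)"
    by simp
  also have "\<dots> = (\<Oplus>k\<in>{..Suc n}. (if k = 0 then \<zero> else t (k - 1) k))"
    by (rule finsum_Suc2[symmetric]) auto
  also have "(\<Oplus>k\<in>{..n}. [(n choose k)] \<cdot> (x [^] k \<otimes> y [^] (n - k))) \<otimes> y
      = (\<Oplus>k\<in>{..n}. [(n choose k)] \<cdot> (x [^] k \<otimes> y [^] (n - k)) \<otimes> y)"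
    by (rule finsum_ldistr) auto
  also have "\<dots> = (\<Oplus>k\<in>{..n}. t k k)"
    using shift2 by (intro finsum_cong') auto
  also have "\<dots> = t (Suc n) (Suc n) \<oplus> (\<Oplus>k\<in>{..n}. t k k)"
    by simp
  also have "\<dots> = (\<Oplus>k\<in>{..Suc n}. t k k)"
    by (rule finsum_Suc[symmetric]) auto
  also have "(\<Oplus>k\<in>{..Suc n}. (if k = 0 then \<zero> else t (k - 1) k)) \<oplus> (\<Oplus>k\<in>{..Suc n}. t k k)
      = (\<Oplus>k\<in>{..Suc n}. (if k = 0 then \<zero> else t (k - 1) k) \<oplus> t k k)"
    by (rule finsum_addf[symmetric]) auto
  also have "\<dots> = (\<Oplus>k\<in>{..Suc n}. [(Suc n choose k)] \<cdot> (x [^] k \<otimes> y [^] (Suc n - k)))"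
  proof (rule finsum_cong')
    fix k assume "k \<in> {..Suc n}"
    show "(if k = 0 then \<zero> else t (k - 1) k) \<oplus> t k k = [(Suc n choose k)] \<cdot> (x [^] k \<otimes> y [^] (Suc n - k))"
      by (cases k) (simp_all add: t_def add.nat_pow_mult)
  qed auto
  finally show ?case .
qed simp

lemma (in ring) add_pow_eq_zero:
  assumes "[(p :: nat)] \<cdot> \<one> = \<zero>" "x \<in> carrier R" "p dvd m"
  shows "[m] \<cdot> x = \<zero>"
proof -
  obtain k where m: "m = p * k" using assms(3) by auto
  have "[p] \<cdot> x = ([p] \<cdot> \<one>) \<otimes> x" using assms(2) by (simp add: add_pow_ldistr)
  then have "[p] \<cdot> x = \<zero>" using assms by simp
  then show ?thesis unfolding m using add.nat_pow_pow[of x k p] assms(2) by simp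
qed

text \<open>All binomial coefficients strictly between the ends are divisible by \<open>p\<close>;
  iterating gives the powers of \<open>p\<close>. Commutative rings are the right generality because
  polynomial rings are substituted as well as fields.\<close>

lemma (in cring) freshman:
  assumes p: "prime (p :: nat)" "[p] \<cdot> \<one> = \<zero>" and [simp]: "x \<in> carrier R" "y \<in> carrier R"
  shows "(x \<oplus> y) [^] (p ^ j) = x [^] (p ^ j) \<oplus> y [^] (p ^ j)"
proof -
  have *: "(x \<oplus> y) [^] p = x [^] p \<oplus> y [^] p" if [simp]: "x \<in> carrier R" "y \<in> carrier R" for x y
  proof -
    obtain m where m: "p = Suc (Suc m)"
      using prime_ge_2_nat[OF p(1)] by (metis add_2_eq_Suc le_Suc_ex)
    define f where "f k = [(p choose k)] \<cdot> (x [^] k \<otimes> y [^] (p - k))" for k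
    have [simp]: "f k \<in> carrier R" for k unfolding f_def by simp
    have "f (Suc k) = \<zero>" if "k \<in> {..m}" for k
    proof -
      have "p dvd (p choose Suc k)" by (rule dvd_choose_prime) (use that m p(1) in auto)
      from add_pow_eq_zero[OF p(2) _ this] show ?thesis unfolding f_def by simp
    qed
    then have z: "(\<Oplus>k\<in>{..m}. f (Suc k)) = \<zero>"
      by (intro add.finprod_one_eqI) auto
    have "(x \<oplus> y) [^] p = (\<Oplus>k\<in>{..p}. f k)" unfolding f_def by (rule binomial) auto
    also have "\<dots> = f p \<oplus> ((\<Oplus>k\<in>{..m}. f (Suc k)) \<oplus> f 0)"
      unfolding m using finsum_Suc[of f "Suc m"] finsum_Suc2[of f m] by (simp add: Pi_def del: finsum_Suc)
    also have "\<dots> = x [^] p \<oplus> y [^] p" unfolding z by (simp add: f_def)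
    finally show ?thesis .
  qed
  show ?thesis
  proof (induction j)
    case (Suc j)
    have pw: "z [^] (p ^ Suc j) = (z [^] (p ^ j)) [^] p" if "z \<in> carrier R" for z
      using nat_pow_pow[OF that] by (simp add: mult.commute)
    show ?case using Suc * by (simp add: pw del: power_Suc)
  qed simp
qed

section \<open>Finite fields as fixed fields of powers of Frobenius\<close>

lemma (in ring_hom_ring) hom_add_pow_one: "h ([n] \<cdot> \<one>) = [(n :: nat)] \<cdot>\<^bsub>S\<^esub> \<one>\<^bsub>S\<^esub>"
  by (induction n) auto

text \<open>For \<open>n = p ^ j\<close> with \<open>j > 0\<close>, in an algebraically closed field
  of characteristic \<open>p\<close>, this is the subfield with \<open>p ^ j\<close> elements.
  Realising the finite fields inside one carrier turns the embeddings between them into identity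
  maps.\<close>

definition fixed_field :: "('a, 'm) ring_scheme \<Rightarrow> nat \<Rightarrow> 'a set" where
  "fixed_field R n = {x \<in> carrier R. x [^]\<^bsub>R\<^esub> n = x}"

text \<open>By \<open>freshman\<close>, raising to the power \<open>p ^ j\<close> is a ring
  homomorphism, and the fixed points of an endomorphism of a field form a subfield.\<close>

lemma (in field) subfield_fixed_field:
  assumes p: "prime (p :: nat)" "[p] \<cdot> \<one> = \<zero>"
  shows "subfield (fixed_field R (p ^ j)) R"
proof (rule subfieldI')
  let ?q = "p ^ j"
  have q0: "?q > 0" using prime_gt_0_nat[OF p(1)] by simp
  have zero: "\<zero> [^] ?q = \<zero>" using q0 nat_pow_zero by simp
  show "subring (fixed_field R ?q) R"
  proof (rule subringI)
    show "\<ominus> x \<in> fixed_field R ?q" if x: "x \<in> fixed_field R ?q" for x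
    proof -
      have [simp]: "x \<in> carrier R" "x [^] ?q = x" using x by (auto simp: fixed_field_def)
      \<comment> \<open>Additivity applied to \<open>x\<close> and its negative treats
        \<open>p = 2\<close> and odd \<open>p\<close> alike.\<close>
      have "x \<oplus> (\<ominus> x) [^] ?q = \<zero>"
        using freshman[OF p, of x "\<ominus> x" j] zero by (simp add: r_neg)
      then show ?thesis using minus_equality[of "(\<ominus> x) [^] ?q" x] by (simp add: fixed_field_def a_comm)
    qed
    show "x \<otimes> y \<in> fixed_field R ?q" if "x \<in> fixed_field R ?q" "y \<in> fixed_field R ?q" for x y
      using that by (auto simp: fixed_field_def nat_pow_distrib)
    show "x \<oplus> y \<in> fixed_field R ?q" if "x \<in> fixed_field R ?q" "y \<in> fixed_field R ?q" for x y
      using that by (auto simp: fixed_field_def freshman[OF p])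
  qed (auto simp: fixed_field_def)
  show "inv x \<in> fixed_field R ?q" if x: "x \<in> fixed_field R ?q - {\<zero>}" for x
  proof -
    have [simp]: "x \<in> carrier R" "x [^] ?q = x" and u: "x \<in> Units R"
      using x by (auto simp: fixed_field_def field_Units)
    have "x [^] ?q \<otimes> (inv x) [^] ?q = (x \<otimes> inv x) [^] ?q"
      using u by (intro nat_pow_distrib[symmetric]) auto
    then have "x \<otimes> (inv x) [^] ?q = \<one>" using u by simp
    then have "inv x = (inv x) [^] ?q" using u by (intro comm_inv_char) auto
    then show ?thesis using u by (simp add: fixed_field_def)
  qed
qed

lemma (in field) fixed_field_mono:
  assumes "i dvd j"
  shows "fixed_field R (p ^ i) \<subseteq> fixed_field R (p ^ j)"
proof
  fix x assume x: "x \<in> fixed_field R (p ^ i)"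
  then have [simp]: "x \<in> carrier R" "x [^] (p ^ i) = x" by (auto simp: fixed_field_def)
  obtain k where k: "j = i * k" using assms by auto
  have "x [^] ((p ^ i) ^ k) = x"
    by (induction k) (simp_all add: mult.commute flip: nat_pow_pow)
  then show "x \<in> fixed_field R (p ^ j)" by (simp add: fixed_field_def k power_mult)
qed

text \<open>The fixed field is the set of roots of X^q - X, which has q roots counted with
  multiplicity. Only the absence of repeated roots needs an argument; translating a root to 0 avoids
  derivatives.\<close>

lemma (in algebraically_closed) card_fixed_field:
  assumes p: "prime (p :: nat)" "[p] \<cdot> \<one> = \<zero>" and j: "j > 0"
  shows "finite (fixed_field L (p ^ j))" "card (fixed_field L (p ^ j)) = p ^ j"
proof -
  define q where "q = p ^ j"
  have q2: "q \<ge> 2" unfolding q_def using prime_ge_2_nat[OF p(1)] j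
    by (metis One_nat_def Suc_leI dual_order.trans power_increasing power_one_right prime_ge_1_nat p(1))
  let ?P = "poly_ring L"
  interpret UP: domain ?P
    using univ_poly_is_domain[OF carrier_is_subring] .
  have X: "X \<in> carrier ?P" using var_closed(1)[OF carrier_is_subring] .
  define f where "f = X [^]\<^bsub>?P\<^esub> q \<ominus>\<^bsub>?P\<^esub> X"
  have f: "f \<in> carrier ?P" unfolding f_def using X by simp
  have degX: "degree X = 1" by (simp add: var_def)
  have degXq: "degree (X [^]\<^bsub>?P\<^esub> q) = q" using polynomial_pow_degree[OF X, of q] degX by simp
  have degmX: "degree (\<ominus>\<^bsub>?P\<^esub> X) = 1"
    using univ_poly_a_inv_degree[OF carrier_is_subring X] degX by simp
  have degf: "degree f = q"
  proof -
    have "degree (poly_add (X [^]\<^bsub>?P\<^esub> q) (\<ominus>\<^bsub>?P\<^esub> X)) = max q 1"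
      using poly_add_degree_eq[OF carrier_is_subring, of "X [^]\<^bsub>?P\<^esub> q" "\<ominus>\<^bsub>?P\<^esub> X"] X degXq degmX q2
      by (simp add: univ_poly_carrier)
    then show ?thesis using q2 by (simp add: f_def UP.minus_eq univ_poly_add)
  qed
  have f0: "f \<noteq> []" using degf q2 by auto
  have evf: "eval f a = a [^] q \<ominus> a" if a: "a \<in> carrier L" for a
  proof -
    interpret E: ring_hom_ring ?P L "\<lambda>g. eval g a"
      using eval_ring_hom[OF carrier_is_subring a] .
    have "eval f a = eval X a [^] q \<ominus> eval X a"
      unfolding f_def using X by (simp add: UP.minus_eq minus_eq E.hom_nat_pow)
    then show ?thesis using eval_var[OF a] by simp
  qed
  have root: "is_root f a \<longleftrightarrow> a \<in> fixed_field L q" for a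
    using evf[of a] f0 by (cases "a \<in> carrier L") (auto simp: is_root_def fixed_field_def)
  have set: "set_mset (roots f) = fixed_field L q"
    using roots_mem_iff_is_root[OF f] root by auto
  have char: "[p] \<cdot>\<^bsub>?P\<^esub> \<one>\<^bsub>?P\<^esub> = \<zero>\<^bsub>?P\<^esub>"
  proof -
    interpret C: ring_hom_ring L ?P poly_of_const
      using canonical_embedding_ring_hom[OF carrier_is_subring] by simp
    show ?thesis using C.hom_add_pow_one[of p] p(2) by simp
  qed
  \<comment> \<open>With \<open>Y = X - a\<close> we have \<open>f = Y^q - Y\<close>, which is not divisible by \<open>Y^2\<close>.\<close>
  have mult: "count (roots f) a \<le> 1" for a
  proof (rule ccontr)
    assume "\<not> ?thesis"
    then have c: "count (roots f) a \<ge> 2" by simp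
    then have "a \<in># roots f" by (metis count_eq_zero_iff not_numeral_le_zero)
    then have a: "a \<in> carrier L" "a [^] q = a" using set by (auto simp: fixed_field_def)
    define Y where "Y = [\<one>, \<ominus> a]"
    define C where "C = poly_of_const a"
    interpret C: ring_hom_ring L ?P poly_of_const
      using canonical_embedding_ring_hom[OF carrier_is_subring] by simp
    \<comment> \<open>Since \<open>a\<close> is fixed by the power \<open>q\<close>, the constant
      cancels when X = Y + a is substituted into X^q - X.\<close>
    have C: "C \<in> carrier ?P" "C [^]\<^bsub>?P\<^esub> q = C"
      using a C.hom_nat_pow[of a q] by (auto simp: C_def)
    have Y: "Y \<in> carrier ?P" using a by (auto simp: Y_def univ_poly_def polynomial_def)
    have XYC: "X = Y \<oplus>\<^bsub>?P\<^esub> C"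
      using a by (auto simp: Y_def C_def var_def univ_poly_add poly_of_const_def l_neg)
    have "X [^]\<^bsub>?P\<^esub> q = Y [^]\<^bsub>?P\<^esub> q \<oplus>\<^bsub>?P\<^esub> C [^]\<^bsub>?P\<^esub> q"
      unfolding XYC q_def by (rule UP.freshman[OF p(1) char Y C(1)])
    then have feq: "f = Y [^]\<^bsub>?P\<^esub> q \<ominus>\<^bsub>?P\<^esub> Y"
      unfolding f_def using C Y by (simp add: XYC UP.minus_eq UP.minus_add UP.a_ac UP.r_neg UP.r_neg2 UP.r_neg1)
    have "alg_mult f a \<ge> 2" using c alg_mult_eq_count_roots[OF f] by simp
    then have d: "Y [^]\<^bsub>?P\<^esub> (2::nat) divides\<^bsub>?P\<^esub> f"
      using le_alg_mult_imp_pdivides[OF a(1) f, of 2] by (simp add: Y_def pdivides_def)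
    obtain g where g: "g \<in> carrier ?P" "f = Y [^]\<^bsub>?P\<^esub> (2::nat) \<otimes>\<^bsub>?P\<^esub> g"
      using d unfolding factor_def by auto
    have "Y [^]\<^bsub>?P\<^esub> q = Y [^]\<^bsub>?P\<^esub> (2::nat) \<otimes>\<^bsub>?P\<^esub> Y [^]\<^bsub>?P\<^esub> (q - 2)"
      using UP.nat_pow_mult[OF Y, of 2 "q - 2"] by (simp only: le_add_diff_inverse[OF q2])
    \<comment> \<open>Both \<open>f\<close> and the power of \<open>Y\<close> are multiples of the
      square of \<open>Y\<close>, hence so is \<open>Y\<close> itself, which contradicts its
      degree.\<close>
    moreover have "Y = Y [^]\<^bsub>?P\<^esub> q \<ominus>\<^bsub>?P\<^esub> f"
      unfolding feq using Y by (simp add: UP.minus_eq UP.minus_add UP.a_ac UP.r_neg UP.r_neg2 UP.r_neg1)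
    ultimately have "Y = Y [^]\<^bsub>?P\<^esub> (2::nat) \<otimes>\<^bsub>?P\<^esub> (Y [^]\<^bsub>?P\<^esub> (q - 2) \<ominus>\<^bsub>?P\<^esub> g)"
      using g Y by (simp add: UP.minus_eq UP.r_distr UP.r_minus)
    then have "Y [^]\<^bsub>?P\<^esub> (2::nat) divides\<^bsub>?P\<^esub> Y"
      using Y g unfolding factor_def by (intro bexI[of _ "Y [^]\<^bsub>?P\<^esub> (q - 2) \<ominus>\<^bsub>?P\<^esub> g"]) auto
    then have "degree (Y [^]\<^bsub>?P\<^esub> (2::nat)) \<le> degree Y"
      using pdivides_imp_degree_le[OF carrier_is_subring _ Y, of "Y [^]\<^bsub>?P\<^esub> (2::nat)"] Y
      by (auto simp: pdivides_def Y_def)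
    then show False using polynomial_pow_degree[OF Y, of 2] by (simp add: Y_def)
  qed
  have "size (roots f) = (\<Sum>a\<in>set_mset (roots f). count (roots f) a)"
    by (rule size_multiset_overloaded_eq)
  also have "\<dots> = (\<Sum>a\<in>set_mset (roots f). 1)"
    by (rule sum.cong) (use mult in \<open>auto simp: le_antisym Suc_leI count_greater_zero_iff\<close>)
  finally have "size (roots f) = card (fixed_field L q)" using set by simp
  moreover have "size (roots f) = q"
    using roots_over_carrier[OF f] degf unfolding splitted_def by simp
  ultimately show "card (fixed_field L (p ^ j)) = p ^ j" "finite (fixed_field L (p ^ j))"
    using set unfolding q_def by (simp, metis finite_set_mset)
qed

text \<open>Inside an algebraic closure of the prime field, the fixed field for \<open>p ^ N\<close>
  contains the one for \<open>p ^ j\<close> whenever \<open>j\<close> divides \<open>N\<close>.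
  Being finite, it can be renamed to natural numbers, the type that \<open>Fq_algebra\<close> asks
  for.\<close>

lemma finite_field_tower:
  assumes p: "prime (p :: nat)" and N: "N > 0"
  shows "\<exists>K :: nat ring. field K \<and> finite (carrier K) \<and> [p] \<cdot>\<^bsub>K\<^esub> \<one>\<^bsub>K\<^esub> = \<zero>\<^bsub>K\<^esub> \<and>
    (\<forall>j>0. j dvd N \<longrightarrow> card (fixed_field K (p ^ j)) = p ^ j)"
proof -
  interpret Zp: residues_prime p "residue_ring (int p)"
    using p by (simp_all add: residues_prime_def)
  obtain L :: "((int list \<times> nat) multiset \<Rightarrow> int) ring" and K
    where L: "algebraic_closure L K" "Zp.indexed_const \<in> ring_hom (residue_ring (int p)) L"
    using Zp.exists_closure by metis
  interpret L: algebraic_closure L K by fact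
  interpret h: ring_hom_ring "residue_ring (int p)" L Zp.indexed_const
    using L(2) by (intro ring_hom_ringI2) (auto simp: Zp.ring_axioms L.ring_axioms)
  have "[n] \<cdot>\<^bsub>residue_ring (int p)\<^esub> \<one>\<^bsub>residue_ring (int p)\<^esub> = int n mod int p" for n
  proof (induction n)
    case (Suc n)
    then show ?case using Zp.add.nat_pow_Suc[of n "\<one>\<^bsub>residue_ring (int p)\<^esub>"]
      by (simp add: Zp.res_add_eq Zp.res_one_eq mod_simps add.commute)
  qed (simp add: Zp.res_zero_eq)
  then have "[p] \<cdot>\<^bsub>residue_ring (int p)\<^esub> \<one>\<^bsub>residue_ring (int p)\<^esub> = \<zero>\<^bsub>residue_ring (int p)\<^esub>"
    by (simp add: Zp.res_zero_eq)
  then have Lp: "[p] \<cdot>\<^bsub>L\<^esub> \<one>\<^bsub>L\<^esub> = \<zero>\<^bsub>L\<^esub>"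
    using h.hom_add_pow_one[of p] by simp
  define S where "S = fixed_field L (p ^ N)"
  have S: "subfield S L" unfolding S_def by (rule L.subfield_fixed_field[OF p Lp])
  have finS: "finite S" unfolding S_def by (rule L.card_fixed_field[OF p Lp N])
  interpret SF: field "L\<lparr>carrier := S\<rparr>" using L.subfield_iff(2)[OF S] .
  obtain e :: "((int list \<times> nat) multiset \<Rightarrow> int) \<Rightarrow> nat" where e: "inj_on e S"
    using finite_imp_inj_to_nat_seg[OF finS] by blast
  define K' where "K' = image_ring e (L\<lparr>carrier := S\<rparr>)"
  have iso: "e \<in> ring_iso (L\<lparr>carrier := S\<rparr>) K'"
    unfolding K'_def by (rule inj_imp_image_ring_iso) (use e in simp)
  have car: "carrier K' = e ` S" unfolding K'_def by (simp add: image_ring_carrier)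
  interpret K': field K' unfolding K'_def by (rule SF.inj_imp_image_ring_is_field) (use e in simp)
  interpret e: ring_hom_ring "L\<lparr>carrier := S\<rparr>" K' e
    using iso by (intro ring_hom_ringI2) (auto simp: ring_iso_def SF.ring_axioms K'.ring_axioms)
  interpret i: ring_hom_ring "L\<lparr>carrier := S\<rparr>" L "\<lambda>x. x"
    using S by (intro ring_hom_ringI2) (auto simp: ring_hom_def SF.ring_axioms L.ring_axioms dest: subfieldE(3))
  have "[p] \<cdot>\<^bsub>L\<lparr>carrier := S\<rparr>\<^esub> \<one>\<^bsub>L\<^esub> = \<zero>\<^bsub>L\<^esub>" using i.hom_add_pow_one[of p] Lp by simp
  then have "[p] \<cdot>\<^bsub>K'\<^esub> \<one>\<^bsub>K'\<^esub> = \<zero>\<^bsub>K'\<^esub>" using e.hom_add_pow_one[of p] e.hom_zero by simp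
  moreover have "card (fixed_field K' (p ^ j)) = p ^ j" if j: "j > 0" "j dvd N" for j
  proof -
    have sub: "fixed_field L (p ^ j) \<subseteq> S" unfolding S_def by (rule L.fixed_field_mono[OF j(2)])
    have "e x [^]\<^bsub>K'\<^esub> (p ^ j) = e x \<longleftrightarrow> x [^]\<^bsub>L\<^esub> (p ^ j) = x" if x: "x \<in> S" for x
    proof -
      have eq: "x [^]\<^bsub>L\<^esub> (p ^ j) = x [^]\<^bsub>L\<lparr>carrier := S\<rparr>\<^esub> (p ^ j)" using L.nat_pow_consistent by simp
      have "x [^]\<^bsub>L\<lparr>carrier := S\<rparr>\<^esub> (p ^ j) \<in> S" using SF.nat_pow_closed[of x "p ^ j"] x by simp
      moreover have "e (x [^]\<^bsub>L\<lparr>carrier := S\<rparr>\<^esub> (p ^ j)) = e x [^]\<^bsub>K'\<^esub> (p ^ j)"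
        using e.hom_nat_pow[of x "p ^ j"] x by simp
      ultimately show ?thesis unfolding eq using e x by (metis inj_on_eq_iff)
    qed
    then have "fixed_field K' (p ^ j) = e ` fixed_field L (p ^ j)"
      using sub S subfieldE(3)[OF S] unfolding fixed_field_def car by auto
    moreover have "inj_on e (fixed_field L (p ^ j))" using e sub by (rule inj_on_subset)
    ultimately show ?thesis using L.card_fixed_field[OF p Lp j(1)] by (simp add: card_image)
  qed
  ultimately show ?thesis using K'.field_axioms car finS by (intro exI[of _ K']) auto
qed

section \<open>Power series\<close>

definition power_series :: "('a, 'm) ring_scheme \<Rightarrow> (nat \<Rightarrow> 'a) ring" where
  "power_series R = \<lparr>carrier = {f. \<forall>n. f n \<in> carrier R},
     mult = (\<lambda>f g n. \<Oplus>\<^bsub>R\<^esub>i\<in>{..n}. f i \<otimes>\<^bsub>R\<^esub> g (n - i)),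
     one = (\<lambda>n. if n = 0 then \<one>\<^bsub>R\<^esub> else \<zero>\<^bsub>R\<^esub>),
     zero = (\<lambda>n. \<zero>\<^bsub>R\<^esub>),
     add = (\<lambda>f g n. f n \<oplus>\<^bsub>R\<^esub> g n)\<rparr>"

lemma power_series_simps [simp]:
  "f \<in> carrier (power_series R) \<longleftrightarrow> (\<forall>n. f n \<in> carrier R)"
  "\<one>\<^bsub>power_series R\<^esub> n = (if n = 0 then \<one>\<^bsub>R\<^esub> else \<zero>\<^bsub>R\<^esub>)"
  "\<zero>\<^bsub>power_series R\<^esub> n = \<zero>\<^bsub>R\<^esub>"
  "(f \<oplus>\<^bsub>power_series R\<^esub> g) n = f n \<oplus>\<^bsub>R\<^esub> g n"
  by (simp_all add: power_series_def)

lemma power_series_mult: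
  "(f \<otimes>\<^bsub>power_series R\<^esub> g) n = (\<Oplus>\<^bsub>R\<^esub>i\<in>{..n}. f i \<otimes>\<^bsub>R\<^esub> g (n - i))"
  by (simp add: power_series_def)

text \<open>The test \<open>i < n\<close> is redundant, but the termination prover does not see the range of the sum.\<close>

fun series_quotient :: "('a, 'm) ring_scheme \<Rightarrow> (nat \<Rightarrow> 'a) \<Rightarrow> (nat \<Rightarrow> 'a) \<Rightarrow> nat \<Rightarrow> nat \<Rightarrow> 'a" where
  "series_quotient R f g v n = inv\<^bsub>R\<^esub> (g v) \<otimes>\<^bsub>R\<^esub> (f (n + v) \<ominus>\<^bsub>R\<^esub>
     (\<Oplus>\<^bsub>R\<^esub>i\<in>{..<n}. if i < n then series_quotient R f g v i \<otimes>\<^bsub>R\<^esub> g (n + v - i) else \<zero>\<^bsub>R\<^esub>))"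

declare series_quotient.simps [simp del]

text \<open>The order of vanishing. Its value at the zero series is unspecified, which is why the
  facts about it exclude that series.\<close>

definition series_val :: "('a, 'm) ring_scheme \<Rightarrow> (nat \<Rightarrow> 'a) \<Rightarrow> nat" where
  "series_val R f = (LEAST n. f n \<noteq> \<zero>\<^bsub>R\<^esub>)"

context cring
begin

abbreviation "PS \<equiv> power_series R"

lemma PS_mult_closed [simp, intro]:
  "f \<in> carrier PS \<Longrightarrow> g \<in> carrier PS \<Longrightarrow> (f \<otimes>\<^bsub>PS\<^esub> g) n \<in> carrier R"
  by (simp add: power_series_mult)

text \<open>The coefficients of a product up to degree \<open>n\<close> depend only on those of the
  factors up to degree \<open>n\<close>. So associativity and commutativity are inherited from
  polynomials, one degree at a time.\<close>

lemma PS_mult_trunc: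
  assumes "f \<in> carrier PS" "g \<in> carrier PS" "p \<in> carrier (UP R)" "q \<in> carrier (UP R)"
    and "\<And>i. i \<le> n \<Longrightarrow> f i = p i" "\<And>i. i \<le> n \<Longrightarrow> g i = q i" "i \<le> n"
  shows "(f \<otimes>\<^bsub>PS\<^esub> g) i = (p \<otimes>\<^bsub>UP R\<^esub> q) i"
proof -
  have "(p \<otimes>\<^bsub>UP R\<^esub> q) i = (\<Oplus>j\<in>{..i}. p j \<otimes> q (i - j))"
    using assms(3,4) by (simp add: UP_def)
  also have "\<dots> = (\<Oplus>j\<in>{..i}. f j \<otimes> g (i - j))"
  proof (rule finsum_cong')
    fix j assume "j \<in> {..i}"
    then show "p j \<otimes> q (i - j) = f j \<otimes> g (i - j)" using assms(5)[of j] assms(6)[of "i - j"] assms(7) by simp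
  qed (use assms(1,2) in auto)
  finally show ?thesis by (simp add: power_series_mult)
qed

lemma PS_trunc_obtain:
  assumes "f \<in> carrier PS"
  obtains p where "p \<in> carrier (UP R)" "\<And>i. i \<le> n \<Longrightarrow> f i = p i"
proof
  show "(\<lambda>i. if i \<le> n then f i else \<zero>) \<in> carrier (UP R)"
    using assms by (auto simp: UP_def up_def intro!: exI[of _ n])
qed auto

text \<open>The typical case is a factor \<open>f\<close> with a gap after its constant term and a
  factor \<open>g\<close> that vanishes in low degrees: then only the constant term of
  \<open>f\<close> acts.\<close>

lemma PS_mult_const_term:
  assumes f: "f \<in> carrier PS" "g \<in> carrier PS"
    and z: "\<And>i. 0 < i \<Longrightarrow> i \<le> n \<Longrightarrow> f i = \<zero> \<or> g (n - i) = \<zero>"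
  shows "(f \<otimes>\<^bsub>PS\<^esub> g) n = f 0 \<otimes> g n"
proof -
  have "(f \<otimes>\<^bsub>PS\<^esub> g) n = (\<Oplus>i\<in>{..n}. if i = 0 then f i \<otimes> g (n - i) else \<zero>)"
    unfolding power_series_mult
  proof (rule finsum_cong')
    fix i assume i: "i \<in> {..n}"
    show "f i \<otimes> g (n - i) = (if i = 0 then f i \<otimes> g (n - i) else \<zero>)"
      using z[of i] i f by (cases "i = 0") auto
  qed (use f in auto)
  also have "\<dots> = f 0 \<otimes> g (n - 0)"
    by (rule add.finprod_singleton_swap) (use f in auto)
  finally show ?thesis by simp
qed

lemma PS_cring: "cring PS"
proof -
  interpret UP: UP_cring R "UP R" by (simp_all add: UP_cring_def cring_axioms)
  show ?thesis
  proof (rule cringI)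
    show "abelian_group PS"
    proof (rule abelian_groupI)
      fix x assume "x \<in> carrier PS"
      then show "\<exists>y\<in>carrier PS. y \<oplus>\<^bsub>PS\<^esub> x = \<zero>\<^bsub>PS\<^esub>"
        by (intro bexI[of _ "\<lambda>n. \<ominus> x n"]) (auto simp: l_neg)
    qed (auto simp: a_ac fun_eq_iff)
    show "comm_monoid PS"
    proof (rule comm_monoidI)
      fix x y z assume xyz: "x \<in> carrier PS" "y \<in> carrier PS" "z \<in> carrier PS"
      show "x \<otimes>\<^bsub>PS\<^esub> y \<otimes>\<^bsub>PS\<^esub> z = x \<otimes>\<^bsub>PS\<^esub> (y \<otimes>\<^bsub>PS\<^esub> z)"
      proof
        fix n
        obtain p where p: "p \<in> carrier (UP R)" "\<And>i. i \<le> n \<Longrightarrow> x i = p i" using PS_trunc_obtain xyz(1) by blast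
        obtain q where q: "q \<in> carrier (UP R)" "\<And>i. i \<le> n \<Longrightarrow> y i = q i" using PS_trunc_obtain xyz(2) by blast
        obtain r where r: "r \<in> carrier (UP R)" "\<And>i. i \<le> n \<Longrightarrow> z i = r i" using PS_trunc_obtain xyz(3) by blast
        have "(x \<otimes>\<^bsub>PS\<^esub> y \<otimes>\<^bsub>PS\<^esub> z) n = (p \<otimes>\<^bsub>UP R\<^esub> q \<otimes>\<^bsub>UP R\<^esub> r) n"
          by (rule PS_mult_trunc[where n = n]) (use xyz p q r PS_mult_trunc[OF xyz(1,2) p(1) q(1) p(2) q(2)] in auto)
        moreover have "(x \<otimes>\<^bsub>PS\<^esub> (y \<otimes>\<^bsub>PS\<^esub> z)) n = (p \<otimes>\<^bsub>UP R\<^esub> (q \<otimes>\<^bsub>UP R\<^esub> r)) n"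
          by (rule PS_mult_trunc[where n = n]) (use xyz p q r PS_mult_trunc[OF xyz(2,3) q(1) r(1) q(2) r(2)] in auto)
        ultimately show "(x \<otimes>\<^bsub>PS\<^esub> y \<otimes>\<^bsub>PS\<^esub> z) n = (x \<otimes>\<^bsub>PS\<^esub> (y \<otimes>\<^bsub>PS\<^esub> z)) n"
          using p q r by (simp add: UP.P.m_assoc)
      qed
    next
      fix x y assume xy: "x \<in> carrier PS" "y \<in> carrier PS"
      show "x \<otimes>\<^bsub>PS\<^esub> y = y \<otimes>\<^bsub>PS\<^esub> x"
      proof
        fix n
        obtain p where p: "p \<in> carrier (UP R)" "\<And>i. i \<le> n \<Longrightarrow> x i = p i" using PS_trunc_obtain xy(1) by blast
        obtain q where q: "q \<in> carrier (UP R)" "\<And>i. i \<le> n \<Longrightarrow> y i = q i" using PS_trunc_obtain xy(2) by blast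
        show "(x \<otimes>\<^bsub>PS\<^esub> y) n = (y \<otimes>\<^bsub>PS\<^esub> x) n"
          using PS_mult_trunc[OF xy p(1) q(1) p(2) q(2) order_refl] PS_mult_trunc[OF xy(2,1) q(1) p(1) q(2) p(2) order_refl]
            p q UP.P.m_comm by simp
      qed
    next
      fix x assume x: "x \<in> carrier PS"
      show "\<one>\<^bsub>PS\<^esub> \<otimes>\<^bsub>PS\<^esub> x = x"
      proof
        fix n
        show "(\<one>\<^bsub>PS\<^esub> \<otimes>\<^bsub>PS\<^esub> x) n = x n"
          using PS_mult_const_term[of "\<one>\<^bsub>PS\<^esub>" x n] x by simp
      qed
    qed auto
    fix x y z assume xyz: "x \<in> carrier PS" "y \<in> carrier PS" "z \<in> carrier PS"
    show "(x \<oplus>\<^bsub>PS\<^esub> y) \<otimes>\<^bsub>PS\<^esub> z = x \<otimes>\<^bsub>PS\<^esub> z \<oplus>\<^bsub>PS\<^esub> y \<otimes>\<^bsub>PS\<^esub> z"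
    proof
      fix n
      have "((x \<oplus>\<^bsub>PS\<^esub> y) \<otimes>\<^bsub>PS\<^esub> z) n = (\<Oplus>i\<in>{..n}. x i \<otimes> z (n - i) \<oplus> y i \<otimes> z (n - i))"
        unfolding power_series_mult by (rule finsum_cong') (use xyz in \<open>auto simp: l_distr\<close>)
      also have "\<dots> = (x \<otimes>\<^bsub>PS\<^esub> z \<oplus>\<^bsub>PS\<^esub> y \<otimes>\<^bsub>PS\<^esub> z) n"
        using xyz by (simp add: power_series_mult finsum_addf Pi_def)
      finally show "((x \<oplus>\<^bsub>PS\<^esub> y) \<otimes>\<^bsub>PS\<^esub> z) n = (x \<otimes>\<^bsub>PS\<^esub> z \<oplus>\<^bsub>PS\<^esub> y \<otimes>\<^bsub>PS\<^esub> z) n" .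
    qed
  qed
qed

lemma PS_minus:
  assumes "f \<in> carrier PS"
  shows "\<ominus>\<^bsub>PS\<^esub> f = (\<lambda>n. \<ominus> f n)"
proof -
  interpret PS: cring PS by (rule PS_cring)
  have "(\<lambda>n. \<ominus> f n) \<oplus>\<^bsub>PS\<^esub> f = \<zero>\<^bsub>PS\<^esub>" using assms by (auto simp: l_neg)
  then show ?thesis using assms by (intro PS.minus_equality) auto
qed

section \<open>Orders of vanishing and division of series\<close>

lemma PS_mult_low:
  assumes f: "f \<in> carrier PS" "g \<in> carrier PS"
    and a: "\<And>i. i < a \<Longrightarrow> f i = \<zero>" and b: "\<And>i. i < b \<Longrightarrow> g i = \<zero>"
  shows "n < a + b \<Longrightarrow> (f \<otimes>\<^bsub>PS\<^esub> g) n = \<zero>"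
    and "(f \<otimes>\<^bsub>PS\<^esub> g) (a + b) = f a \<otimes> g b"
proof -
  show "(f \<otimes>\<^bsub>PS\<^esub> g) n = \<zero>" if n: "n < a + b"
    unfolding power_series_mult
  proof (rule add.finprod_one_eqI)
    fix i assume "i \<in> {..n}"
    then have "i < a \<or> n - i < b" using n by auto
    then show "f i \<otimes> g (n - i) = \<zero>" using a b f by auto
  qed
  have "(f \<otimes>\<^bsub>PS\<^esub> g) (a + b) = (\<Oplus>i\<in>{..a + b}. if i = a then f i \<otimes> g (a + b - i) else \<zero>)"
    unfolding power_series_mult
  proof (rule finsum_cong')
    fix i assume "i \<in> {..a + b}"
    moreover have "i < a \<or> i = a \<or> a + b - i < b \<or> i > a + b" by auto
    ultimately show "f i \<otimes> g (a + b - i) = (if i = a then f i \<otimes> g (a + b - i) else \<zero>)"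
      using a b f by auto
  qed (use f in auto)
  also have "\<dots> = f a \<otimes> g (a + b - a)"
    by (rule add.finprod_singleton_swap) (use f in auto)
  finally show "(f \<otimes>\<^bsub>PS\<^esub> g) (a + b) = f a \<otimes> g b" by simp
qed

lemma series_val:
  assumes "f \<noteq> \<zero>\<^bsub>PS\<^esub>"
  shows "f (series_val R f) \<noteq> \<zero>" "i < series_val R f \<Longrightarrow> f i = \<zero>"
proof -
  obtain n where "f n \<noteq> \<zero>" using assms by (auto simp: power_series_def fun_eq_iff)
  then show "f (series_val R f) \<noteq> \<zero>" unfolding series_val_def by (rule LeastI)
  show "i < series_val R f \<Longrightarrow> f i = \<zero>" unfolding series_val_def by (auto dest: not_less_Least)
qed

lemma series_val_eqI:
  assumes "f n \<noteq> \<zero>" "\<And>i. i < n \<Longrightarrow> f i = \<zero>"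
  shows "series_val R f = n" "f \<noteq> \<zero>\<^bsub>PS\<^esub>"
proof -
  show "series_val R f = n" unfolding series_val_def
    by (rule Least_equality) (use assms in \<open>force simp: not_less[symmetric]\<close>)+
  show "f \<noteq> \<zero>\<^bsub>PS\<^esub>" using assms by auto
qed

end

lemma (in domain) series_val_mult:
  assumes fg: "f \<in> carrier PS" "g \<in> carrier PS" and "f \<noteq> \<zero>\<^bsub>PS\<^esub>" "g \<noteq> \<zero>\<^bsub>PS\<^esub>"
  shows "series_val R (f \<otimes>\<^bsub>PS\<^esub> g) = series_val R f + series_val R g" "f \<otimes>\<^bsub>PS\<^esub> g \<noteq> \<zero>\<^bsub>PS\<^esub>"
proof -
  let ?a = "series_val R f" and ?b = "series_val R g"
  have "(f \<otimes>\<^bsub>PS\<^esub> g) (?a + ?b) = f ?a \<otimes> g ?b" "\<And>n. n < ?a + ?b \<Longrightarrow> (f \<otimes>\<^bsub>PS\<^esub> g) n = \<zero>"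
    using PS_mult_low[OF fg, of ?a ?b] series_val(2)[OF assms(3)] series_val(2)[OF assms(4)] by auto
  moreover have "f ?a \<otimes> g ?b \<noteq> \<zero>" using series_val(1)[OF assms(3)] series_val(1)[OF assms(4)] integral fg by (metis power_series_simps(1))
  ultimately show "series_val R (f \<otimes>\<^bsub>PS\<^esub> g) = ?a + ?b" "f \<otimes>\<^bsub>PS\<^esub> g \<noteq> \<zero>\<^bsub>PS\<^esub>"
    using series_val_eqI[of "f \<otimes>\<^bsub>PS\<^esub> g" "?a + ?b"] by auto
qed

lemma (in domain) PS_domain: "domain PS"
proof -
  interpret PS: cring PS by (rule PS_cring)
  show ?thesis
  proof (rule domain.intro[OF PS_cring domain_axioms.intro])
    have "\<one>\<^bsub>PS\<^esub> 0 \<noteq> \<zero>\<^bsub>PS\<^esub> 0" by simp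
    then show "\<one>\<^bsub>PS\<^esub> \<noteq> \<zero>\<^bsub>PS\<^esub>" by metis
    show "a = \<zero>\<^bsub>PS\<^esub> \<or> b = \<zero>\<^bsub>PS\<^esub>" if "a \<otimes>\<^bsub>PS\<^esub> b = \<zero>\<^bsub>PS\<^esub>" "a \<in> carrier PS" "b \<in> carrier PS" for a b
      using series_val_mult(2)[of a b] that by blast
  qed
qed

text \<open>Comparing coefficients of degree \<open>n + v\<close> in f = g h expresses
  \<open>h n\<close> times the invertible \<open>g v\<close> through \<open>f (n + v)\<close> and
  earlier coefficients of \<open>h\<close>; \<open>series_quotient\<close> is this
  recursion.\<close>

lemma (in field) PS_divide:
  assumes f: "f \<in> carrier PS" and g: "g \<in> carrier PS" and v: "g v \<noteq> \<zero>"
    and low: "\<And>i. i < v \<Longrightarrow> g i = \<zero>" "\<And>i. i < v \<Longrightarrow> f i = \<zero>"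
  shows "\<exists>h\<in>carrier PS. f = g \<otimes>\<^bsub>PS\<^esub> h"
proof -
  interpret PS: cring PS by (rule PS_cring)
  define h where "h = series_quotient R f g v"
  have u: "g v \<in> Units R" using v g by (auto simp: field_Units)
  have h_eq: "h n = inv (g v) \<otimes> (f (n + v) \<ominus> (\<Oplus>i\<in>{..<n}. if i < n then h i \<otimes> g (n + v - i) else \<zero>))" for n
    unfolding h_def by (subst series_quotient.simps) simp
  have hc: "h n \<in> carrier R" for n
  proof (induction n rule: less_induct)
    case (less n)
    have "(\<lambda>i. if i < n then h i \<otimes> g (n + v - i) else \<zero>) \<in> {..<n} \<rightarrow> carrier R"
      using less g by auto
    then show ?case using f u by (subst h_eq) auto
  qed
  then have h: "h \<in> carrier PS" by simp
  have "f N = (g \<otimes>\<^bsub>PS\<^esub> h) N" for N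
  proof (cases "N < v")
    case True
    then show ?thesis using PS_mult_low(1)[OF g h, of v 0 N] low by simp
  next
    case False
    then obtain n where N: "N = n + v" by (metis add.commute le_Suc_ex not_less)
    have "(g \<otimes>\<^bsub>PS\<^esub> h) N = (\<Oplus>i\<in>{..N}. h i \<otimes> g (N - i))"
      using PS.m_comm[OF g h] by (simp add: power_series_mult)
    \<comment> \<open>For \<open>i > n\<close> the index \<open>N - i\<close> is below
      \<open>v\<close>, where \<open>g\<close> vanishes.\<close>
    also have "\<dots> = (\<Oplus>i\<in>{..n}. h i \<otimes> g (N - i))"
      by (rule add.finprod_mono_neutral_cong_right) (use low g hc N in auto)
    also have "\<dots> = h n \<otimes> g v \<oplus> (\<Oplus>i\<in>{..<n}. h i \<otimes> g (N - i))"
      using add.finprod_Suc3[of "\<lambda>i. h i \<otimes> g (N - i)" n] g hc N by (simp add: Pi_def)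
    also have "(\<Oplus>i\<in>{..<n}. h i \<otimes> g (N - i)) = (\<Oplus>i\<in>{..<n}. if i < n then h i \<otimes> g (n + v - i) else \<zero>)"
      by (rule finsum_cong') (use g hc N in auto)
    also have "h n \<otimes> g v = f N \<ominus> (\<Oplus>i\<in>{..<n}. if i < n then h i \<otimes> g (n + v - i) else \<zero>)" (is "_ = _ \<ominus> ?S")
    proof -
      have S: "?S \<in> carrier R" using g hc by (intro finsum_closed) auto
      have gv: "g v \<in> carrier R" "inv (g v) \<in> carrier R" using u by auto
      have w: "f N \<ominus> ?S \<in> carrier R" using f S by simp
      have "h n = inv (g v) \<otimes> (f N \<ominus> ?S)" unfolding N by (rule h_eq)
      then have "h n \<otimes> g v = inv (g v) \<otimes> (f N \<ominus> ?S) \<otimes> g v" by simp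
      also have "\<dots> = (f N \<ominus> ?S) \<otimes> (inv (g v) \<otimes> g v)"
        using w gv by (simp only: m_ac m_closed)
      finally show ?thesis using u w by (simp only: Units_l_inv r_one)
    qed
    finally have *: "(g \<otimes>\<^bsub>PS\<^esub> h) N = f N \<ominus> ?S \<oplus> ?S" .
    have S: "?S \<in> carrier R" using g hc by (intro finsum_closed) auto
    show ?thesis unfolding * using f S by (simp add: minus_eq a_assoc l_neg)
  qed
  then show ?thesis using h by blast
qed

section \<open>The local rings \<open>k + t\<^sup>s R[[t]]\<close>\<close>

text \<open>Over a field, \<open>s = 1\<close> with \<open>k\<close> the whole field gives the
  discrete valuation ring, whose only atom up to associates is prime. More atoms arise in two
  independent ways: a larger gap \<open>s\<close> or a proper subfield \<open>k\<close>.\<close>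

definition series_from :: "('a, 'm) ring_scheme \<Rightarrow> 'a set \<Rightarrow> nat \<Rightarrow> (nat \<Rightarrow> 'a) ring" where
  "series_from R k s = power_series R\<lparr>carrier :=
     {f \<in> carrier (power_series R). f 0 \<in> k \<and> (\<forall>n. 0 < n \<and> n < s \<longrightarrow> f n = \<zero>\<^bsub>R\<^esub>)}\<rparr>"

lemma series_from_simps [simp]:
  "f \<in> carrier (series_from R k s) \<longleftrightarrow>
     f \<in> carrier (power_series R) \<and> f 0 \<in> k \<and> (\<forall>n. 0 < n \<and> n < s \<longrightarrow> f n = \<zero>\<^bsub>R\<^esub>)"
  "\<one>\<^bsub>series_from R k s\<^esub> = \<one>\<^bsub>power_series R\<^esub>"
  "\<zero>\<^bsub>series_from R k s\<^esub> = \<zero>\<^bsub>power_series R\<^esub>"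
  "f \<oplus>\<^bsub>series_from R k s\<^esub> g = f \<oplus>\<^bsub>power_series R\<^esub> g"
  "f \<otimes>\<^bsub>series_from R k s\<^esub> g = f \<otimes>\<^bsub>power_series R\<^esub> g"
  by (simp_all add: series_from_def)

lemma uncountable_nat_sets: "uncountable (UNIV :: nat set set)"
proof
  assume "countable (UNIV :: nat set set)"
  then have "range (from_nat_into (UNIV :: nat set set)) = UNIV"
    by (intro range_from_nat_into) auto
  then show False using Cantors_theorem[of "UNIV :: nat set"] by auto
qed

locale truncated_series = field R for R (structure) +
  fixes k :: "'a set" and s :: nat
  assumes finite_carrier: "finite (carrier R)" and k: "subfield k R" and s: "s > 0"
begin

abbreviation "L \<equiv> series_from R k s"

lemma k_props: "k \<subseteq> carrier R" "\<zero> \<in> k" "\<one> \<in> k"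
    "\<And>x y. x \<in> k \<Longrightarrow> y \<in> k \<Longrightarrow> x \<otimes> y \<in> k" "\<And>x y. x \<in> k \<Longrightarrow> y \<in> k \<Longrightarrow> x \<oplus> y \<in> k"
    "\<And>x. x \<in> k \<Longrightarrow> \<ominus> x \<in> k"
  using subringE[OF subfieldE(1)[OF k]] by auto

lemma finite_k: "finite k" using finite_subset[OF k_props(1) finite_carrier] .

sublocale PS: "domain" PS by (rule PS_domain)

lemma subring_L: "subring (carrier L) PS"
proof (rule PS.subringI)
  show "h1 \<otimes>\<^bsub>PS\<^esub> h2 \<in> carrier L" if h: "h1 \<in> carrier L" "h2 \<in> carrier L" for h1 h2
  proof -
    have c: "h1 \<in> carrier PS" "h2 \<in> carrier PS" using h by auto
    have "(h1 \<otimes>\<^bsub>PS\<^esub> h2) n = h1 0 \<otimes> h2 n" if "n < s" for n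
      by (rule PS_mult_const_term[OF c]) (use h that in auto)
    moreover have "h1 \<otimes>\<^bsub>PS\<^esub> h2 \<in> carrier PS" using c by (rule PS.m_closed)
    ultimately show ?thesis using h c k_props s by simp
  qed
qed (use k_props in \<open>auto simp: PS_minus\<close>)

sublocale L: "domain" L
proof -
  have "L = PS\<lparr>carrier := carrier L\<rparr>" by (simp add: series_from_def)
  then show "domain L" using PS.subring_is_domain[OF subring_L] by simp
qed

lemma L_PS: "f \<in> carrier L \<Longrightarrow> f \<in> carrier PS" by simp

abbreviation "val \<equiv> series_val R"

lemma val_cases:
  assumes "f \<in> carrier L" "f \<noteq> \<zero>\<^bsub>PS\<^esub>"
  shows "val f = 0 \<or> s \<le> val f"
  using assms series_val(1)[OF assms(2)] by (metis series_from_simps(1) neq0_conv not_less)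

lemma val_0: "f \<noteq> \<zero>\<^bsub>PS\<^esub> \<Longrightarrow> val f = 0 \<longleftrightarrow> f 0 \<noteq> \<zero>"
  using series_val[of f] by (metis neq0_conv)

lemma val_mult:
  assumes "f \<in> carrier L" "g \<in> carrier L" "f \<noteq> \<zero>\<^bsub>PS\<^esub>" "g \<noteq> \<zero>\<^bsub>PS\<^esub>"
  shows "val (f \<otimes>\<^bsub>PS\<^esub> g) = val f + val g"
  using series_val_mult(1)[OF L_PS L_PS] assms by blast

text \<open>The quotient is formed in the full power series ring. As orders add up, it vanishes
  below degree \<open>s\<close>, and such series all lie in \<open>L\<close>.\<close>

lemma low_quotient:
  assumes a: "a \<in> carrier PS" "a \<noteq> \<zero>\<^bsub>PS\<^esub>" and b: "b \<in> carrier PS"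
    and low: "\<And>i. i < val a + s \<Longrightarrow> b i = \<zero>"
  shows "\<exists>h\<in>carrier PS. b = a \<otimes>\<^bsub>PS\<^esub> h \<and> (\<forall>n<s. h n = \<zero>)"
proof -
  obtain h where h: "h \<in> carrier PS" "b = a \<otimes>\<^bsub>PS\<^esub> h"
    using PS_divide[OF b a(1) series_val(1)[OF a(2)] series_val(2)[OF a(2)]] low by auto
  have "h n = \<zero>" if n: "n < s" for n
  proof (cases "h = \<zero>\<^bsub>PS\<^esub>")
    case False
    have "b (val a + val h) \<noteq> \<zero>"
      using series_val_mult[OF a(1) h(1) a(2) False] series_val(1) h(2) by metis
    then have "s \<le> val h" using low by (metis add_less_cancel_left not_less)
    then show ?thesis using series_val(2)[OF False] n by auto
  qed simp
  then show ?thesis using h by blast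
qed

lemma in_LI: "h \<in> carrier PS \<Longrightarrow> (\<And>n. n < s \<Longrightarrow> h n = \<zero>) \<Longrightarrow> h \<in> carrier L"
  using k_props s by auto

lemma divides_high:
  assumes a: "a \<in> carrier L" "a \<noteq> \<zero>\<^bsub>PS\<^esub>" and b: "b \<in> carrier L" "b \<noteq> \<zero>\<^bsub>PS\<^esub>" and le: "val a + s \<le> val b"
  shows "a divides\<^bsub>L\<^esub> b"
proof -
  obtain h where h: "h \<in> carrier PS" "b = a \<otimes>\<^bsub>PS\<^esub> h" "\<forall>n<s. h n = \<zero>"
    using low_quotient[OF L_PS[OF a(1)] a(2) L_PS[OF b(1)]] series_val(2)[OF b(2)] le by auto
  have "h \<in> carrier L" using h in_LI by blast
  then show ?thesis using h(2) by (intro dividesI) auto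
qed

definition const :: "'a \<Rightarrow> nat \<Rightarrow> 'a" where
  "const c = (\<lambda>n. if n = 0 then c else \<zero>)"

lemma const_in_L [simp]: "c \<in> k \<Longrightarrow> const c \<in> carrier L"
  using k_props by (auto simp: const_def)

lemma const_mult:
  assumes "c \<in> carrier R" "f \<in> carrier PS"
  shows "(const c \<otimes>\<^bsub>PS\<^esub> f) n = c \<otimes> f n"
  using PS_mult_const_term[of "const c" f n] assms by (simp add: const_def)

lemma const_hom: "const \<in> ring_hom (R\<lparr>carrier := k\<rparr>) L"
proof (rule ring_hom_memI)
  fix x y assume "x \<in> carrier (R\<lparr>carrier := k\<rparr>)" "y \<in> carrier (R\<lparr>carrier := k\<rparr>)"
  then have xy: "x \<in> carrier R" "y \<in> carrier R" using k_props by auto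
  show "const (x \<otimes>\<^bsub>R\<lparr>carrier := k\<rparr>\<^esub> y) = const x \<otimes>\<^bsub>L\<^esub> const y"
    using xy const_mult[of x "const y"] by (auto simp: const_def fun_eq_iff)
  show "const (x \<oplus>\<^bsub>R\<lparr>carrier := k\<rparr>\<^esub> y) = const x \<oplus>\<^bsub>L\<^esub> const y"
    using xy by (auto simp: const_def fun_eq_iff)
qed (use const_in_L in \<open>auto simp: const_def fun_eq_iff\<close>)

text \<open>Subtracting \<open>c\<close> times \<open>a\<close> from \<open>b\<close> leaves a
  series vanishing below degree \<open>val a + s\<close>. By \<open>low_quotient\<close> this is
  \<open>a\<close> times some \<open>h\<close> in \<open>L\<close>, so the quotient of
  \<open>b\<close> by \<open>a\<close> is \<open>c + h\<close>.\<close>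

lemma divides_proportional:
  assumes a: "a \<in> carrier L" "a \<noteq> \<zero>\<^bsub>PS\<^esub>" and b: "b \<in> carrier L"
    and c: "c \<in> k" and low: "\<And>n. n < val a \<Longrightarrow> b n = \<zero>"
    and proport: "\<And>n. n < s \<Longrightarrow> b (val a + n) = c \<otimes> a (val a + n)"
  shows "a divides\<^bsub>L\<^esub> b"
proof -
  have cc: "c \<in> carrier R" "const c \<in> carrier PS" using c k_props(1) by (auto simp: const_def)
  have ab: "a \<in> carrier PS" "b \<in> carrier PS" using a b by auto
  define d where "d = b \<ominus>\<^bsub>PS\<^esub> const c \<otimes>\<^bsub>PS\<^esub> a"
  have ca: "const c \<otimes>\<^bsub>PS\<^esub> a \<in> carrier PS" using cc ab by (intro PS.m_closed)
  have d: "d \<in> carrier PS" unfolding d_def using ca ab by (intro PS.minus_closed)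
  have dn: "d n = b n \<ominus> c \<otimes> a n" for n
    unfolding d_def PS.minus_eq PS_minus[OF ca] using const_mult[OF cc(1) ab(1)] by (simp add: minus_eq)
  have "d i = \<zero>" if i: "i < val a + s" for i
  proof (cases "i < val a")
    case True
    then show ?thesis unfolding dn using low series_val(2)[OF a(2)] cc by simp
  next
    case False
    then have "i = val a + (i - val a)" "i - val a < s" using i by auto
    then have "b i = c \<otimes> a i" using proport by metis
    moreover have "c \<otimes> a i \<in> carrier R" using cc ab by auto
    ultimately show ?thesis unfolding dn by simp
  qed
  then obtain h where h: "h \<in> carrier PS" "d = a \<otimes>\<^bsub>PS\<^esub> h" "\<forall>n<s. h n = \<zero>"
    using low_quotient[OF ab(1) a(2) d] by auto
  have hL: "h \<in> carrier L" using h in_LI by blast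
  have "b = const c \<otimes>\<^bsub>PS\<^esub> a \<oplus>\<^bsub>PS\<^esub> d"
    unfolding d_def using ca ab by (simp add: PS.minus_eq PS.a_ac PS.r_neg2 PS.r_neg del: power_series_simps)
  also have "\<dots> = a \<otimes>\<^bsub>PS\<^esub> (const c \<oplus>\<^bsub>PS\<^esub> h)"
    unfolding h(2) using PS.r_distr[OF cc(2) h(1) ab(1)] PS.m_comm[OF cc(2) ab(1)] by simp
  finally show ?thesis using L.a_closed[OF const_in_L[OF c] hL] by (intro dividesI) auto
qed

lemma Units_L: "f \<in> Units L \<longleftrightarrow> f \<in> carrier L \<and> f 0 \<noteq> \<zero>"
proof
  assume f: "f \<in> Units L"
  then obtain g where g: "g \<in> carrier L" "f \<otimes>\<^bsub>PS\<^esub> g = \<one>\<^bsub>PS\<^esub>" and fc: "f \<in> carrier L"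
    unfolding Units_def by auto
  have "(f \<otimes>\<^bsub>PS\<^esub> g) 0 = f 0 \<otimes> g 0" by (rule PS_mult_const_term[OF L_PS[OF fc] L_PS[OF g(1)]]) auto
  then show "f \<in> carrier L \<and> f 0 \<noteq> \<zero>" using g fc by auto
next
  assume f: "f \<in> carrier L \<and> f 0 \<noteq> \<zero>"
  then have "f \<noteq> \<zero>\<^bsub>PS\<^esub>" by auto
  then have v: "val f = 0" using f val_0 by blast
  have f0: "f 0 \<in> k - {\<zero>}" using f by auto
  \<comment> \<open>Below degree \<open>s\<close> both \<open>f\<close> and 1 consist of their
    constant terms only, hence are proportional with a factor from \<open>k\<close>.\<close>
  have "f divides\<^bsub>L\<^esub> \<one>\<^bsub>L\<^esub>"
  proof (rule divides_proportional)
    show "inv (f 0) \<in> k" using subfield_m_inv(1)[OF k f0] by auto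
    show "\<one>\<^bsub>L\<^esub> (val f + n) = inv (f 0) \<otimes> f (val f + n)" if "n < s" for n
      using v f that subfield_m_inv[OF k f0] k_props by (cases "n = 0") auto
    show "\<one>\<^bsub>L\<^esub> \<in> carrier L" by (rule L.one_closed)
  qed (use f v \<open>f \<noteq> \<zero>\<^bsub>PS\<^esub>\<close> in auto)
  then show "f \<in> Units L" using L.divides_unit f by blast
qed

lemma Units_L_val: "f \<in> carrier L \<Longrightarrow> f \<noteq> \<zero>\<^bsub>PS\<^esub> \<Longrightarrow> f \<in> Units L \<longleftrightarrow> val f = 0"
  using Units_L val_0 by blast

text \<open>After its constant term \<open>u\<close> has no term before degree \<open>s\<close>, too
  late to affect the first \<open>s\<close> coefficients of \<open>a\<close> counted from its
  order.\<close>

lemma unit_mult_lead: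
  assumes a: "a \<in> carrier L" "a \<noteq> \<zero>\<^bsub>PS\<^esub>" and u: "u \<in> carrier L" and n: "n < s"
  shows "(u \<otimes>\<^bsub>PS\<^esub> a) (val a + n) = u 0 \<otimes> a (val a + n)"
proof (rule PS_mult_const_term[OF L_PS[OF u] L_PS[OF a(1)]])
  fix i assume i: "0 < i" "i \<le> val a + n"
  then have "i < s \<or> val a + n - i < val a" using n by auto
  then show "u i = \<zero> \<or> a (val a + n - i) = \<zero>"
    using i(1) u series_val(2)[OF a(2)] by auto
qed

lemma uncountable_Units_L: "uncountable (Units L)"
proof -
  \<comment> \<open>A set \<open>A\<close> of naturals is coded in the coefficients from degree
    \<open>s\<close> on, which are unrestricted; the constant term 1 makes the series a
    unit.\<close>
  define f where "f A = (\<lambda>n. if n = 0 \<or> (s \<le> n \<and> n - s \<in> A) then \<one> else \<zero>)" for A :: "nat set"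
  have "range f \<subseteq> Units L" using s k_props by (auto simp: Units_L f_def)
  moreover have "inj f"
  proof (rule injI)
    fix A B assume eq: "f A = f B"
    have "m \<in> A \<longleftrightarrow> f A (m + s) = \<one>" for m A using s by (simp add: f_def)
    then show "A = B" using eq by auto
  qed
  ultimately show ?thesis
    using uncountable_nat_sets countable_image_inj_eq countable_subset by metis
qed

section \<open>Associate classes as orbits of leading coefficients\<close>

definition lead :: "(nat \<Rightarrow> 'a) \<Rightarrow> nat \<Rightarrow> 'a" where
  "lead a = (\<lambda>n\<in>{..<s}. a (val a + n))"

definition leads :: "(nat \<Rightarrow> 'a) set" where
  "leads = {x \<in> {..<s} \<rightarrow>\<^sub>E carrier R. x 0 \<noteq> \<zero>}"

text \<open>A unit acts on the first \<open>s\<close> coefficients of a series through its constant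
  term, which ranges over the nonzero elements of \<open>k\<close>. The orbit is therefore what
  remains of these coefficients up to associates.\<close>

definition orbit :: "(nat \<Rightarrow> 'a) \<Rightarrow> (nat \<Rightarrow> 'a) set" where
  "orbit x = (\<lambda>c. \<lambda>n\<in>{..<s}. c \<otimes> x n) ` (k - {\<zero>})"

lemma lead_in_leads: "a \<in> carrier L \<Longrightarrow> a \<noteq> \<zero>\<^bsub>PS\<^esub> \<Longrightarrow> lead a \<in> leads"
  using s series_val(1)[of a] by (auto simp: lead_def leads_def)

lemma leadsD: "x \<in> leads \<Longrightarrow> n < s \<Longrightarrow> x n \<in> carrier R" "x \<in> leads \<Longrightarrow> x 0 \<noteq> \<zero>"
  by (auto simp: leads_def)

lemma orbit_self:
  assumes "x \<in> leads"
  shows "x \<in> orbit x"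
proof -
  have "x = (\<lambda>n\<in>{..<s}. \<one> \<otimes> x n)"
  proof
    fix n
    show "x n = (\<lambda>n\<in>{..<s}. \<one> \<otimes> x n) n"
      using leadsD(1)[OF assms, of n] PiE_arb[of x "{..<s}" "\<lambda>_. carrier R" n] assms
      by (cases "n < s") (auto simp: leads_def)
  qed
  then show ?thesis unfolding orbit_def using k_props by (intro image_eqI[where x = \<one>]) auto
qed

lemma orbit_subset:
  assumes "x \<in> leads" "y \<in> orbit x"
  shows "orbit y \<subseteq> orbit x"
proof
  fix z assume "z \<in> orbit y"
  then obtain c where c: "c \<in> k - {\<zero>}" "z = (\<lambda>n\<in>{..<s}. c \<otimes> y n)" by (auto simp: orbit_def)
  obtain d where d: "d \<in> k - {\<zero>}" "y = (\<lambda>n\<in>{..<s}. d \<otimes> x n)" using assms by (auto simp: orbit_def)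
  have car: "c \<in> carrier R" "d \<in> carrier R" using c d k_props by auto
  have "z = (\<lambda>n\<in>{..<s}. (c \<otimes> d) \<otimes> x n)"
    unfolding c(2) d(2) using car leadsD(1)[OF assms(1)] by (auto simp: fun_eq_iff m_assoc)
  moreover have "c \<otimes> d \<in> k - {\<zero>}" using c d car k_props(4) integral by auto
  ultimately show "z \<in> orbit x" unfolding orbit_def by blast
qed

lemma orbit_leads:
  assumes "x \<in> leads"
  shows "orbit x \<subseteq> leads"
proof
  fix y assume "y \<in> orbit x"
  then obtain c where c: "c \<in> k - {\<zero>}" "y = (\<lambda>n\<in>{..<s}. c \<otimes> x n)" by (auto simp: orbit_def)
  have cc: "c \<in> carrier R" using c(1) k_props(1) by auto
  have "y \<in> {..<s} \<rightarrow>\<^sub>E carrier R" unfolding c(2) using cc leadsD(1)[OF assms] by auto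
  moreover have "y 0 \<noteq> \<zero>"
    using c cc leadsD(1)[OF assms s] leadsD(2)[OF assms] s integral[of c "x 0"] by auto
  ultimately show "y \<in> leads" by (simp add: leads_def)
qed

lemma orbit_sym:
  assumes x: "x \<in> leads" and y: "y \<in> orbit x"
  shows "x \<in> orbit y"
proof -
  obtain d where d: "d \<in> k - {\<zero>}" "y = (\<lambda>n\<in>{..<s}. d \<otimes> x n)" using y by (auto simp: orbit_def)
  have i: "inv d \<in> k - {\<zero>}" "inv d \<otimes> d = \<one>" using subfield_m_inv[OF k d(1)] by auto
  have car: "inv d \<in> carrier R" "d \<in> carrier R" using i d k_props by auto
  have "inv d \<otimes> (d \<otimes> x n) = x n" if "n < s" for n
    using car leadsD(1)[OF x that] i(2) by (simp flip: m_assoc)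
  then have "x = (\<lambda>n\<in>{..<s}. inv d \<otimes> y n)"
    using x by (auto simp: d(2) leads_def PiE_def extensional_def fun_eq_iff)
  then show ?thesis unfolding orbit_def using i by blast
qed

lemma orbit_eq_iff:
  assumes "x \<in> leads" "y \<in> leads"
  shows "orbit x = orbit y \<longleftrightarrow> y \<in> orbit x"
  using orbit_self[OF assms(2)] orbit_subset[OF assms(1)] orbit_subset[OF assms(2)] orbit_sym[OF assms(1)] by blast

lemma finite_leads: "finite leads"
  by (rule finite_subset[of _ "{..<s} \<rightarrow>\<^sub>E carrier R"]) (use finite_carrier in \<open>auto simp: leads_def finite_PiE\<close>)

text \<open>The nonzero elements of \<open>k\<close> act freely, because the entry
  \<open>x 0\<close> is nonzero and can be cancelled.\<close>

lemma card_orbit: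
  assumes "x \<in> leads"
  shows "card (orbit x) = card k - 1"
proof -
  have "inj_on (\<lambda>c. \<lambda>n\<in>{..<s}. c \<otimes> x n) (k - {\<zero>})"
  proof (rule inj_onI)
    fix c d assume cd: "c \<in> k - {\<zero>}" "d \<in> k - {\<zero>}" "(\<lambda>n\<in>{..<s}. c \<otimes> x n) = (\<lambda>n\<in>{..<s}. d \<otimes> x n)"
    then have "c \<otimes> x 0 = d \<otimes> x 0" using s by (metis lessThan_iff restrict_apply')
    then show "c = d" using cd leadsD[OF assms] s k_props m_rcancel[of "x 0" c d] by auto
  qed
  then show ?thesis unfolding orbit_def using k_props(2) finite_k by (simp add: card_image)
qed

lemma card_orbits: "(card k - 1) * card (orbit ` leads) = card leads"
proof -
  have "\<Union>(orbit ` leads) = leads" using orbit_leads orbit_self by blast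
  moreover have "(card k - 1) * card (orbit ` leads) = card (\<Union>(orbit ` leads))"
  proof (rule card_partition)
    show "finite (orbit ` leads)" using finite_leads by simp
    show "finite (\<Union>(orbit ` leads))" using calculation finite_leads by simp
    show "card c = card k - 1" if "c \<in> orbit ` leads" for c using that card_orbit by auto
    show "c1 \<inter> c2 = {}" if c: "c1 \<in> orbit ` leads" "c2 \<in> orbit ` leads" "c1 \<noteq> c2" for c1 c2
    proof (rule ccontr)
      assume "c1 \<inter> c2 \<noteq> {}"
      then obtain x y z where *: "x \<in> leads" "c1 = orbit x" "y \<in> leads" "c2 = orbit y" "z \<in> orbit x" "z \<in> orbit y"
        using c by auto
      then have "z \<in> leads" using orbit_leads by blast
      then have "orbit x = orbit z" "orbit y = orbit z" using * orbit_eq_iff by blast+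
      then show False using c * by simp
    qed
  qed
  ultimately show ?thesis by simp
qed

lemma card_leads: "card leads = (card (carrier R) - 1) * card (carrier R) ^ (s - 1)"
proof -
  obtain m where m: "s = Suc m" using s by (cases s) auto
  have "leads = (\<Pi>\<^sub>E n\<in>{..<s}. if n = 0 then carrier R - {\<zero>} else carrier R)"
  proof -
    have mem: "y \<in> (if n = 0 then carrier R - {\<zero>} else carrier R) \<longleftrightarrow> y \<in> carrier R \<and> (n = 0 \<longrightarrow> y \<noteq> \<zero>)"
      for y and n :: nat by simp
    show ?thesis using s by (simp only: set_eq_iff leads_def mem_Collect_eq PiE_iff mem lessThan_iff) blast
  qed
  then have "card leads = (\<Prod>n<s. card (if n = 0 then carrier R - {\<zero>} else carrier R))"
    by (simp add: card_PiE)
  also have "\<dots> = (card (carrier R) - 1) * card (carrier R) ^ m"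
    unfolding m prod.lessThan_Suc_shift by simp
  finally show ?thesis by (simp add: m)
qed

text \<open>A unit preserves the order and scales the leading coefficients by
  \<open>unit_mult_lead\<close>. Conversely, equal orders and proportional leading coefficients give
  divisibility in both directions by \<open>divides_proportional\<close>.\<close>

lemma associated_L_iff:
  assumes a: "a \<in> carrier L" "a \<noteq> \<zero>\<^bsub>PS\<^esub>" and b: "b \<in> carrier L" "b \<noteq> \<zero>\<^bsub>PS\<^esub>"
  shows "a \<sim>\<^bsub>L\<^esub> b \<longleftrightarrow> val a = val b \<and> orbit (lead a) = orbit (lead b)"
proof
  assume "a \<sim>\<^bsub>L\<^esub> b"
  then obtain u where u: "u \<in> Units L" "b = u \<otimes>\<^bsub>PS\<^esub> a"
    using L.ring_associated_iff[OF b(1) a(1)] L.associated_sym by auto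
  have uL: "u \<in> carrier L" "u 0 \<noteq> \<zero>" using u Units_L by auto
  then have "u \<noteq> \<zero>\<^bsub>PS\<^esub>" by auto
  then have v: "val b = val a" unfolding u(2) using val_mult[OF uL(1) a(1)] a(2) Units_L_val[OF uL(1)] u(1) by simp
  have "lead b = (\<lambda>n\<in>{..<s}. u 0 \<otimes> lead a n)"
    unfolding lead_def v unfolding u(2) using unit_mult_lead[OF a uL(1)] by (auto simp: fun_eq_iff)
  then have "lead b \<in> orbit (lead a)" unfolding orbit_def using uL by auto
  then show "val a = val b \<and> orbit (lead a) = orbit (lead b)"
    using v orbit_eq_iff[OF lead_in_leads[OF a] lead_in_leads[OF b]] by auto
next
  have div: "x divides\<^bsub>L\<^esub> y"
    if x: "x \<in> carrier L" "x \<noteq> \<zero>\<^bsub>PS\<^esub>" and y: "y \<in> carrier L" "y \<noteq> \<zero>\<^bsub>PS\<^esub>"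
      and v: "val x = val y" and o: "orbit (lead x) = orbit (lead y)" for x y
  proof -
    have "lead y \<in> orbit (lead x)" using orbit_self[OF lead_in_leads[OF y]] o by simp
    then obtain c where c: "c \<in> k - {\<zero>}" "lead y = (\<lambda>n\<in>{..<s}. c \<otimes> lead x n)" by (auto simp: orbit_def)
    have "y (val x + n) = c \<otimes> x (val x + n)" if "n < s" for n
      using fun_cong[OF c(2), of n] that v by (simp add: lead_def)
    then show ?thesis using divides_proportional[OF x y(1), of c] c series_val(2)[OF y(2)] v by auto
  qed
  assume "val a = val b \<and> orbit (lead a) = orbit (lead b)"
  then show "a \<sim>\<^bsub>L\<^esub> b" using div a b by (auto simp: associated_def)
qed

section \<open>The atoms of the local rings\<close>

definition with_lead :: "nat \<Rightarrow> (nat \<Rightarrow> 'a) \<Rightarrow> nat \<Rightarrow> 'a" where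
  "with_lead v x = (\<lambda>n. if v \<le> n \<and> n < v + s then x (n - v) else \<zero>)"

lemma with_lead:
  assumes x: "x \<in> leads" and v: "s \<le> v"
  shows "with_lead v x \<in> carrier L" "with_lead v x \<noteq> \<zero>\<^bsub>PS\<^esub>" "val (with_lead v x) = v" "lead (with_lead v x) = x"
proof -
  show c: "with_lead v x \<in> carrier L" using leadsD(1)[OF x] v s k_props by (auto simp: with_lead_def)
  have "with_lead v x v \<noteq> \<zero>" "\<And>i. i < v \<Longrightarrow> with_lead v x i = \<zero>" using leadsD(2)[OF x] s by (auto simp: with_lead_def)
  then show "with_lead v x \<noteq> \<zero>\<^bsub>PS\<^esub>" "val (with_lead v x) = v"
    using series_val_eqI[of "with_lead v x" v] by blast+
  then show "lead (with_lead v x) = x" using x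
    by (auto simp: lead_def with_lead_def leads_def PiE_def extensional_def fun_eq_iff)
qed

lemma leads_nonempty: "leads \<noteq> {}"
proof -
  have "(\<lambda>n\<in>{..<s}. \<one>) \<in> leads" using s by (auto simp: leads_def)
  then show ?thesis by blast
qed

text \<open>Nonunits have order at least \<open>s\<close>, so a product of two of them has order at
  least \<open>2 * s\<close>. Conversely, from order \<open>2 * s\<close> on, any element of order
  \<open>s\<close> can be split off by \<open>divides_high\<close>, and the cofactor still has order
  at least \<open>s\<close>.\<close>

lemma atom_L_iff: "atom L a \<longleftrightarrow> a \<in> carrier L \<and> a \<noteq> \<zero>\<^bsub>PS\<^esub> \<and> s \<le> val a \<and> val a < 2 * s"
proof
  assume at: "atom L a"
  have a: "a \<in> carrier L" "a \<noteq> \<zero>\<^bsub>PS\<^esub>" "a \<notin> Units L"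
    using atom_in_carrier[OF at] at by (auto simp: atom_def nonzero_nonunits_def)
  have "s \<le> val a" using val_cases[OF a(1,2)] Units_L_val[OF a(1,2)] a(3) by auto
  moreover have "val a < 2 * s"
  proof (rule ccontr)
    assume "\<not> val a < 2 * s"
    then have v: "2 * s \<le> val a" by simp
    obtain x where x: "x \<in> leads" using leads_nonempty by blast
    define p where "p = with_lead s x"
    note p = with_lead[OF x order_refl, folded p_def]
    obtain b where b': "b \<in> carrier L" "a = p \<otimes>\<^bsub>L\<^esub> b"
      using divides_high[OF p(1,2) a(1,2)] v p(3) unfolding factor_def by auto
    then have b: "b \<in> carrier L" "a = p \<otimes>\<^bsub>PS\<^esub> b" by auto
    have "b \<noteq> \<zero>\<^bsub>PS\<^esub>" using b a p by (metis PS.r_null L_PS)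
    then have "val a = val p + val b" using val_mult p b by blast
    then have "p \<notin> Units L" "b \<notin> Units L" using Units_L_val p b \<open>b \<noteq> \<zero>\<^bsub>PS\<^esub>\<close> s v by auto
    then show False using at p(1) b' unfolding atom_def by blast
  qed
  ultimately show "a \<in> carrier L \<and> a \<noteq> \<zero>\<^bsub>PS\<^esub> \<and> s \<le> val a \<and> val a < 2 * s" using a by blast
next
  assume a: "a \<in> carrier L \<and> a \<noteq> \<zero>\<^bsub>PS\<^esub> \<and> s \<le> val a \<and> val a < 2 * s"
  show "atom L a" unfolding atom_def
  proof (intro conjI ballI impI)
    have "a \<notin> Units L" using Units_L_val[of a] a s by auto
    then show "a \<in> nonzero_nonunits L" using a unfolding nonzero_nonunits_def by auto
    fix x y assume xy: "x \<in> carrier L" "y \<in> carrier L" "a = x \<otimes>\<^bsub>L\<^esub> y"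
    then have nz: "x \<noteq> \<zero>\<^bsub>PS\<^esub>" "y \<noteq> \<zero>\<^bsub>PS\<^esub>" using a L.l_null L.r_null by fastforce+
    then have "val a = val x + val y" using val_mult[OF xy(1,2)] xy(3) by simp
    then have "val x = 0 \<or> val y = 0" using val_cases[OF xy(1) nz(1)] val_cases[OF xy(2) nz(2)] a by auto
    then show "x \<in> Units L \<or> y \<in> Units L" using Units_L_val xy nz by blast
  qed
qed

text \<open>Order and orbit together form a complete invariant. Each of the \<open>s\<close>
  possible orders of an atom occurs with every orbit, as \<open>with_lead\<close> shows.\<close>

lemma has_exactly_atoms_L: "has_exactly_atoms L (s * card (orbit ` leads))"
proof -
  define Y where "Y = {s..<2 * s} \<times> orbit ` leads"
  have "has_exactly_atoms L (card Y)"
  proof (rule has_exactly_atoms_by_invariant)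
    show "domain L" by (rule L.domain_axioms)
    show "finite Y" unfolding Y_def using finite_leads by auto
    show "a \<sim>\<^bsub>L\<^esub> b \<longleftrightarrow> (val a, orbit (lead a)) = (val b, orbit (lead b))" if "atom L a" "atom L b" for a b
      using that associated_L_iff[of a b] by (auto simp: atom_L_iff simp del: series_from_simps)
    show "(\<lambda>a. (val a, orbit (lead a))) ` {a. atom L a} = Y"
    proof
      show "(\<lambda>a. (val a, orbit (lead a))) ` {a. atom L a} \<subseteq> Y"
        using lead_in_leads unfolding Y_def by (auto simp: atom_L_iff simp del: series_from_simps)
      show "Y \<subseteq> (\<lambda>a. (val a, orbit (lead a))) ` {a. atom L a}"
      proof
        fix z assume "z \<in> Y"
        then obtain v x where z: "z = (v, orbit x)" "s \<le> v" "v < 2 * s" "x \<in> leads" unfolding Y_def by auto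
        then show "z \<in> (\<lambda>a. (val a, orbit (lead a))) ` {a. atom L a}"
          using with_lead[OF z(4,2)] by (intro image_eqI[of _ _ "with_lead v x"]) (auto simp: atom_L_iff simp del: series_from_simps)
      qed
    qed
  qed
  then show ?thesis by (simp add: Y_def card_cartesian_product)
qed

text \<open>Take \<open>x\<close> of the same order as \<open>p\<close> in a different orbit. A
  quotient of \<open>x\<close> by \<open>p\<close> would have order 0 and be a unit, against the
  choice of orbit; but the square of \<open>x\<close> has order at least
  \<open>val p + s\<close>.\<close>

lemma atom_L_not_prime:
  assumes "card (orbit ` leads) > 1" and p: "atom L p"
  shows "\<exists>x\<in>carrier L. x \<noteq> \<zero>\<^bsub>L\<^esub> \<and> \<not> p divides\<^bsub>L\<^esub> x \<and> p divides\<^bsub>L\<^esub> x \<otimes>\<^bsub>L\<^esub> x"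
proof -
  have pp: "p \<in> carrier L" "p \<noteq> \<zero>\<^bsub>PS\<^esub>" "s \<le> val p" using p unfolding atom_L_iff by blast+
  have "\<exists>o'\<in>orbit ` leads. o' \<noteq> orbit (lead p)"
  proof (rule ccontr)
    assume "\<not> ?thesis"
    then have "orbit ` leads \<subseteq> {orbit (lead p)}" by blast
    then have "card (orbit ` leads) \<le> 1" using card_mono[of "{orbit (lead p)}"] by simp
    then show False using assms(1) by simp
  qed
  then obtain y where y: "y \<in> leads" "orbit y \<noteq> orbit (lead p)" by blast
  define x where "x = with_lead (val p) y"
  note x = with_lead[OF y(1) pp(3), folded x_def]
  have "\<not> p divides\<^bsub>L\<^esub> x"
  proof
    assume "p divides\<^bsub>L\<^esub> x"
    then obtain u where u: "u \<in> carrier L" "x = p \<otimes>\<^bsub>L\<^esub> u" by (auto simp: factor_def)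
    have "u \<noteq> \<zero>\<^bsub>PS\<^esub>" using u x pp by (metis L.r_null series_from_simps(3))
    then have "u \<in> Units L" using val_mult[OF pp(1) u(1) pp(2)] u x Units_L_val by auto
    then have "x \<sim>\<^bsub>L\<^esub> p" using u pp by (intro L.associatedI2) auto
    then show False using associated_L_iff[OF x(1,2) pp(1,2)] x y by auto
  qed
  moreover have "p divides\<^bsub>L\<^esub> x \<otimes>\<^bsub>L\<^esub> x"
  proof (rule divides_high[OF pp(1,2)])
    show "x \<otimes>\<^bsub>L\<^esub> x \<in> carrier L" using x(1) by (intro L.m_closed)
    show "x \<otimes>\<^bsub>L\<^esub> x \<noteq> \<zero>\<^bsub>PS\<^esub>" using x(1,2) L.integral[of x x] by auto
    show "val p + s \<le> val (x \<otimes>\<^bsub>L\<^esub> x)" using val_mult[OF x(1,1,2,2)] x(3) pp(3) by simp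
  qed
  ultimately show ?thesis using x by (intro bexI[of _ x]) auto
qed

end

section \<open>Domains with componentwise divisibility\<close>

text \<open>Both factors of a factorisation into nonunits have positive, hence strictly smaller,
  length, so repeated splitting terminates.\<close>

lemma (in domain) atomic_by_length:
  assumes mult: "\<And>a b. a \<in> carrier R - {\<zero>} \<Longrightarrow> b \<in> carrier R - {\<zero>} \<Longrightarrow> l (a \<otimes> b) = l a + (l b :: nat)"
    and unit: "\<And>a. a \<in> carrier R - {\<zero>} \<Longrightarrow> l a = 0 \<longleftrightarrow> a \<in> Units R"
  shows "atomic R"
proof -
  have "\<exists>ps. (\<forall>p\<in>set ps. atom R p) \<and> x = foldr (\<otimes>) ps \<one>" if "x \<in> nonzero_nonunits R" for x
    using that
  proof (induction "l x" arbitrary: x rule: less_induct)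
    case less
    have x: "x \<in> carrier R" "x \<noteq> \<zero>" "x \<notin> Units R" using less.prems by (auto simp: nonzero_nonunits_def)
    show ?case
    proof (cases "atom R x")
      case True
      then show ?thesis using x by (intro exI[of _ "[x]"]) auto
    next
      case False
      then obtain y z where yz: "y \<in> carrier R" "z \<in> carrier R" "x = y \<otimes> z" "y \<notin> Units R" "z \<notin> Units R"
        using less.prems unfolding atom_def by blast
      then have nz: "y \<noteq> \<zero>" "z \<noteq> \<zero>" using x by auto
      have "l x = l y + l z" "l y \<noteq> 0" "l z \<noteq> 0" using mult[of y z] unit[of y] unit[of z] yz nz by auto
      then have "l y < l x" "l z < l x" by auto
      then obtain ps qs where ps: "\<forall>p\<in>set ps. atom R p" "y = foldr (\<otimes>) ps \<one>"
        and qs: "\<forall>p\<in>set qs. atom R p" "z = foldr (\<otimes>) qs \<one>"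
        using less.hyps yz nz unfolding nonzero_nonunits_def by (metis DiffI insertE empty_iff UnE)
      have "foldr (\<otimes>) (rs @ qs) \<one> = foldr (\<otimes>) rs \<one> \<otimes> z \<and> foldr (\<otimes>) rs \<one> \<in> carrier R"
        if "\<forall>p\<in>set rs. atom R p" for rs
        using that
      proof (induction rs)
        case (Cons r rs)
        then show ?case using yz atom_in_carrier[of R r] by (simp add: m_assoc)
      qed (use qs yz in auto)
      from this[OF ps(1)] show ?thesis using ps qs yz by (intro exI[of _ "ps @ qs"]) auto
    qed
  qed
  then show ?thesis unfolding atomic_def by blast
qed

text \<open>
  By \<open>divides_locally\<close> and \<open>lift_exists\<close>, the monoid of nonzero principal ideals of \<open>R\<close> is
  the direct sum of those of the \<open>L i\<close>.
\<close>

locale glued_domain = domain R for R :: "('a, 'm) ring_scheme" (structure) +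
  fixes I :: "'i set" and L :: "'i \<Rightarrow> ('b, 'n) ring_scheme" and \<pi> :: "'i \<Rightarrow> 'a \<Rightarrow> 'b"
  assumes finite_I: "finite I"
    and local_domain: "i \<in> I \<Longrightarrow> domain (L i)"
    and hom: "i \<in> I \<Longrightarrow> \<pi> i \<in> ring_hom R (L i)"
    and nonzero: "i \<in> I \<Longrightarrow> a \<in> carrier R \<Longrightarrow> a \<noteq> \<zero> \<Longrightarrow> \<pi> i a \<noteq> \<zero>\<^bsub>L i\<^esub>"
    and divides_locally: "a \<in> carrier R \<Longrightarrow> b \<in> carrier R \<Longrightarrow>
      (\<And>i. i \<in> I \<Longrightarrow> \<pi> i a divides\<^bsub>L i\<^esub> \<pi> i b) \<Longrightarrow> a divides b"
    and lift_exists: "i \<in> I \<Longrightarrow> x \<in> carrier (L i) \<Longrightarrow> x \<noteq> \<zero>\<^bsub>L i\<^esub> \<Longrightarrow>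
      \<exists>a\<in>carrier R. \<pi> i a \<sim>\<^bsub>L i\<^esub> x \<and> (\<forall>j\<in>I. j \<noteq> i \<longrightarrow> \<pi> j a \<in> Units (L j))"
begin

lemma local_hom: "i \<in> I \<Longrightarrow> ring_hom_cring R (L i) (\<pi> i)"
  using local_domain hom by (intro ring_hom_cringI) (auto simp: domain_def is_cring)

lemma local_closed [simp]: "i \<in> I \<Longrightarrow> a \<in> carrier R \<Longrightarrow> \<pi> i a \<in> carrier (L i)"
  using hom ring_hom_closed by fast

lemma local_mult [simp]:
  "i \<in> I \<Longrightarrow> a \<in> carrier R \<Longrightarrow> b \<in> carrier R \<Longrightarrow> \<pi> i (a \<otimes> b) = \<pi> i a \<otimes>\<^bsub>L i\<^esub> \<pi> i b"
  by (rule ring_hom_mult[OF hom])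

lemma local_one [simp]: "i \<in> I \<Longrightarrow> \<pi> i \<one> = \<one>\<^bsub>L i\<^esub>"
  using hom ring_hom_one by fast

lemma local_zero [simp]: "i \<in> I \<Longrightarrow> \<pi> i \<zero> = \<zero>\<^bsub>L i\<^esub>"
  using local_hom ring_hom_cring.hom_zero by fast

lemma divides_iff_local:
  assumes "a \<in> carrier R" "b \<in> carrier R"
  shows "a divides b \<longleftrightarrow> (\<forall>i\<in>I. \<pi> i a divides\<^bsub>L i\<^esub> \<pi> i b)"
proof
  assume "a divides b"
  then obtain c where c: "c \<in> carrier R" "b = a \<otimes> c" by (auto simp: factor_def)
  then show "\<forall>i\<in>I. \<pi> i a divides\<^bsub>L i\<^esub> \<pi> i b" using assms by (auto simp: factor_def)
qed (use divides_locally assms in blast)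

lemma Units_iff_local:
  assumes a: "a \<in> carrier R"
  shows "a \<in> Units R \<longleftrightarrow> (\<forall>i\<in>I. \<pi> i a \<in> Units (L i))"
proof -
  have "a \<in> Units R \<longleftrightarrow> a divides \<one>" using unit_divides[OF _ one_closed] divides_unit[OF _ a Units_one_closed] by blast
  moreover have "\<pi> i a \<in> Units (L i) \<longleftrightarrow> \<pi> i a divides\<^bsub>L i\<^esub> \<pi> i \<one>" if i: "i \<in> I" for i
  proof -
    interpret Li: domain "L i" using local_domain[OF i] .
    show ?thesis using Li.unit_divides[OF _ Li.one_closed] Li.divides_unit[OF _ local_closed[OF i a] Li.Units_one_closed]
      local_one[OF i] by metis
  qed
  ultimately show ?thesis using divides_iff_local[OF a one_closed] by auto
qed

lemma associated_iff_local:
  assumes "a \<in> carrier R" "b \<in> carrier R"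
  shows "a \<sim> b \<longleftrightarrow> (\<forall>i\<in>I. \<pi> i a \<sim>\<^bsub>L i\<^esub> \<pi> i b)"
  using assms divides_iff_local by (auto simp: associated_def)

text \<open>The embedding of the \<open>i\<close>-th summand on the level of principal ideals; as a
  map on elements it is an arbitrary choice, meaningful only up to associates.\<close>

definition lift :: "'i \<Rightarrow> 'b \<Rightarrow> 'a" where
  "lift i x = (SOME a. a \<in> carrier R \<and> \<pi> i a \<sim>\<^bsub>L i\<^esub> x \<and> (\<forall>j\<in>I. j \<noteq> i \<longrightarrow> \<pi> j a \<in> Units (L j)))"

lemma lift:
  assumes "i \<in> I" "x \<in> carrier (L i)" "x \<noteq> \<zero>\<^bsub>L i\<^esub>"
  shows "lift i x \<in> carrier R" "\<pi> i (lift i x) \<sim>\<^bsub>L i\<^esub> x" "j \<in> I \<Longrightarrow> j \<noteq> i \<Longrightarrow> \<pi> j (lift i x) \<in> Units (L j)"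
proof -
  have "\<exists>a. a \<in> carrier R \<and> \<pi> i a \<sim>\<^bsub>L i\<^esub> x \<and> (\<forall>j\<in>I. j \<noteq> i \<longrightarrow> \<pi> j a \<in> Units (L j))"
    using lift_exists[OF assms] by blast
  from someI_ex[OF this] show "lift i x \<in> carrier R" "\<pi> i (lift i x) \<sim>\<^bsub>L i\<^esub> x"
    "j \<in> I \<Longrightarrow> j \<noteq> i \<Longrightarrow> \<pi> j (lift i x) \<in> Units (L j)"
    unfolding lift_def by blast+
qed

end

section \<open>Atoms and primes of a glued domain\<close>

lemma (in comm_monoid) associated_mult:
  assumes "a \<sim> a'" "b \<sim> b'" "a \<in> carrier G" "a' \<in> carrier G" "b \<in> carrier G" "b' \<in> carrier G"
  shows "a \<otimes> b \<sim> a' \<otimes> b'"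
  using associated_trans[OF mult_cong_l[OF assms(1,3,4,5)] mult_cong_r[OF assms(2,4,5,6)]] assms by simp

lemma (in domain) associated_nonzero:
  assumes "a \<sim> b" "a \<in> carrier R" "b \<in> carrier R"
  shows "a = \<zero> \<longleftrightarrow> b = \<zero>"
  using assms by (auto simp: associated_def factor_def)

lemma (in domain) associated_Units:
  assumes "a \<sim> b" "a \<in> carrier R" "b \<in> carrier R"
  shows "a \<in> Units R \<longleftrightarrow> b \<in> Units R"
  using assms divides_unit by (auto simp: associated_def)

lemma (in domain) associated_atom:
  assumes ab: "a \<sim> b" "a \<in> carrier R" "b \<in> carrier R" and a: "atom R a"
  shows "atom R b"
  unfolding atom_def
proof (intro conjI ballI impI)
  show "b \<in> nonzero_nonunits R"
    using a associated_nonzero[OF ab] associated_Units[OF ab] ab(3)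
    by (auto simp: atom_def nonzero_nonunits_def)
  fix x y assume xy: "x \<in> carrier R" "y \<in> carrier R" "b = x \<otimes> y"
  obtain u where u: "u \<in> Units R" "a = b \<otimes> u"
    using ring_associated_iff[OF ab(2,3)] ab m_comm Units_closed by blast
  then have "a = x \<otimes> (y \<otimes> u)" using xy by (simp add: m_assoc Units_closed)
  then have "x \<in> Units R \<or> y \<otimes> u \<in> Units R" using a xy u by (auto simp: atom_def)
  then show "x \<in> Units R \<or> y \<in> Units R" using u xy
    by (metis Units_closed prod_unit_l m_comm)
qed

lemma atom_nonzero: "atom R a \<Longrightarrow> a \<noteq> \<zero>\<^bsub>R\<^esub>"
  and atom_not_unit: "atom R a \<Longrightarrow> a \<notin> Units R"
  by (auto simp: atom_def nonzero_nonunits_def)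

context glued_domain
begin

lemma lift_nonzero:
  assumes "i \<in> I" "x \<in> carrier (L i)" "x \<noteq> \<zero>\<^bsub>L i\<^esub>"
  shows "lift i x \<noteq> \<zero>"
proof
  assume "lift i x = \<zero>"
  then show False
    using domain.associated_nonzero[OF local_domain[OF assms(1)] lift(2)[OF assms] local_closed[OF assms(1) lift(1)[OF assms]]]
      assms by simp
qed

text \<open>Any factor of a lift from \<open>i\<close> is a unit in the other components, so whether
  it is a unit is decided at \<open>i\<close>. In the other direction, a factorisation of
  \<open>x\<close> lifts to a factorisation of an associate of \<open>lift i x\<close>.\<close>

lemma atom_lift_iff:
  assumes i: "i \<in> I" and x: "x \<in> carrier (L i)" "x \<noteq> \<zero>\<^bsub>L i\<^esub>"
  shows "atom R (lift i x) \<longleftrightarrow> atom (L i) x"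
proof -
  interpret Li: domain "L i" using local_domain[OF i] .
  note lx = lift[OF i x]
  have unit: "a \<in> Units R \<longleftrightarrow> \<pi> i a \<in> Units (L i)"
    if a: "a \<in> carrier R" "b \<in> carrier R" "lift i x = a \<otimes> b" for a b
  proof -
    have "\<pi> j a \<in> Units (L j)" if j: "j \<in> I" "j \<noteq> i" for j
    proof -
      interpret Lj: domain "L j" using local_domain[OF j(1)] .
      have "\<pi> j a \<otimes>\<^bsub>L j\<^esub> \<pi> j b \<in> Units (L j)" using lx(3)[OF j] a j by simp
      then show ?thesis using Lj.unit_factor a j local_closed by blast
    qed
    then show ?thesis using Units_iff_local[OF a(1)] i by auto
  qed
  have unit_lift: "y \<in> Units (L i) \<longleftrightarrow> lift i y \<in> Units R" if y: "y \<in> carrier (L i)" "y \<noteq> \<zero>\<^bsub>L i\<^esub>" for y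
    using Units_iff_local[OF lift(1)[OF i y]] lift(3)[OF i y] i
      Li.associated_Units[OF lift(2)[OF i y] _ y(1)] lift(1)[OF i y] by auto
  show ?thesis
  proof
    assume atom: "atom (L i) x"
    have xi: "atom (L i) (\<pi> i (lift i x))"
      by (rule Li.associated_atom[OF _ x(1) _ atom]) (use lx i x Li.associated_sym in auto)
    show "atom R (lift i x)" unfolding atom_def
    proof (intro conjI ballI impI)
      show "lift i x \<in> nonzero_nonunits R"
        using lift_nonzero[OF i x] lx(1) unit_lift[OF x] atom by (auto simp: nonzero_nonunits_def atom_def)
      fix a b assume ab: "a \<in> carrier R" "b \<in> carrier R" "lift i x = a \<otimes> b"
      then have "\<pi> i (lift i x) = \<pi> i a \<otimes>\<^bsub>L i\<^esub> \<pi> i b" using i by simp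
      then have "\<pi> i a \<in> Units (L i) \<or> \<pi> i b \<in> Units (L i)" using xi ab i unfolding atom_def by auto
      then show "a \<in> Units R \<or> b \<in> Units R" using unit[OF ab] unit[of b a] ab by (auto simp: m_comm)
    qed
  next
    assume atom: "atom R (lift i x)"
    show "atom (L i) x" unfolding atom_def
    proof (intro conjI ballI impI)
      show "x \<in> nonzero_nonunits (L i)"
        using x unit_lift[OF x] atom by (auto simp: nonzero_nonunits_def atom_def)
      fix y z assume yz: "y \<in> carrier (L i)" "z \<in> carrier (L i)" "x = y \<otimes>\<^bsub>L i\<^esub> z"
      then have nz: "y \<noteq> \<zero>\<^bsub>L i\<^esub>" "z \<noteq> \<zero>\<^bsub>L i\<^esub>" using x by auto
      note ly = lift[OF i yz(1) nz(1)] and lz = lift[OF i yz(2) nz(2)]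
      have "lift i y \<otimes> lift i z \<sim> lift i x"
        unfolding associated_iff_local[OF m_closed[OF ly(1) lz(1)] lx(1)]
      proof
        fix j assume j: "j \<in> I"
        interpret Lj: domain "L j" using local_domain[OF j] .
        show "\<pi> j (lift i y \<otimes> lift i z) \<sim>\<^bsub>L j\<^esub> \<pi> j (lift i x)"
        proof (cases "j = i")
          case True
          have "\<pi> i (lift i y) \<otimes>\<^bsub>L i\<^esub> \<pi> i (lift i z) \<sim>\<^bsub>L i\<^esub> y \<otimes>\<^bsub>L i\<^esub> z"
            using ly lz yz i by (intro Li.associated_mult) auto
          then have "\<pi> i (lift i y) \<otimes>\<^bsub>L i\<^esub> \<pi> i (lift i z) \<sim>\<^bsub>L i\<^esub> \<pi> i (lift i x)"
            using Li.associated_trans[OF _ Li.associated_sym[OF lx(2)]] yz i lx(1) ly(1) lz(1) by simp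
          then show ?thesis using True i ly lz by simp
        next
          case False
          then show ?thesis using ly lz lx j Lj.Units_cong Lj.Units_assoc by auto
        qed
      qed
      then have "atom R (lift i y \<otimes> lift i z)"
        using associated_atom[OF associated_sym _ _ atom] ly lz lx by auto
      then have "lift i y \<in> Units R \<or> lift i z \<in> Units R" using ly lz by (auto simp: atom_def)
      then show "y \<in> Units (L i) \<or> z \<in> Units (L i)" using unit_lift yz nz by auto
    qed
  qed
qed

text \<open>An atom has only one nonunit component: the lift of a nonunit component divides
  \<open>a\<close>, since it is a unit elsewhere, and is itself not a unit. So the cofactor is a
  unit.\<close>

lemma lift_local:
  assumes a: "atom R a" and i: "i \<in> I" "\<pi> i a \<notin> Units (L i)"
  shows "lift i (\<pi> i a) \<sim> a" "j \<in> I \<Longrightarrow> j \<noteq> i \<Longrightarrow> \<pi> j a \<in> Units (L j)"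
proof -
  have ac: "a \<in> carrier R" "a \<noteq> \<zero>" using atom_in_carrier[OF a] atom_nonzero[OF a] by auto
  interpret Li: domain "L i" using local_domain[OF i(1)] .
  have x: "\<pi> i a \<in> carrier (L i)" "\<pi> i a \<noteq> \<zero>\<^bsub>L i\<^esub>" using ac i nonzero by auto
  note l = lift[OF i(1) x]
  have "lift i (\<pi> i a) divides a"
  proof (rule divides_locally[OF l(1) ac(1)])
    fix j assume j: "j \<in> I"
    interpret Lj: domain "L j" using local_domain[OF j] .
    show "\<pi> j (lift i (\<pi> i a)) divides\<^bsub>L j\<^esub> \<pi> j a"
    proof (cases "j = i")
      case True
      then show ?thesis using l(2) by (simp add: associated_def)
    next
      case False
      then show ?thesis using l(3)[OF j] j ac Lj.unit_divides by auto
    qed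
  qed
  then obtain c where c: "c \<in> carrier R" "a = lift i (\<pi> i a) \<otimes> c" by (auto simp: factor_def)
  have "lift i (\<pi> i a) \<notin> Units R"
    using Units_iff_local[OF l(1)] i Li.associated_Units[OF l(2) _ x(1)] l(1) by auto
  then have "c \<in> Units R" using a c l(1) unfolding atom_def by auto
  then show as: "lift i (\<pi> i a) \<sim> a" using c l(1) by (metis associatedI2 associated_sym ac(1))
  show "\<pi> j a \<in> Units (L j)" if j: "j \<in> I" "j \<noteq> i"
    using as l(3)[OF j] domain.associated_Units[OF local_domain[OF j(1)]] associated_iff_local[OF l(1) ac(1)] j l(1) ac(1)
    by (metis local_closed)
qed

lemma atom_has_component:
  assumes "atom R a"
  shows "\<exists>i\<in>I. \<pi> i a \<notin> Units (L i)"
  using Units_iff_local[OF atom_in_carrier[OF assms]] atom_not_unit[OF assms] by blast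

text \<open>By \<open>lift_local\<close> every atom is, up to a unit, the lift of an atom of exactly
  one \<open>L i\<close>. Lifting transversals of all the \<open>L i\<close> therefore gives a
  disjoint union that is a transversal of \<open>R\<close>.\<close>

lemma atoms_glued:
  assumes n: "\<And>i. i \<in> I \<Longrightarrow> has_exactly_atoms (L i) (n i)"
  shows "has_exactly_atoms R (sum n I)"
proof -
  have "\<exists>P. \<forall>i\<in>I. atom_transversal (L i) (P i) \<and> finite (P i) \<and> card (P i) = n i"
    using n unfolding has_exactly_atoms_def by (intro bchoice) blast
  then obtain P where P: "\<And>i. i \<in> I \<Longrightarrow> atom_transversal (L i) (P i)" "\<And>i. i \<in> I \<Longrightarrow> finite (P i)"
    "\<And>i. i \<in> I \<Longrightarrow> card (P i) = n i" by blast
  have Pa: "atom (L i) p" "p \<in> carrier (L i)" "p \<noteq> \<zero>\<^bsub>L i\<^esub>" "p \<notin> Units (L i)" if "i \<in> I" "p \<in> P i" for i p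
  proof -
    show p: "atom (L i) p" using P(1)[OF that(1)] that(2) unfolding atom_transversal_def by blast
    show "p \<in> carrier (L i)" "p \<noteq> \<zero>\<^bsub>L i\<^esub>" "p \<notin> Units (L i)"
      using atom_in_carrier[OF p] atom_nonzero[OF p] atom_not_unit[OF p] by auto
  qed
  let ?f = "\<lambda>(i, p). lift i p"
  let ?S = "Sigma I P"
  \<comment> \<open>Lifts from different indices are told apart at \<open>i\<close>, where the lift
    of \<open>p\<close> is a nonunit while a lift from another index is a unit.\<close>
  have assoc: "i = j \<and> p = q"
    if ip: "i \<in> I" "p \<in> P i" "j \<in> I" "q \<in> P j" "lift i p \<sim> lift j q" for i j p q
  proof -
    interpret Li: domain "L i" using local_domain[OF ip(1)] .
    note p = Pa[OF ip(1,2)] and q = Pa[OF ip(3,4)]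
    note lp = lift[OF ip(1) p(2,3)] and lq = lift[OF ip(3) q(2,3)]
    have as: "\<pi> i (lift i p) \<sim>\<^bsub>L i\<^esub> \<pi> i (lift j q)"
      using ip(5) associated_iff_local[OF lp(1) lq(1)] ip(1) by auto
    have "i = j"
    proof (rule ccontr)
      assume "i \<noteq> j"
      then have "\<pi> i (lift j q) \<in> Units (L i)" using lq(3)[OF ip(1)] by auto
      then have "p \<in> Units (L i)"
        using Li.associated_Units[OF as] Li.associated_Units[OF lp(2)] lp(1) lq(1) p ip by auto
      then show False using p by blast
    qed
    moreover have "p \<sim>\<^bsub>L i\<^esub> q" if "j = i"
    proof -
      have "p \<sim>\<^bsub>L i\<^esub> \<pi> i (lift i p)" using Li.associated_sym[OF lp(2)] .
      also have "\<dots> \<sim>\<^bsub>L i\<^esub> \<pi> i (lift i q)" using as that by simp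
      also have "\<dots> \<sim>\<^bsub>L i\<^esub> q" using lq(2) that by simp
      finally show ?thesis using p q lp(1) lq(1) ip that by simp
    qed
    ultimately show ?thesis using P(1)[OF ip(1)] ip Pa(1)[OF ip(1,2)] Li.associated_refl[OF p(2)]
      unfolding atom_transversal_def by blast
  qed
  have "inj_on ?f ?S"
  proof (rule inj_onI)
    fix x y assume xy: "x \<in> ?S" "y \<in> ?S" "?f x = ?f y"
    obtain i p j q where x: "x = (i, p)" "y = (j, q)" by (metis surj_pair)
    have "lift i p \<sim> lift j q" using xy x lift(1)[of i p] Pa by auto
    then show "x = y" using assoc[of i p j q] xy x by auto
  qed
  moreover have "atom_transversal R (?f ` ?S)"
    unfolding atom_transversal_def
  proof (intro conjI allI impI)
    show "\<forall>p\<in>?f ` ?S. atom R p"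
      using Pa atom_lift_iff by auto
    fix a assume a: "atom R a"
    have ac: "a \<in> carrier R" using atom_in_carrier[OF a] .
    obtain i where i: "i \<in> I" "\<pi> i a \<notin> Units (L i)" using atom_has_component[OF a] by blast
    interpret Li: domain "L i" using local_domain[OF i(1)] .
    have x: "\<pi> i a \<in> carrier (L i)" "\<pi> i a \<noteq> \<zero>\<^bsub>L i\<^esub>" using ac i nonzero atom_nonzero[OF a] by auto
    note l = lift[OF i(1) x]
    have "atom R (lift i (\<pi> i a))"
      using associated_atom[OF associated_sym[OF lift_local(1)[OF a i]] ac l(1) a] .
    then have "atom (L i) (\<pi> i a)" using atom_lift_iff[OF i(1) x] by simp
    then obtain p where p: "p \<in> P i" "\<pi> i a \<sim>\<^bsub>L i\<^esub> p"
      using P(1)[OF i(1)] unfolding atom_transversal_def by blast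
    note pc = Pa[OF i(1) p(1)]
    note lp = lift[OF i(1) pc(2,3)]
    have ap: "a \<sim> lift i p"
      unfolding associated_iff_local[OF ac lp(1)]
    proof
      fix j assume j: "j \<in> I"
      interpret Lj: domain "L j" using local_domain[OF j] .
      show "\<pi> j a \<sim>\<^bsub>L j\<^esub> \<pi> j (lift i p)"
      proof (cases "j = i")
        case True
        have "\<pi> i a \<sim>\<^bsub>L i\<^esub> \<pi> i (lift i p)"
          using Li.associated_trans[OF p(2) Li.associated_sym[OF lp(2)]] x pc lp(1) i by auto
        then show ?thesis using True by simp
      next
        case False
        then show ?thesis using lp(3)[OF j] lift_local(2)[OF a i j] Lj.Units_assoc by auto
      qed
    qed
    show "\<exists>!q. q \<in> ?f ` ?S \<and> a \<sim> q"
    proof (rule ex1I[of _ "lift i p"])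
      show "lift i p \<in> ?f ` ?S \<and> a \<sim> lift i p" using ap p i by force
      fix q assume q: "q \<in> ?f ` ?S \<and> a \<sim> q"
      then obtain j r where jr: "j \<in> I" "r \<in> P j" "q = lift j r" by auto
      have "lift i p \<sim> lift j r"
        using associated_trans[OF associated_sym[OF ap], of "lift j r"] q jr ac lp(1) lift(1)[OF jr(1)] Pa[OF jr(1,2)] by auto
      then show "q = lift i p" using assoc[OF i(1) p(1) jr(1,2)] jr by auto
    qed
  qed
  moreover have "card (?f ` ?S) = sum n I"
    using calculation(1) P finite_I by (simp add: card_image card_SigmaI)
  moreover have "finite (?f ` ?S)" using P finite_I by auto
  ultimately show ?thesis unfolding has_exactly_atoms_def by blast
qed

text \<open>A prime is an atom, hence a unit outside one component \<open>i\<close>. Lifting the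
  local witness from \<open>i\<close>, divisibility of its square holds in every component, while
  divisibility of the lift itself fails at \<open>i\<close>.\<close>

lemma primefree_glued:
  assumes "\<And>i p. i \<in> I \<Longrightarrow> atom (L i) p \<Longrightarrow>
      \<exists>x\<in>carrier (L i). x \<noteq> \<zero>\<^bsub>L i\<^esub> \<and> \<not> p divides\<^bsub>L i\<^esub> x \<and> p divides\<^bsub>L i\<^esub> x \<otimes>\<^bsub>L i\<^esub> x"
  shows "primefree R"
  unfolding primefree_def
proof
  assume "\<exists>a. prime_element R a"
  then obtain a where a: "a \<in> carrier R" "ring_prime a" using prime_element_iff_ring_prime by blast
  then have atom: "atom R a"
    using ring_irreducibleI'[OF _ mult_of.prime_irreducible[OF ring_primeE(2)[OF a]]] ring_primeE(1)[OF a]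
    by (simp add: atom_iff_ring_irreducible)
  obtain i where i: "i \<in> I" "\<pi> i a \<notin> Units (L i)" using atom_has_component[OF atom] by blast
  interpret Li: domain "L i" using local_domain[OF i(1)] .
  have x: "\<pi> i a \<in> carrier (L i)" "\<pi> i a \<noteq> \<zero>\<^bsub>L i\<^esub>" using a i nonzero atom_nonzero[OF atom] by auto
  have "atom R (lift i (\<pi> i a))"
    using associated_atom[OF associated_sym[OF lift_local(1)[OF atom i]] a(1) lift(1)[OF i(1) x] atom] .
  then have "atom (L i) (\<pi> i a)" using atom_lift_iff[OF i(1) x] by simp
  then obtain y where y: "y \<in> carrier (L i)" "y \<noteq> \<zero>\<^bsub>L i\<^esub>" "\<not> \<pi> i a divides\<^bsub>L i\<^esub> y"
      "\<pi> i a divides\<^bsub>L i\<^esub> y \<otimes>\<^bsub>L i\<^esub> y"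
    using assms i(1) by blast
  note ly = lift[OF i(1) y(1,2)]
  have "a divides lift i y \<otimes> lift i y"
  proof (rule divides_locally[OF a(1)])
    fix j assume j: "j \<in> I"
    interpret Lj: domain "L j" using local_domain[OF j] .
    show "\<pi> j a divides\<^bsub>L j\<^esub> \<pi> j (lift i y \<otimes> lift i y)"
    proof (cases "j = i")
      case True
      have "\<pi> i (lift i y) \<otimes>\<^bsub>L i\<^esub> \<pi> i (lift i y) \<sim>\<^bsub>L i\<^esub> y \<otimes>\<^bsub>L i\<^esub> y"
        using ly y i by (intro Li.associated_mult) auto
      then have "\<pi> i a divides\<^bsub>L i\<^esub> \<pi> i (lift i y) \<otimes>\<^bsub>L i\<^esub> \<pi> i (lift i y)"
        using Li.divides_trans[OF y(4) _ x(1)] by (simp add: associated_def)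
      then show ?thesis using True ly i by simp
    next
      case False
      then show ?thesis using lift_local(2)[OF atom i j] ly j Lj.unit_divides by auto
    qed
  qed (use ly in auto)
  then have "a divides lift i y"
    using a(2) ly(1) by (auto simp: ring_prime_def Divisibility.prime_def)
  then have "\<pi> i a divides\<^bsub>L i\<^esub> \<pi> i (lift i y)" using divides_iff_local[OF a(1) ly(1)] i by auto
  then show False using y ly x i Li.divides_trans[of "\<pi> i a" "\<pi> i (lift i y)" y] by (auto simp: associated_def)
qed

text \<open>The sum of the local lengths is a length function on \<open>R\<close>.\<close>

lemma atomic_glued:
  assumes mult: "\<And>i a b. i \<in> I \<Longrightarrow> a \<in> carrier (L i) - {\<zero>\<^bsub>L i\<^esub>} \<Longrightarrow> b \<in> carrier (L i) - {\<zero>\<^bsub>L i\<^esub>} \<Longrightarrow>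
      l i (a \<otimes>\<^bsub>L i\<^esub> b) = l i a + (l i b :: nat)"
    and unit: "\<And>i a. i \<in> I \<Longrightarrow> a \<in> carrier (L i) - {\<zero>\<^bsub>L i\<^esub>} \<Longrightarrow> l i a = 0 \<longleftrightarrow> a \<in> Units (L i)"
  shows "atomic R"
proof (rule atomic_by_length)
  fix a b assume ab: "a \<in> carrier R - {\<zero>}" "b \<in> carrier R - {\<zero>}"
  show "(\<Sum>i\<in>I. l i (\<pi> i (a \<otimes> b))) = (\<Sum>i\<in>I. l i (\<pi> i a)) + (\<Sum>i\<in>I. l i (\<pi> i b))"
    unfolding sum.distrib[symmetric] by (rule sum.cong) (use ab mult nonzero in auto)
next
  fix a assume a: "a \<in> carrier R - {\<zero>}"
  have "(\<Sum>i\<in>I. l i (\<pi> i a)) = 0 \<longleftrightarrow> (\<forall>i\<in>I. l i (\<pi> i a) = 0)" using finite_I by simp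
  also have "\<dots> \<longleftrightarrow> (\<forall>i\<in>I. \<pi> i a \<in> Units (L i))" using a unit nonzero by auto
  finally show "(\<Sum>i\<in>I. l i (\<pi> i a)) = 0 \<longleftrightarrow> a \<in> Units R" using Units_iff_local a by auto
qed

end

section \<open>Gluing local rings\<close>

definition product_ring :: "'i set \<Rightarrow> ('i \<Rightarrow> ('b, 'n) ring_scheme) \<Rightarrow> ('i \<Rightarrow> 'b) ring" where
  "product_ring I L = \<lparr>carrier = (\<Pi>\<^sub>E i\<in>I. carrier (L i)),
     mult = (\<lambda>f g. \<lambda>i\<in>I. f i \<otimes>\<^bsub>L i\<^esub> g i),
     one = (\<lambda>i\<in>I. \<one>\<^bsub>L i\<^esub>),
     zero = (\<lambda>i\<in>I. \<zero>\<^bsub>L i\<^esub>),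
     add = (\<lambda>f g. \<lambda>i\<in>I. f i \<oplus>\<^bsub>L i\<^esub> g i)\<rparr>"

lemma product_ring_carrier: "carrier (product_ring I L) = (\<Pi>\<^sub>E i\<in>I. carrier (L i))"
  by (simp add: product_ring_def)

lemma product_ring_mem: "f \<in> carrier (product_ring I L) \<Longrightarrow> i \<in> I \<Longrightarrow> f i \<in> carrier (L i)"
  by (auto simp: product_ring_carrier)

lemma product_ring_simps [simp]:
  "i \<in> I \<Longrightarrow> (f \<otimes>\<^bsub>product_ring I L\<^esub> g) i = f i \<otimes>\<^bsub>L i\<^esub> g i"
  "i \<in> I \<Longrightarrow> \<one>\<^bsub>product_ring I L\<^esub> i = \<one>\<^bsub>L i\<^esub>"
  "i \<in> I \<Longrightarrow> \<zero>\<^bsub>product_ring I L\<^esub> i = \<zero>\<^bsub>L i\<^esub>"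
  "i \<in> I \<Longrightarrow> (f \<oplus>\<^bsub>product_ring I L\<^esub> g) i = f i \<oplus>\<^bsub>L i\<^esub> g i"
  by (simp_all add: product_ring_def)

lemma product_ring_closed:
  assumes "\<And>i. i \<in> I \<Longrightarrow> cring (L i)"
  shows "f \<in> carrier (product_ring I L) \<Longrightarrow> g \<in> carrier (product_ring I L) \<Longrightarrow>
      f \<otimes>\<^bsub>product_ring I L\<^esub> g \<in> carrier (product_ring I L)"
    "f \<in> carrier (product_ring I L) \<Longrightarrow> g \<in> carrier (product_ring I L) \<Longrightarrow>
      f \<oplus>\<^bsub>product_ring I L\<^esub> g \<in> carrier (product_ring I L)"
    "\<one>\<^bsub>product_ring I L\<^esub> \<in> carrier (product_ring I L)"
    "\<zero>\<^bsub>product_ring I L\<^esub> \<in> carrier (product_ring I L)"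
  using assms
  by (auto simp: product_ring_def PiE_iff cring_def ring.ring_simprules)

lemma product_ring_eqI:
  assumes "f \<in> carrier (product_ring I L)" "g \<in> carrier (product_ring I L)" "\<And>i. i \<in> I \<Longrightarrow> f i = g i"
  shows "f = g"
  using assms by (auto simp: product_ring_carrier intro: PiE_ext)

lemma product_ring_cring:
  assumes L: "\<And>i. i \<in> I \<Longrightarrow> cring (L i)"
  shows "cring (product_ring I L)" (is "cring ?P")
proof (rule cringI)
  note cl = product_ring_closed[OF L] and eqI = product_ring_eqI[of _ I L]
  have R: "ring (L i)" if "i \<in> I" for i using L[OF that] by (simp add: cring_def)
  note simps = product_ring_mem ring.ring_simprules[OF R] cring.cring_simprules[OF L]
  show "abelian_group ?P"
  proof (rule abelian_groupI)
    fix f assume f: "f \<in> carrier ?P"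
    define g where "g = (\<lambda>i\<in>I. \<ominus>\<^bsub>L i\<^esub> f i)"
    have g: "g \<in> carrier ?P" using f by (auto simp: g_def product_ring_carrier simps)
    have "g \<oplus>\<^bsub>?P\<^esub> f = \<zero>\<^bsub>?P\<^esub>"
      using f g by (intro eqI cl) (simp_all add: g_def simps)
    then show "\<exists>g\<in>carrier ?P. g \<oplus>\<^bsub>?P\<^esub> f = \<zero>\<^bsub>?P\<^esub>" using g by blast
  next
    fix f g h assume "f \<in> carrier ?P" "g \<in> carrier ?P" "h \<in> carrier ?P"
    then show "f \<oplus>\<^bsub>?P\<^esub> g \<oplus>\<^bsub>?P\<^esub> h = f \<oplus>\<^bsub>?P\<^esub> (g \<oplus>\<^bsub>?P\<^esub> h)"
      by (intro eqI cl) (simp_all add: simps)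
  next
    fix f g assume "f \<in> carrier ?P" "g \<in> carrier ?P"
    then show "f \<oplus>\<^bsub>?P\<^esub> g = g \<oplus>\<^bsub>?P\<^esub> f"
      by (intro eqI cl) (simp_all add: simps)
  next
    fix f assume "f \<in> carrier ?P"
    then show "\<zero>\<^bsub>?P\<^esub> \<oplus>\<^bsub>?P\<^esub> f = f"
      by (intro eqI cl) (simp_all add: simps)
  qed (rule cl | assumption)+
  show "comm_monoid ?P"
  proof (rule comm_monoidI)
    fix f g h assume "f \<in> carrier ?P" "g \<in> carrier ?P" "h \<in> carrier ?P"
    then show "f \<otimes>\<^bsub>?P\<^esub> g \<otimes>\<^bsub>?P\<^esub> h = f \<otimes>\<^bsub>?P\<^esub> (g \<otimes>\<^bsub>?P\<^esub> h)"
      by (intro eqI cl) (simp_all add: simps)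
  next
    fix f g assume "f \<in> carrier ?P" "g \<in> carrier ?P"
    then show "f \<otimes>\<^bsub>?P\<^esub> g = g \<otimes>\<^bsub>?P\<^esub> f"
      by (intro eqI cl) (simp_all add: simps)
  next
    fix f assume "f \<in> carrier ?P"
    then show "\<one>\<^bsub>?P\<^esub> \<otimes>\<^bsub>?P\<^esub> f = f"
      by (intro eqI cl) (simp_all add: product_ring_mem ring.ring_simprules[OF R])
  qed (rule cl | assumption)+
  fix f g h assume "f \<in> carrier ?P" "g \<in> carrier ?P" "h \<in> carrier ?P"
  then show "(f \<oplus>\<^bsub>?P\<^esub> g) \<otimes>\<^bsub>?P\<^esub> h = f \<otimes>\<^bsub>?P\<^esub> h \<oplus>\<^bsub>?P\<^esub> g \<otimes>\<^bsub>?P\<^esub> h"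
    by (intro eqI cl) (simp_all add: simps)
qed

text \<open>Elements of \<open>simple_extension\<close> are built by Horner's scheme, and each
  closure property follows by induction along it; products need closure under sums and under scaling
  by \<open>K\<close> first. The setting includes rings with zero divisors because the extension
  takes place in a product ring.\<close>

lemma (in cring) simple_extension_subring:
  assumes K: "subring K R" and x: "x \<in> carrier R"
  shows "subring (simple_extension K x) R"
proof (rule subringI)
  note cl = subringE[OF K]
  note lin = simple_extension.lin[of _ K x]
  have inc: "K \<subseteq> simple_extension K x" by (rule simple_extension_incl[OF cl(1) x])
  show S: "simple_extension K x \<subseteq> carrier R" by (rule simple_extension_in_carrier[OF cl(1) x])
  show "\<one> \<in> simple_extension K x" using inc cl(3) by blast
  show "\<ominus> a \<in> simple_extension K x" if "a \<in> simple_extension K x" for a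
    using that
  proof (induction rule: simple_extension.induct)
    case (lin a k)
    have "\<ominus> (a \<otimes> x \<oplus> k) = \<ominus> a \<otimes> x \<oplus> \<ominus> k"
      using lin(1,2) S cl(1) x by (simp add: minus_add l_minus subset_iff)
    then show ?case using simple_extension.lin[OF lin(3) cl(5)[OF lin(2)]] by simp
  qed simp
  have add: "a \<oplus> b \<in> simple_extension K x" if "a \<in> simple_extension K x" "b \<in> simple_extension K x" for a b
    using that
  proof (induction arbitrary: b rule: simple_extension.induct)
    case (lin a k)
    have c: "a \<in> carrier R" "k \<in> carrier R" using lin(1,2) S cl(1) by auto
    show ?case using lin(4)
    proof (cases rule: simple_extension.cases)
      case zero
      then show ?thesis using simple_extension.lin[OF lin(1,2)] c x by simp
    next
      case (lin b' l)
      have d: "b' \<in> carrier R" "l \<in> carrier R" using lin(2,3) S cl(1) by auto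
      have "(a \<otimes> x \<oplus> k) \<oplus> (b' \<otimes> x \<oplus> l) = (a \<oplus> b') \<otimes> x \<oplus> (k \<oplus> l)"
        using c d x by (simp add: l_distr a_ac)
      then show ?thesis
        using simple_extension.lin[OF \<open>\<And>b. b \<in> simple_extension K x \<Longrightarrow> a \<oplus> b \<in> simple_extension K x\<close>[OF lin(2)] cl(7)[OF \<open>k \<in> K\<close> lin(3)]]
        by (simp add: lin(1))
    qed
  qed (use S in auto)
  then show "a \<oplus> b \<in> simple_extension K x" if "a \<in> simple_extension K x" "b \<in> simple_extension K x" for a b
    using that by blast
  have scal: "a \<otimes> l \<in> simple_extension K x" if "a \<in> simple_extension K x" "l \<in> K" for a l
    using that
  proof (induction rule: simple_extension.induct)
    case zero
    then show ?case using cl(1) by auto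
  next
    case (lin a k)
    have "a \<in> carrier R" "k \<in> carrier R" "l \<in> carrier R" using lin(1,2,4) S cl(1) by auto
    then have "(a \<otimes> x \<oplus> k) \<otimes> l = (a \<otimes> l) \<otimes> x \<oplus> k \<otimes> l" using x by (simp add: l_distr m_assoc m_comm[of x l])
    then show ?case using simple_extension.lin[OF lin(3)[OF lin(4)] cl(6)[OF lin(2,4)]] by simp
  qed
  show "a \<otimes> b \<in> simple_extension K x" if a: "a \<in> simple_extension K x" and b: "b \<in> simple_extension K x" for a b
    using b
  proof (induction rule: simple_extension.induct)
    case zero
    then show ?case using a S by auto
  next
    case (lin b k)
    have c: "a \<in> carrier R" "b \<in> carrier R" "k \<in> carrier R" using a lin(1,2) S cl(1) by auto
    then have "a \<otimes> (b \<otimes> x \<oplus> k) = ((a \<otimes> b) \<otimes> x \<oplus> \<zero>) \<oplus> a \<otimes> k" using x by (simp add: r_distr m_ac)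
    then show ?case using add[OF simple_extension.lin[OF lin(3) cl(2)] scal[OF a lin(2)]] by simp
  qed
qed

lemma (in ring) countable_simple_extension:
  assumes "countable K" "K \<subseteq> carrier R" "x \<in> carrier R"
  shows "countable (simple_extension K x)"
proof -
  have "carrier (K[X]) \<subseteq> lists K"
    by (auto simp: univ_poly_def polynomial_def)
  then have "countable (carrier (K[X]))"
    using countable_lists[OF assms(1)] countable_subset by blast
  then show ?thesis unfolding simple_extension_as_eval_img[OF assms(2,3)] by (rule countable_image)
qed

section \<open>Countable subrings that embed into every factor\<close>

locale local_family =
  fixes I :: "'i set" and L :: "'i \<Rightarrow> ('b, 'n) ring_scheme"
  assumes finite_I: "finite I" and I_nonempty: "I \<noteq> {}"
    and local_domain: "i \<in> I \<Longrightarrow> domain (L i)"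
    and uncountable_Units: "i \<in> I \<Longrightarrow> uncountable (Units (L i))"
begin

abbreviation "B \<equiv> product_ring I L"

sublocale B: cring B
  using local_domain by (intro product_ring_cring) (simp add: domain_def)

lemma B_mem: "f \<in> carrier B \<Longrightarrow> i \<in> I \<Longrightarrow> f i \<in> carrier (L i)"
  by (rule product_ring_mem)

lemma comp_hom: "i \<in> I \<Longrightarrow> ring_hom_ring B (L i) (\<lambda>f. f i)"
  using local_domain by (intro ring_hom_ringI2 ring_hom_memI) (auto simp: B.ring_axioms domain_def cring_def product_ring_mem)

text \<open>The last condition says that every projection is injective on \<open>A\<close>, so
  \<open>A\<close> is a domain even where the product is not. Countability leaves room for further
  generators.\<close>

definition good :: "('i \<Rightarrow> 'b) set \<Rightarrow> bool" where
  "good A \<longleftrightarrow> subring A B \<and> countable A \<and> (\<forall>f\<in>A. f \<noteq> \<zero>\<^bsub>B\<^esub> \<longrightarrow> (\<forall>i\<in>I. f i \<noteq> \<zero>\<^bsub>L i\<^esub>))"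

text \<open>The leading coefficient of a nonzero polynomial over \<open>A\<close> stays nonzero in
  component \<open>i\<close> because \<open>A\<close> is good. So each polynomial contributes
  finitely many roots, and there are countably many polynomials.\<close>

lemma countable_algebraic:
  assumes A: "good A" and i: "i \<in> I"
  shows "countable {x \<in> carrier (L i). \<exists>p \<in> carrier (A[X]\<^bsub>B\<^esub>). p \<noteq> [] \<and> ring.eval (L i) (map (\<lambda>f. f i) p) x = \<zero>\<^bsub>L i\<^esub>}"
proof -
  interpret Li: domain "L i" using local_domain[OF i] .
  have sub: "A \<subseteq> carrier B" using A subringE(1) unfolding good_def by blast
  have fin: "finite {x. Li.is_root (map (\<lambda>f. f i) p) x}" if p: "p \<in> carrier (A[X]\<^bsub>B\<^esub>)" for p
  proof (rule Li.finite_number_of_roots)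
    have *: "set p \<subseteq> A" "p \<noteq> [] \<Longrightarrow> lead_coeff p \<noteq> \<zero>\<^bsub>B\<^esub>" using p by (auto simp: univ_poly_def polynomial_def)
    then have "p \<noteq> [] \<Longrightarrow> (lead_coeff p) i \<noteq> \<zero>\<^bsub>L i\<^esub>" using A i unfolding good_def by (meson hd_in_set subsetD)
    moreover have "set (map (\<lambda>f. f i) p) \<subseteq> carrier (L i)" using *(1) sub B_mem[OF _ i] by auto
    ultimately show "map (\<lambda>f. f i) p \<in> carrier (poly_ring (L i))"
      by (auto simp: univ_poly_def polynomial_def hd_map)
  qed
  have "carrier (A[X]\<^bsub>B\<^esub>) \<subseteq> lists A" by (auto simp: univ_poly_def polynomial_def)
  then have "countable (carrier (A[X]\<^bsub>B\<^esub>))"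
    using A countable_subset[OF _ countable_lists] unfolding good_def by metis
  then have "countable (\<Union>p\<in>carrier (A[X]\<^bsub>B\<^esub>). {x. Li.is_root (map (\<lambda>f. f i) p) x})"
    using fin by (intro countable_UN) (auto intro: countable_finite)
  then show ?thesis by (rule countable_subset[rotated]) (auto simp: Li.is_root_def)
qed

text \<open>The unit multiples of \<open>x i\<close> are uncountable, so one of them avoids the
  countable set of algebraic elements. With such a choice in every component, a nonzero polynomial
  expression in \<open>f\<close> over \<open>A\<close> vanishes in none of them.\<close>

lemma good_extension:
  assumes A: "good A" and x: "\<And>i. i \<in> I \<Longrightarrow> x i \<in> carrier (L i)" "\<And>i. i \<in> I \<Longrightarrow> x i \<noteq> \<zero>\<^bsub>L i\<^esub>"
  shows "\<exists>A' f. good A' \<and> A \<subseteq> A' \<and> f \<in> A' \<and> (\<forall>i\<in>I. f i \<sim>\<^bsub>L i\<^esub> x i)"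
proof -
  have subA: "subring A B" and cA: "countable A" using A unfolding good_def by auto
  define bad where "bad i = {x \<in> carrier (L i). \<exists>p \<in> carrier (A[X]\<^bsub>B\<^esub>). p \<noteq> [] \<and> ring.eval (L i) (map (\<lambda>f. f i) p) x = \<zero>\<^bsub>L i\<^esub>}" for i
  have "\<exists>y. y \<in> carrier (L i) \<and> y \<sim>\<^bsub>L i\<^esub> x i \<and> y \<notin> bad i" if i: "i \<in> I" for i
  proof -
    interpret Li: domain "L i" using local_domain[OF i] .
    have "inj_on (\<lambda>u. x i \<otimes>\<^bsub>L i\<^esub> u) (Units (L i))"
      using x[OF i] Li.m_lcancel[of "x i"] Li.Units_closed by (intro inj_onI) blast
    then have "uncountable ((\<lambda>u. x i \<otimes>\<^bsub>L i\<^esub> u) ` Units (L i))"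
      using uncountable_Units[OF i] by (simp add: countable_image_inj_eq)
    then have "\<not> (\<lambda>u. x i \<otimes>\<^bsub>L i\<^esub> u) ` Units (L i) \<subseteq> bad i"
      using countable_algebraic[OF A i] countable_subset unfolding bad_def by blast
    then obtain u where u: "u \<in> Units (L i)" "x i \<otimes>\<^bsub>L i\<^esub> u \<notin> bad i" by blast
    then show ?thesis using x[OF i] Li.associatedI2[OF u(1) refl x(1)[OF i]] by (intro exI[of _ "x i \<otimes>\<^bsub>L i\<^esub> u"]) (simp add: Li.Units_closed)
  qed
  then obtain y where y: "\<And>i. i \<in> I \<Longrightarrow> y i \<in> carrier (L i) \<and> y i \<sim>\<^bsub>L i\<^esub> x i \<and> y i \<notin> bad i" by metis
  define f where "f = restrict y I"
  have f: "f \<in> carrier B" using y by (auto simp: f_def product_ring_carrier)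
  have fy: "f i = y i" if "i \<in> I" for i using that by (simp add: f_def)
  define A' where "A' = B.simple_extension A f"
  have A'_img: "A' = (\<lambda>p. B.eval p f) ` carrier (A[X]\<^bsub>B\<^esub>)"
    unfolding A'_def by (rule B.simple_extension_as_eval_img[OF subringE(1)[OF subA] f])
  have "good A'" unfolding good_def
  proof (intro conjI ballI impI)
    show "subring A' B" unfolding A'_def by (rule B.simple_extension_subring[OF subA f])
    show "countable A'" unfolding A'_def by (rule B.countable_simple_extension[OF cA subringE(1)[OF subA] f])
    fix g i assume g: "g \<in> A'" "g \<noteq> \<zero>\<^bsub>B\<^esub>" and i: "i \<in> I"
    interpret h: ring_hom_ring B "L i" "\<lambda>f. f i" using comp_hom[OF i] .
    obtain p where p: "p \<in> carrier (A[X]\<^bsub>B\<^esub>)" "g = B.eval p f" using g A'_img by blast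
    then have "p \<noteq> []" using g by auto
    moreover have "g i = h.S.eval (map (\<lambda>f. f i) p) (f i)"
      unfolding p(2) by (rule h.eval_hom[OF subA f p(1)])
    ultimately show "g i \<noteq> \<zero>\<^bsub>L i\<^esub>" using y[OF i] p(1) fy[OF i] unfolding bad_def by auto
  qed
  moreover have "A \<subseteq> A'" unfolding A'_def by (rule B.simple_extension_incl[OF subringE(1)[OF subA] f])
  moreover have "f \<in> A'" unfolding A'_def by (rule B.simple_extension_mem[OF subA f])
  ultimately show ?thesis using fy y by (intro exI[of _ A'] exI[of _ f]) auto
qed

lemma good_with_targets:
  assumes A: "good A" and T: "finite T" "\<And>t i. t \<in> T \<Longrightarrow> i \<in> I \<Longrightarrow> t i \<in> carrier (L i) - {\<zero>\<^bsub>L i\<^esub>}"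
  shows "\<exists>A'. good A' \<and> A \<subseteq> A' \<and> (\<forall>t\<in>T. \<exists>f\<in>A'. \<forall>i\<in>I. f i \<sim>\<^bsub>L i\<^esub> t i)"
  using T
proof (induction T)
  case empty
  then show ?case using A by auto
next
  case (insert t T)
  then obtain A' where A': "good A'" "A \<subseteq> A'" "\<And>t. t \<in> T \<Longrightarrow> \<exists>f\<in>A'. \<forall>i\<in>I. f i \<sim>\<^bsub>L i\<^esub> t i" by auto
  obtain A'' f where "good A''" "A' \<subseteq> A''" "f \<in> A''" "\<forall>i\<in>I. f i \<sim>\<^bsub>L i\<^esub> t i"
    using good_extension[OF A'(1), of t] insert.prems by auto
  then show ?case using A' by (intro exI[of _ A'']) blast
qed

text \<open>The intersection of the product with the quotient field of \<open>A\<close>.\<close>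

definition saturation :: "('i \<Rightarrow> 'b) set \<Rightarrow> ('i \<Rightarrow> 'b) set" where
  "saturation A = {h \<in> carrier B. \<exists>f\<in>A. \<exists>g\<in>A. g \<noteq> \<zero>\<^bsub>B\<^esub> \<and> g \<otimes>\<^bsub>B\<^esub> h = f}"

lemma zero_comp: "f \<in> carrier B \<Longrightarrow> (\<And>i. i \<in> I \<Longrightarrow> f i = \<zero>\<^bsub>L i\<^esub>) \<Longrightarrow> f = \<zero>\<^bsub>B\<^esub>"
  using product_ring_eqI[of f I L "\<zero>\<^bsub>B\<^esub>"] B.zero_closed by simp

lemma good_mult_nonzero:
  assumes A: "good A" and fg: "f \<in> A" "g \<in> A" "f \<noteq> \<zero>\<^bsub>B\<^esub>" "g \<noteq> \<zero>\<^bsub>B\<^esub>"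
  shows "f \<otimes>\<^bsub>B\<^esub> g \<noteq> \<zero>\<^bsub>B\<^esub>"
proof
  assume 0: "f \<otimes>\<^bsub>B\<^esub> g = \<zero>\<^bsub>B\<^esub>"
  obtain i where i: "i \<in> I" using I_nonempty by blast
  interpret Li: domain "L i" using local_domain[OF i] .
  have c: "f \<in> carrier B" "g \<in> carrier B" using A fg subringE(1) unfolding good_def by blast+
  have "f i \<otimes>\<^bsub>L i\<^esub> g i = \<zero>\<^bsub>L i\<^esub>" using fun_cong[OF 0, of i] i by simp
  moreover have "f i \<noteq> \<zero>\<^bsub>L i\<^esub>" "g i \<noteq> \<zero>\<^bsub>L i\<^esub>" using A fg i unfolding good_def by auto
  ultimately show False using product_ring_mem[OF c(1) i] product_ring_mem[OF c(2) i] Li.integral[of "f i" "g i"] by auto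
qed

lemma good_subset_saturation:
  assumes A: "good A"
  shows "A \<subseteq> saturation A"
proof
  fix f assume f: "f \<in> A"
  have sub: "subring A B" using A unfolding good_def by auto
  have c: "f \<in> carrier B" using f subringE(1)[OF sub] by blast
  obtain i where i: "i \<in> I" using I_nonempty by blast
  have "\<one>\<^bsub>B\<^esub> i \<noteq> \<zero>\<^bsub>B\<^esub> i" using i domain.one_not_zero[OF local_domain[OF i]] by simp
  then have "\<one>\<^bsub>B\<^esub> \<noteq> \<zero>\<^bsub>B\<^esub>" by metis
  moreover have "\<one>\<^bsub>B\<^esub> \<otimes>\<^bsub>B\<^esub> f = f" using c by (rule B.l_one)
  ultimately show "f \<in> saturation A" unfolding saturation_def using f c subringE(3)[OF sub] by blast
qed

text \<open>Arithmetic of fractions: for sums and products \<open>g\<close> times \<open>g'\<close>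
  is a common denominator, nonzero by \<open>good_mult_nonzero\<close>.\<close>

lemma subring_saturation:
  assumes A: "good A"
  shows "subring (saturation A) B"
proof (rule B.subringI)
  have sub: "subring A B" using A unfolding good_def by auto
  note cl = subringE[OF sub]
  show "saturation A \<subseteq> carrier B" unfolding saturation_def by blast
  show "\<one>\<^bsub>B\<^esub> \<in> saturation A" using good_subset_saturation[OF A] cl(3) by blast
  show "\<ominus>\<^bsub>B\<^esub> h \<in> saturation A" if hs: "h \<in> saturation A" for h
  proof -
    obtain f g where h: "h \<in> carrier B" "f \<in> A" "g \<in> A" "g \<noteq> \<zero>\<^bsub>B\<^esub>" "g \<otimes>\<^bsub>B\<^esub> h = f"
      using hs unfolding saturation_def by blast
    have gc: "g \<in> carrier B" using h cl(1) by blast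
    have "g \<otimes>\<^bsub>B\<^esub> (\<ominus>\<^bsub>B\<^esub> h) = \<ominus>\<^bsub>B\<^esub> f" using B.r_minus[OF gc h(1)] h(5) by simp
    then show ?thesis unfolding saturation_def using h cl(5) B.a_inv_closed[OF h(1)] by blast
  qed
  fix h h' assume "h \<in> saturation A" "h' \<in> saturation A"
  then obtain f g f' g' where h: "h \<in> carrier B" "f \<in> A" "g \<in> A" "g \<noteq> \<zero>\<^bsub>B\<^esub>" "g \<otimes>\<^bsub>B\<^esub> h = f"
    and h': "h' \<in> carrier B" "f' \<in> A" "g' \<in> A" "g' \<noteq> \<zero>\<^bsub>B\<^esub>" "g' \<otimes>\<^bsub>B\<^esub> h' = f'"
    unfolding saturation_def by blast
  have c: "f \<in> carrier B" "g \<in> carrier B" "f' \<in> carrier B" "g' \<in> carrier B" using h h' cl(1) by blast+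
  have nz: "g \<otimes>\<^bsub>B\<^esub> g' \<noteq> \<zero>\<^bsub>B\<^esub>" using good_mult_nonzero[OF A h(3) h'(3) h(4) h'(4)] .
  have "(g \<otimes>\<^bsub>B\<^esub> g') \<otimes>\<^bsub>B\<^esub> (h \<otimes>\<^bsub>B\<^esub> h') = (g \<otimes>\<^bsub>B\<^esub> h) \<otimes>\<^bsub>B\<^esub> (g' \<otimes>\<^bsub>B\<^esub> h')"
    using h(1) h'(1) c by (simp only: B.m_ac B.m_closed)
  then have "(g \<otimes>\<^bsub>B\<^esub> g') \<otimes>\<^bsub>B\<^esub> (h \<otimes>\<^bsub>B\<^esub> h') = f \<otimes>\<^bsub>B\<^esub> f'" using h h' by simp
  then show "h \<otimes>\<^bsub>B\<^esub> h' \<in> saturation A"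
    unfolding saturation_def using nz cl(6)[OF h(3) h'(3)] cl(6)[OF h(2) h'(2)] B.m_closed[OF h(1) h'(1)] by blast
  have "(g \<otimes>\<^bsub>B\<^esub> g') \<otimes>\<^bsub>B\<^esub> (h \<oplus>\<^bsub>B\<^esub> h') = (g \<otimes>\<^bsub>B\<^esub> g') \<otimes>\<^bsub>B\<^esub> h \<oplus>\<^bsub>B\<^esub> (g \<otimes>\<^bsub>B\<^esub> g') \<otimes>\<^bsub>B\<^esub> h'"
    using h(1) h'(1) c by (intro B.r_distr B.m_closed)
  also have "(g \<otimes>\<^bsub>B\<^esub> g') \<otimes>\<^bsub>B\<^esub> h = g' \<otimes>\<^bsub>B\<^esub> (g \<otimes>\<^bsub>B\<^esub> h)"
    using h(1) c by (simp only: B.m_ac B.m_closed)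
  also have "(g \<otimes>\<^bsub>B\<^esub> g') \<otimes>\<^bsub>B\<^esub> h' = g \<otimes>\<^bsub>B\<^esub> (g' \<otimes>\<^bsub>B\<^esub> h')"
    using h'(1) c by (simp only: B.m_ac B.m_closed)
  finally have "(g \<otimes>\<^bsub>B\<^esub> g') \<otimes>\<^bsub>B\<^esub> (h \<oplus>\<^bsub>B\<^esub> h') = g' \<otimes>\<^bsub>B\<^esub> f \<oplus>\<^bsub>B\<^esub> g \<otimes>\<^bsub>B\<^esub> f'" using h h' by simp
  then show "h \<oplus>\<^bsub>B\<^esub> h' \<in> saturation A"
    unfolding saturation_def
    using nz cl(6)[OF h(3) h'(3)] cl(7)[OF cl(6)[OF h'(3) h(2)] cl(6)[OF h(3) h'(2)]] B.a_closed[OF h(1) h'(1)] by blast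
qed

text \<open>If a fraction vanishes in one component, so does its numerator, which then is zero
  because \<open>A\<close> is good. As the denominator is nonzero everywhere, the fraction vanishes
  in all components.\<close>

lemma saturation_nonzero:
  assumes A: "good A" and h: "h \<in> saturation A" "h \<noteq> \<zero>\<^bsub>B\<^esub>" and i: "i \<in> I"
  shows "h i \<noteq> \<zero>\<^bsub>L i\<^esub>"
proof
  assume 0: "h i = \<zero>\<^bsub>L i\<^esub>"
  obtain f g where fg: "h \<in> carrier B" "f \<in> A" "g \<in> A" "g \<noteq> \<zero>\<^bsub>B\<^esub>" "g \<otimes>\<^bsub>B\<^esub> h = f"
    using h(1) unfolding saturation_def by blast
  have gc: "g \<in> carrier B" using fg A subringE(1) unfolding good_def by blast
  have gi: "g j \<in> carrier (L j)" "h j \<in> carrier (L j)" if "j \<in> I" for j using product_ring_mem[OF gc that] product_ring_mem[OF fg(1) that] .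
  interpret Li: domain "L i" using local_domain[OF i] .
  have "f i = \<zero>\<^bsub>L i\<^esub>" using fun_cong[OF fg(5), of i] i 0 gi by simp
  then have f0: "f = \<zero>\<^bsub>B\<^esub>" using A fg(2) i unfolding good_def by blast
  have "h j = \<zero>\<^bsub>L j\<^esub>" if j: "j \<in> I" for j
  proof -
    interpret Lj: domain "L j" using local_domain[OF j] .
    have "g j \<otimes>\<^bsub>L j\<^esub> h j = \<zero>\<^bsub>L j\<^esub>" using fun_cong[OF fg(5), of j] j f0 by simp
    moreover have "g j \<noteq> \<zero>\<^bsub>L j\<^esub>" using A fg j unfolding good_def by blast
    ultimately show ?thesis using Lj.integral gi[OF j] by blast
  qed
  then show False using zero_comp[OF fg(1)] h(2) by blast
qed

text \<open>This is the reason for passing from \<open>A\<close> to its saturation: the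
  componentwise quotients form an element of the product that is a fraction over
  \<open>A\<close>.\<close>

lemma saturation_divides:
  assumes A: "good A" and ab: "a \<in> saturation A" "b \<in> saturation A"
    and dvd: "\<And>i. i \<in> I \<Longrightarrow> a i divides\<^bsub>L i\<^esub> b i"
  shows "\<exists>c\<in>saturation A. b = a \<otimes>\<^bsub>B\<^esub> c"
proof (cases "a = \<zero>\<^bsub>B\<^esub>")
  case True
  have bc: "b \<in> carrier B" using ab unfolding saturation_def by blast
  have "b i = \<zero>\<^bsub>L i\<^esub>" if i: "i \<in> I" for i
  proof -
    interpret Li: domain "L i" using local_domain[OF i] .
    show ?thesis using dvd[OF i] True i by (auto simp: factor_def)
  qed
  then have "b = \<zero>\<^bsub>B\<^esub>" using zero_comp[OF bc] by blast
  then show ?thesis using True B.r_null[OF B.zero_closed] subringE(2)[OF subring_saturation[OF A]] by metis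
next
  case False
  have sub: "subring A B" using A unfolding good_def by auto
  note cl = subringE[OF sub]
  have "\<forall>i\<in>I. \<exists>c. c \<in> carrier (L i) \<and> b i = a i \<otimes>\<^bsub>L i\<^esub> c" using dvd by (auto simp: factor_def)
  then obtain c where c: "\<And>i. i \<in> I \<Longrightarrow> c i \<in> carrier (L i) \<and> b i = a i \<otimes>\<^bsub>L i\<^esub> c i" by metis
  define h where "h = restrict c I"
  have h: "h \<in> carrier B" using c by (auto simp: h_def product_ring_carrier)
  obtain f g where a: "a \<in> carrier B" "f \<in> A" "g \<in> A" "g \<noteq> \<zero>\<^bsub>B\<^esub>" "g \<otimes>\<^bsub>B\<^esub> a = f"
    using ab(1) unfolding saturation_def by blast
  obtain f' g' where b: "b \<in> carrier B" "f' \<in> A" "g' \<in> A" "g' \<noteq> \<zero>\<^bsub>B\<^esub>" "g' \<otimes>\<^bsub>B\<^esub> b = f'"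
    using ab(2) unfolding saturation_def by blast
  have cc: "g \<in> carrier B" "g' \<in> carrier B" using a b cl(1) by blast+
  have bah: "b = a \<otimes>\<^bsub>B\<^esub> h"
    by (rule product_ring_eqI[OF b(1) B.m_closed[OF a(1) h]]) (use c in \<open>simp add: h_def\<close>)
  have f0: "f \<noteq> \<zero>\<^bsub>B\<^esub>"
  proof
    assume f: "f = \<zero>\<^bsub>B\<^esub>"
    obtain i where i: "i \<in> I" using I_nonempty by blast
    interpret Li: domain "L i" using local_domain[OF i] .
    have "g i \<otimes>\<^bsub>L i\<^esub> a i = \<zero>\<^bsub>L i\<^esub>" using fun_cong[OF a(5), of i] f i by simp
    moreover have "g i \<noteq> \<zero>\<^bsub>L i\<^esub>" using A a i unfolding good_def by blast
    moreover have "a i \<noteq> \<zero>\<^bsub>L i\<^esub>" using saturation_nonzero[OF A ab(1) False i] .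
    moreover have "g i \<in> carrier (L i)" "a i \<in> carrier (L i)" using B_mem[OF cc(1) i] B_mem[OF a(1) i] by auto
    ultimately show False using Li.integral by blast
  qed
  \<comment> \<open>With a = f / g and b = f' / g', the quotient \<open>h\<close> is the fraction
    with numerator g f' and denominator g' f.\<close>
  have "(g' \<otimes>\<^bsub>B\<^esub> f) \<otimes>\<^bsub>B\<^esub> h = g \<otimes>\<^bsub>B\<^esub> (g' \<otimes>\<^bsub>B\<^esub> (a \<otimes>\<^bsub>B\<^esub> h))"
    unfolding a(5)[symmetric] using cc a(1) h by (simp only: B.m_ac B.m_closed)
  then have "(g' \<otimes>\<^bsub>B\<^esub> f) \<otimes>\<^bsub>B\<^esub> h = g \<otimes>\<^bsub>B\<^esub> f'" using bah b(5) by simp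
  then have "h \<in> saturation A" unfolding saturation_def
    using h cl(6)[OF b(3) a(2)] cl(6)[OF a(3) b(2)] good_mult_nonzero[OF A b(3) a(2) b(4) f0] by blast
  then show ?thesis using bah by blast
qed

text \<open>An element is determined by numerator and denominator, as the denominator can be
  cancelled in each component. Countability is what lets the glued ring be coded by natural
  numbers.\<close>

lemma countable_saturation:
  assumes A: "good A"
  shows "countable (saturation A)"
proof -
  have "\<exists>p\<in>A \<times> A. snd p \<noteq> \<zero>\<^bsub>B\<^esub> \<and> snd p \<otimes>\<^bsub>B\<^esub> h = fst p" if "h \<in> saturation A" for h
    using that unfolding saturation_def by force
  then obtain F where F: "\<And>h. h \<in> saturation A \<Longrightarrow> F h \<in> A \<times> A \<and> snd (F h) \<noteq> \<zero>\<^bsub>B\<^esub> \<and> snd (F h) \<otimes>\<^bsub>B\<^esub> h = fst (F h)"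
    by metis
  have "inj_on F (saturation A)"
  proof (rule inj_onI)
    fix h h' assume h: "h \<in> saturation A" "h' \<in> saturation A" "F h = F h'"
    have c: "h \<in> carrier B" "h' \<in> carrier B" using h unfolding saturation_def by blast+
    let ?g = "snd (F h)"
    have g: "?g \<in> A" "?g \<noteq> \<zero>\<^bsub>B\<^esub>" "?g \<otimes>\<^bsub>B\<^esub> h = ?g \<otimes>\<^bsub>B\<^esub> h'" using F[OF h(1)] F[OF h(2)] h(3) by (auto simp: mem_Times_iff)
    have gc: "?g \<in> carrier B" using g A subringE(1) unfolding good_def by blast
    show "h = h'"
    proof (rule product_ring_eqI[OF c])
      fix i assume i: "i \<in> I"
      interpret Li: domain "L i" using local_domain[OF i] .
      have "?g i \<otimes>\<^bsub>L i\<^esub> h i = ?g i \<otimes>\<^bsub>L i\<^esub> h' i" using fun_cong[OF g(3), of i] i by simp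
      moreover have "?g i \<noteq> \<zero>\<^bsub>L i\<^esub>" using A g i unfolding good_def by blast
      moreover have "?g i \<in> carrier (L i)" "h i \<in> carrier (L i)" "h' i \<in> carrier (L i)" using B_mem[OF gc i] B_mem[OF c(1) i] B_mem[OF c(2) i] by auto
      ultimately show "h i = h' i" by (simp add: Li.m_lcancel)
    qed
  qed
  moreover have "countable (A \<times> A)" using A unfolding good_def by auto
  then have "countable (F ` saturation A)" using F countable_subset[of "F ` saturation A" "A \<times> A"] by blast
  ultimately show ?thesis using countable_image_inj_on by blast
qed

end

section \<open>The glued domain as an algebra on a prescribed element type\<close>

lemma Fq_algebraI:
  fixes F :: "nat ring"
  assumes F: "field F" "finite (carrier F)" "card (carrier F) = q"
    and R: "cring R" and h: "h \<in> ring_hom F R"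
  shows "Fq_algebra q R"
proof -
  interpret F: field F by fact
  interpret R: cring R by fact
  interpret h: ring_hom_cring F R h by (intro ring_hom_cringI h F.is_cring R)
  let ?M = "\<lparr>carrier = carrier R, mult = mult R, one = one R, zero = zero R, add = add R,
    smult = (\<lambda>c x. h c \<otimes>\<^bsub>R\<^esub> x)\<rparr>"
  have M: "cring ?M"
  proof (rule cringI)
    show "abelian_group ?M"
      by (rule abelian_groupI) (auto simp: R.a_ac intro: R.a_closed bexI[of _ "\<ominus>\<^bsub>R\<^esub> _"] R.l_neg)
    show "comm_monoid ?M"
      by (intro comm_monoidI) (simp_all add: R.m_ac)
  qed (simp add: R.l_distr)
  have "algebra F ?M"
    by (rule algebraI) (auto simp: F.is_cring M R.l_distr R.r_distr R.m_assoc)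
  then show ?thesis unfolding Fq_algebra_def using F by blast
qed

text \<open>The glued ring consists of tuples of series, while the goal fixes another element type;
  this lemma carries the structure along an injective renaming.\<close>

lemma glued_domain_image:
  fixes e :: "'a \<Rightarrow> 'c"
  assumes "glued_domain R I L \<pi>" and e: "inj_on e (carrier R)"
  shows "glued_domain (image_ring e R) I L (\<lambda>i y. \<pi> i (inv_into (carrier R) e y))"
proof -
  interpret glued_domain R I L \<pi> by fact
  let ?R = "image_ring e R" and ?d = "inv_into (carrier R) e"
  have iso: "e \<in> ring_iso R ?R" by (rule inj_imp_image_ring_iso[OF e])
  have d: "?d \<in> ring_hom ?R R"
    using ring_iso_set_sym[OF ring_axioms iso] by (simp add: ring_iso_def image_ring_carrier)
  have e_hom: "e \<in> ring_hom R ?R" using iso by (simp add: ring_iso_def)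
  have dc: "?d y \<in> carrier R" "e (?d y) = y" if "y \<in> carrier ?R" for y
    using that by (auto simp: image_ring_carrier inv_into_into f_inv_into_f)
  have de: "?d (e x) = x" if "x \<in> carrier R" for x using e that by simp
  have ec: "e x \<in> carrier ?R" if "x \<in> carrier R" for x using that by (simp add: image_ring_carrier)
  interpret R': domain ?R by (rule inj_imp_image_ring_is_domain[OF e])
  show ?thesis
  proof (intro glued_domain.intro glued_domain_axioms.intro)
    show "domain ?R" by (rule R'.domain_axioms)
    show "finite I" by (rule finite_I)
    fix i assume i: "i \<in> I"
    show "domain (L i)" using local_domain[OF i] .
    show "(\<lambda>y. \<pi> i (?d y)) \<in> ring_hom ?R (L i)"
      using ring_hom_trans[OF d hom[OF i]] by (simp add: comp_def)
    show "\<pi> i (?d a) \<noteq> \<zero>\<^bsub>L i\<^esub>" if a: "a \<in> carrier ?R" "a \<noteq> \<zero>\<^bsub>?R\<^esub>" for a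
    proof -
      have "?d a \<noteq> \<zero>\<^bsub>R\<^esub>" using dc(2)[OF a(1)] a(2) by (metis image_ring_zero)
      then show ?thesis using nonzero[OF i dc(1)[OF a(1)]] by blast
    qed
    fix x assume x: "x \<in> carrier (L i)" "x \<noteq> \<zero>\<^bsub>L i\<^esub>"
    obtain a where a: "a \<in> carrier R" "\<pi> i a \<sim>\<^bsub>L i\<^esub> x" "\<forall>j\<in>I. j \<noteq> i \<longrightarrow> \<pi> j a \<in> Units (L j)"
      using lift_exists[OF i x] by blast
    then show "\<exists>a\<in>carrier ?R. \<pi> i (?d a) \<sim>\<^bsub>L i\<^esub> x \<and> (\<forall>j\<in>I. j \<noteq> i \<longrightarrow> \<pi> j (?d a) \<in> Units (L j))"
      using ec de by (intro bexI[of _ "e a"]) auto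
  next
    fix a b assume ab: "a \<in> carrier ?R" "b \<in> carrier ?R" "\<And>i. i \<in> I \<Longrightarrow> \<pi> i (?d a) divides\<^bsub>L i\<^esub> \<pi> i (?d b)"
    have "?d a divides\<^bsub>R\<^esub> ?d b" using divides_locally[OF dc(1)[OF ab(1)] dc(1)[OF ab(2)] ab(3)] .
    then obtain c where c: "c \<in> carrier R" "?d b = ?d a \<otimes>\<^bsub>R\<^esub> c" by (auto simp: factor_def)
    have "b = a \<otimes>\<^bsub>?R\<^esub> e c"
      using ring_hom_mult[OF e_hom dc(1)[OF ab(1)] c(1)] c(2) dc(2)[OF ab(1)] dc(2)[OF ab(2)] by simp
    then show "a divides\<^bsub>?R\<^esub> b" using ec[OF c(1)] by (auto simp: factor_def)
  qed
qed

text \<open>The condition on \<open>x\<close> is a form of non-primality of \<open>p\<close> that passes to glued domains.\<close>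

definition local_CK :: "('f, 'g) ring_scheme \<Rightarrow> nat \<Rightarrow> ('a, 'm) ring_scheme \<Rightarrow> bool" where
  "local_CK F n L \<longleftrightarrow> domain L \<and> uncountable (Units L) \<and> n > 0 \<and> has_exactly_atoms L n \<and>
     (\<forall>p. atom L p \<longrightarrow>
        (\<exists>x\<in>carrier L. x \<noteq> \<zero>\<^bsub>L\<^esub> \<and> \<not> p divides\<^bsub>L\<^esub> x \<and> p divides\<^bsub>L\<^esub> x \<otimes>\<^bsub>L\<^esub> x)) \<and>
     (\<exists>l :: 'a \<Rightarrow> nat.
        (\<forall>a\<in>carrier L - {\<zero>\<^bsub>L\<^esub>}. \<forall>b\<in>carrier L - {\<zero>\<^bsub>L\<^esub>}. l (a \<otimes>\<^bsub>L\<^esub> b) = l a + l b) \<and>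
        (\<forall>a\<in>carrier L - {\<zero>\<^bsub>L\<^esub>}. l a = 0 \<longleftrightarrow> a \<in> Units L)) \<and>
     (\<exists>h. h \<in> ring_hom F L)"

text \<open>The diagonal copy of \<open>F\<close> starts the tower of good subrings and makes the
  glued domain an algebra over \<open>F\<close>. A nonzero constant is a unit in every component, so
  it vanishes in none.\<close>

lemma (in local_family) good_constants:
  assumes F: "field F" "countable (carrier F)" and h: "\<And>i. i \<in> I \<Longrightarrow> h i \<in> ring_hom F (L i)"
  defines "\<kappa> \<equiv> \<lambda>c. \<lambda>i\<in>I. h i c"
  shows "\<kappa> \<in> ring_hom F B" "good (\<kappa> ` carrier F)"
proof -
  interpret F: field F by fact
  show hom: "\<kappa> \<in> ring_hom F B"
  proof (rule ring_hom_memI)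
    show "\<kappa> c \<in> carrier B" if "c \<in> carrier F" for c
      using that ring_hom_closed[OF h] by (auto simp: \<kappa>_def product_ring_carrier)
  qed (auto simp: \<kappa>_def product_ring_def fun_eq_iff ring_hom_add[OF h] ring_hom_mult[OF h] ring_hom_one[OF h])
  interpret hB: ring_hom_ring F B \<kappa> by (intro ring_hom_ringI2 hom F.ring_axioms B.ring_axioms)
  show "good (\<kappa> ` carrier F)" unfolding good_def
  proof (intro conjI ballI impI)
    show "subring (\<kappa> ` carrier F) B" by (rule hB.img_is_subring[OF F.carrier_is_subring])
    show "countable (\<kappa> ` carrier F)" using F(2) by simp
    fix f i assume f: "f \<in> \<kappa> ` carrier F" "f \<noteq> \<zero>\<^bsub>B\<^esub>" and i: "i \<in> I"
    obtain c where c: "c \<in> carrier F" "f = \<kappa> c" using f(1) by blast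
    interpret Li: domain "L i" using local_domain[OF i] .
    interpret hi: ring_hom_ring F "L i" "h i" by (intro ring_hom_ringI2 h i F.ring_axioms Li.ring_axioms)
    have "c \<noteq> \<zero>\<^bsub>F\<^esub>" using f(2) c(2) hB.hom_zero by auto
    then have c1: "inv\<^bsub>F\<^esub> c \<in> carrier F" "c \<otimes>\<^bsub>F\<^esub> inv\<^bsub>F\<^esub> c = \<one>\<^bsub>F\<^esub>" using c(1) by (auto simp: F.field_Units)
    have "h i c \<otimes>\<^bsub>L i\<^esub> h i (inv\<^bsub>F\<^esub> c) = \<one>\<^bsub>L i\<^esub>"
      using hi.hom_mult[OF c(1) c1(1)] c1(2) by simp
    then have "h i c \<noteq> \<zero>\<^bsub>L i\<^esub>" using c1(1) hi.hom_closed Li.l_null Li.one_not_zero by metis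
    then show "f i \<noteq> \<zero>\<^bsub>L i\<^esub>" using c(2) i by (simp add: \<kappa>_def)
  qed
qed

text \<open>Lifting atoms is enough for \<open>lift_exists\<close>: the elements with a lift,
  collected in \<open>Z\<close>, include the units (lifted by 1) and are closed under products, so
  by atomicity they are all the nonzero elements.\<close>

lemma (in local_family) glued_saturation:
  assumes A: "good A" and atomic: "\<And>i. i \<in> I \<Longrightarrow> atomic (L i)"
    and atoms: "\<And>i p. i \<in> I \<Longrightarrow> atom (L i) p \<Longrightarrow>
      \<exists>f\<in>A. f i \<sim>\<^bsub>L i\<^esub> p \<and> (\<forall>j\<in>I. j \<noteq> i \<longrightarrow> f j \<in> Units (L j))"
  shows "glued_domain (B\<lparr>carrier := saturation A\<rparr>) I L (\<lambda>i f. f i)"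
proof -
  let ?S = "saturation A" and ?R = "B\<lparr>carrier := saturation A\<rparr>"
  have sub: "subring ?S B" by (rule subring_saturation[OF A])
  note cl = subringE[OF sub]
  obtain i0 where i0: "i0 \<in> I" using I_nonempty by blast
  have "cring ?R" using B.subcring_iff[OF cl(1)] B.subcringI'[OF sub] by simp
  then interpret R: cring ?R .
  have R: "domain ?R"
  proof (rule domain.intro[OF R.is_cring domain_axioms.intro])
    have "\<one>\<^bsub>B\<^esub> i0 \<noteq> \<zero>\<^bsub>B\<^esub> i0" using i0 domain.one_not_zero[OF local_domain[OF i0]] by simp
    then have "\<one>\<^bsub>B\<^esub> \<noteq> \<zero>\<^bsub>B\<^esub>" by metis
    then show "\<one>\<^bsub>?R\<^esub> \<noteq> \<zero>\<^bsub>?R\<^esub>" by simp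
    show "a = \<zero>\<^bsub>?R\<^esub> \<or> b = \<zero>\<^bsub>?R\<^esub>" if ab: "a \<otimes>\<^bsub>?R\<^esub> b = \<zero>\<^bsub>?R\<^esub>" "a \<in> carrier ?R" "b \<in> carrier ?R" for a b
    proof (rule ccontr)
      assume "\<not> ?thesis"
      then have nz: "a i0 \<noteq> \<zero>\<^bsub>L i0\<^esub>" "b i0 \<noteq> \<zero>\<^bsub>L i0\<^esub>"
        using saturation_nonzero[OF A _ _ i0] ab by auto
      have c: "a i0 \<in> carrier (L i0)" "b i0 \<in> carrier (L i0)" using ab cl(1) B_mem[OF _ i0] by auto
      have "a \<otimes>\<^bsub>B\<^esub> b = \<zero>\<^bsub>B\<^esub>" using ab(1) by simp
      from fun_cong[OF this, of i0] have "a i0 \<otimes>\<^bsub>L i0\<^esub> b i0 = \<zero>\<^bsub>L i0\<^esub>" using i0 by simp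
      then show False using nz c domain.integral[OF local_domain[OF i0]] by blast
    qed
  qed
  have comp: "f i \<in> carrier (L i)" if "f \<in> ?S" "i \<in> I" for f i using that cl(1) B_mem by blast
  show ?thesis
  proof (intro glued_domain.intro glued_domain_axioms.intro)
    show "domain ?R" by (rule R)
    show "finite I" by (rule finite_I)
    fix i assume i: "i \<in> I"
    interpret Li: domain "L i" using local_domain[OF i] .
    show "domain (L i)" using local_domain[OF i] .
    show "(\<lambda>f. f i) \<in> ring_hom ?R (L i)"
      using i comp by (intro ring_hom_memI) auto
    show "a i \<noteq> \<zero>\<^bsub>L i\<^esub>" if "a \<in> carrier ?R" "a \<noteq> \<zero>\<^bsub>?R\<^esub>" for a
      using saturation_nonzero[OF A _ _ i] that by simp
    define Z where "Z x \<longleftrightarrow> (\<exists>a\<in>?S. a i \<sim>\<^bsub>L i\<^esub> x \<and> (\<forall>j\<in>I. j \<noteq> i \<longrightarrow> a j \<in> Units (L j)))" for x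
    have Z_unit: "Z x" if x: "x \<in> Units (L i)" for x
    proof -
      have "\<one>\<^bsub>B\<^esub> i \<sim>\<^bsub>L i\<^esub> x" using x i Li.Units_assoc by simp
      moreover have "\<one>\<^bsub>B\<^esub> j \<in> Units (L j)" if "j \<in> I" for j
        using that local_domain[OF that] by (simp add: domain_def cring_def ring_def monoid.Units_one_closed)
      ultimately show ?thesis unfolding Z_def using cl(3) by blast
    qed
    have Z_mult: "Z (x \<otimes>\<^bsub>L i\<^esub> y)" if x: "Z x" "x \<in> carrier (L i)" and y: "Z y" "y \<in> carrier (L i)" for x y
    proof -
      obtain a where a: "a \<in> ?S" "a i \<sim>\<^bsub>L i\<^esub> x" "\<And>j. j \<in> I \<Longrightarrow> j \<noteq> i \<Longrightarrow> a j \<in> Units (L j)"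
        using x(1) unfolding Z_def by blast
      obtain b where b: "b \<in> ?S" "b i \<sim>\<^bsub>L i\<^esub> y" "\<And>j. j \<in> I \<Longrightarrow> j \<noteq> i \<Longrightarrow> b j \<in> Units (L j)"
        using y(1) unfolding Z_def by blast
      have "(a \<otimes>\<^bsub>B\<^esub> b) i \<sim>\<^bsub>L i\<^esub> x \<otimes>\<^bsub>L i\<^esub> y"
        using Li.associated_mult[OF a(2) b(2) comp[OF a(1) i] x(2) comp[OF b(1) i] y(2)] i by simp
      moreover have "(a \<otimes>\<^bsub>B\<^esub> b) j \<in> Units (L j)" if j: "j \<in> I" "j \<noteq> i" for j
      proof -
        interpret Lj: domain "L j" using local_domain[OF j(1)] .
        show ?thesis using a(3)[OF j] b(3)[OF j] j by (simp add: Lj.Units_m_closed)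
      qed
      ultimately show ?thesis unfolding Z_def using cl(6)[OF a(1) b(1)] by blast
    qed
    have Z_atom: "Z p" if "atom (L i) p" for p
      using atoms[OF i that] good_subset_saturation[OF A] unfolding Z_def by blast
    have Z_list: "Z (foldr (\<otimes>\<^bsub>L i\<^esub>) ps \<one>\<^bsub>L i\<^esub>) \<and> foldr (\<otimes>\<^bsub>L i\<^esub>) ps \<one>\<^bsub>L i\<^esub> \<in> carrier (L i)"
      if "\<forall>p\<in>set ps. atom (L i) p" for ps
      using that
    proof (induction ps)
      case Nil
      then show ?case using Z_unit[OF Li.Units_one_closed] by simp
    next
      case (Cons p ps)
      have p: "atom (L i) p" using Cons.prems by simp
      show ?case using Cons Z_mult[OF Z_atom[OF p] atom_in_carrier[OF p]] atom_in_carrier[OF p] by simp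
    qed
    fix x assume x: "x \<in> carrier (L i)" "x \<noteq> \<zero>\<^bsub>L i\<^esub>"
    have "Z x"
    proof (cases "x \<in> Units (L i)")
      case False
      then have "x \<in> nonzero_nonunits (L i)" using x by (simp add: nonzero_nonunits_def)
      then show ?thesis using atomic[OF i] Z_list unfolding atomic_def by metis
    qed (rule Z_unit)
    then show "\<exists>a\<in>carrier ?R. a i \<sim>\<^bsub>L i\<^esub> x \<and> (\<forall>j\<in>I. j \<noteq> i \<longrightarrow> a j \<in> Units (L j))"
      unfolding Z_def by simp
  next
    fix a b assume ab: "a \<in> carrier ?R" "b \<in> carrier ?R" "\<And>i. i \<in> I \<Longrightarrow> a i divides\<^bsub>L i\<^esub> b i"
    then obtain c where "c \<in> ?S" "b = a \<otimes>\<^bsub>B\<^esub> c" using saturation_divides[OF A, of a b] by auto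
    then show "a divides\<^bsub>?R\<^esub> b" by (auto simp: factor_def)
  qed
qed

theorem CK_domain_exists:
  fixes F :: "nat ring" and L :: "nat \<Rightarrow> ('a, 'm) ring_scheme"
  assumes F: "field F" "finite (carrier F)" "card (carrier F) = q"
    and I: "finite I" "I \<noteq> {}" and L: "\<And>i. i \<in> I \<Longrightarrow> local_CK F (n i) (L i)"
  shows "\<exists>R :: (nat \<Rightarrow> nat) ring. CK_domain (sum n I) q R \<and> primefree R"
proof -
  have L': "domain (L i)" "uncountable (Units (L i))" "n i > 0" "has_exactly_atoms (L i) (n i)"
      "\<exists>l. (\<forall>a\<in>carrier (L i) - {\<zero>\<^bsub>L i\<^esub>}. \<forall>b\<in>carrier (L i) - {\<zero>\<^bsub>L i\<^esub>}. l (a \<otimes>\<^bsub>L i\<^esub> b) = l a + (l b :: nat)) \<and>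
        (\<forall>a\<in>carrier (L i) - {\<zero>\<^bsub>L i\<^esub>}. l a = 0 \<longleftrightarrow> a \<in> Units (L i))"
      "\<exists>h. h \<in> ring_hom F (L i)"
    if "i \<in> I" for i
    by (insert L[OF that, unfolded local_CK_def]) (elim conjE, assumption)+
  interpret local_family I L
    by (rule local_family.intro) (use I L' in auto)
  have "\<exists>l. \<forall>i\<in>I. (\<forall>a\<in>carrier (L i) - {\<zero>\<^bsub>L i\<^esub>}. \<forall>b\<in>carrier (L i) - {\<zero>\<^bsub>L i\<^esub>}. l i (a \<otimes>\<^bsub>L i\<^esub> b) = l i a + (l i b :: nat)) \<and>
      (\<forall>a\<in>carrier (L i) - {\<zero>\<^bsub>L i\<^esub>}. l i a = 0 \<longleftrightarrow> a \<in> Units (L i))"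
    by (intro bchoice ballI L'(5))
  then obtain l where l: "\<And>i a b. i \<in> I \<Longrightarrow> a \<in> carrier (L i) - {\<zero>\<^bsub>L i\<^esub>} \<Longrightarrow> b \<in> carrier (L i) - {\<zero>\<^bsub>L i\<^esub>} \<Longrightarrow>
        l i (a \<otimes>\<^bsub>L i\<^esub> b) = l i a + (l i b :: nat)"
      "\<And>i a. i \<in> I \<Longrightarrow> a \<in> carrier (L i) - {\<zero>\<^bsub>L i\<^esub>} \<Longrightarrow> l i a = 0 \<longleftrightarrow> a \<in> Units (L i)"
    by blast
  have atomic: "atomic (L i)" if i: "i \<in> I" for i
    using domain.atomic_by_length[OF local_domain[OF i], of "l i"] l[OF i] by blast
  have "\<exists>h. \<forall>i\<in>I. h i \<in> ring_hom F (L i)"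
    by (intro bchoice ballI L'(6))
  then obtain h where h: "\<And>i. i \<in> I \<Longrightarrow> h i \<in> ring_hom F (L i)" by blast
  define \<kappa> where "\<kappa> c = (\<lambda>i\<in>I. h i c)" for c
  have \<kappa>: "\<kappa> \<in> ring_hom F B" "good (\<kappa> ` carrier F)"
    using good_constants[OF F(1) countable_finite[OF F(2)] h] unfolding \<kappa>_def by blast+
  have "\<exists>P. \<forall>i\<in>I. atom_transversal (L i) (P i) \<and> finite (P i)"
    using L'(4) unfolding has_exactly_atoms_def by (intro bchoice ballI) blast
  then obtain P where P: "\<And>i. i \<in> I \<Longrightarrow> atom_transversal (L i) (P i)" "\<And>i. i \<in> I \<Longrightarrow> finite (P i)" by blast
  \<comment> \<open>The targets are the tuples with a representative atom at one place and 1 at all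
    others.\<close>
  define t where "t = (\<lambda>(i, p) j. if j = i then p else \<one>\<^bsub>L j\<^esub>)"
  define T where "T = t ` Sigma I P"
  have ex: "\<exists>A. good A \<and> \<kappa> ` carrier F \<subseteq> A \<and> (\<forall>t\<in>T. \<exists>f\<in>A. \<forall>i\<in>I. f i \<sim>\<^bsub>L i\<^esub> t i)"
  proof (rule good_with_targets[OF \<kappa>(2)])
    show "finite T" unfolding T_def using I(1) P(2) by auto
    fix g j assume g: "g \<in> T" and j: "j \<in> I"
    then obtain i p where ip: "i \<in> I" "p \<in> P i" "g = t (i, p)" unfolding T_def by auto
    have p: "atom (L i) p" using P(1)[OF ip(1)] ip(2) unfolding atom_transversal_def by blast
    interpret Lj: domain "L j" using local_domain[OF j] .
    show "g j \<in> carrier (L j) - {\<zero>\<^bsub>L j\<^esub>}"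
      using atom_in_carrier[OF p] atom_nonzero[OF p] by (simp add: ip(3) t_def)
  qed
  obtain A where A': "good A \<and> \<kappa> ` carrier F \<subseteq> A \<and> (\<forall>t\<in>T. \<exists>f\<in>A. \<forall>i\<in>I. f i \<sim>\<^bsub>L i\<^esub> t i)"
    by (rule exE[OF ex]) (rule that)
  note A = A'[THEN conjunct1] A'[THEN conjunct2, THEN conjunct1] A'[THEN conjunct2, THEN conjunct2]
  define R where "R = B\<lparr>carrier := saturation A\<rparr>"
  have glued: "glued_domain R I L (\<lambda>i f. f i)" unfolding R_def
  proof (rule glued_saturation[OF A(1) atomic])
    fix i a assume i: "i \<in> I" and a: "atom (L i) a"
    interpret Li: domain "L i" using local_domain[OF i] .
    obtain p where p: "p \<in> P i" "a \<sim>\<^bsub>L i\<^esub> p" using P(1)[OF i] a unfolding atom_transversal_def by blast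
    have pc: "p \<in> carrier (L i)"
      using P(1)[OF i] p(1) atom_in_carrier[of "L i" p] unfolding atom_transversal_def by blast
    have "t (i, p) \<in> T" unfolding T_def using i p by blast
    then obtain f where f: "f \<in> A" "\<And>j. j \<in> I \<Longrightarrow> f j \<sim>\<^bsub>L j\<^esub> t (i, p) j" using A(3) by blast
    have fc: "f j \<in> carrier (L j)" if "j \<in> I" for j
      using f(1) A(1) subringE(1) B_mem[OF _ that] unfolding good_def by blast
    have "f i \<sim>\<^bsub>L i\<^esub> a"
      using Li.associated_trans[OF f(2)[OF i, unfolded t_def, simplified] Li.associated_sym[OF p(2)] fc[OF i] atom_in_carrier[OF a]] .
    moreover have "f j \<in> Units (L j)" if j: "j \<in> I" "j \<noteq> i" for j
    proof -
      interpret Lj: domain "L j" using local_domain[OF j(1)] .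
      have "f j \<sim>\<^bsub>L j\<^esub> \<one>\<^bsub>L j\<^esub>" using f(2)[OF j(1)] j(2) by (simp add: t_def)
      then show ?thesis using Lj.associated_Units fc[OF j(1)] by auto
    qed
    ultimately show "\<exists>f\<in>A. f i \<sim>\<^bsub>L i\<^esub> a \<and> (\<forall>j\<in>I. j \<noteq> i \<longrightarrow> f j \<in> Units (L j))" using f(1) by blast
  qed
  obtain e0 :: "(nat \<Rightarrow> 'a) \<Rightarrow> nat" where e0: "inj_on e0 (saturation A)"
    using countable_saturation[OF A(1)] unfolding countable_def by blast
  \<comment> \<open>The elements are numbered, and the constant function turns the number into an
    element of the required type.\<close>
  define e where "e f = (\<lambda>n :: nat. e0 f)" for f
  have e: "inj_on e (carrier R)" using e0 by (auto simp: inj_on_def e_def R_def fun_eq_iff)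
  let ?R = "image_ring e R"
  interpret G: glued_domain ?R I L "\<lambda>i y. (inv_into (carrier R) e y) i"
    by (rule glued_domain_image[OF glued e])
  have "has_exactly_atoms ?R (sum n I)"
    by (intro G.atoms_glued L'(4))
  moreover have "primefree ?R"
  proof (rule G.primefree_glued)
    fix i p assume "i \<in> I" "atom (L i) p"
    then show "\<exists>x\<in>carrier (L i). x \<noteq> \<zero>\<^bsub>L i\<^esub> \<and> \<not> p divides\<^bsub>L i\<^esub> x \<and> p divides\<^bsub>L i\<^esub> x \<otimes>\<^bsub>L i\<^esub> x"
      using L[of i] unfolding local_CK_def by blast
  qed
  moreover have "atomic ?R" by (rule G.atomic_glued[of l]) (use l in blast)+
  moreover have "Fq_algebra q ?R"
  proof (rule Fq_algebraI[OF F G.is_cring])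
    have "\<kappa> \<in> ring_hom F R"
      using \<kappa>(1) A(2) good_subset_saturation[OF A(1)] by (auto simp: R_def ring_hom_def)
    moreover have "e \<in> ring_hom R ?R"
      using inj_imp_image_ring_iso[OF e] by (simp add: ring_iso_def)
    ultimately show "e \<circ> \<kappa> \<in> ring_hom F ?R" by (rule ring_hom_trans)
  qed
  moreover have "sum n I > 0"
  proof -
    obtain i where "i \<in> I" using I(2) by blast
    then show ?thesis using L'(3)[of i] I(1) by (intro sum_pos2[of I i]) auto
  qed
  ultimately show ?thesis unfolding CK_domain_def using G.domain_axioms by blast
qed

text \<open>Indexing the factors by list positions allows the same local ring to occur several
  times.\<close>

corollary CK_domain_sum_list:
  fixes F :: "nat ring"
  assumes F: "field F" "finite (carrier F)" "card (carrier F) = q"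
    and ns: "ns \<noteq> []" "\<And>n. n \<in> set ns \<Longrightarrow> \<exists>L :: (nat \<Rightarrow> nat) ring. local_CK F n L"
  shows "\<exists>R :: (nat \<Rightarrow> nat) ring. CK_domain (sum_list ns) q R \<and> primefree R"
proof -
  have "\<forall>i\<in>{..<length ns}. \<exists>L :: (nat \<Rightarrow> nat) ring. local_CK F (ns ! i) L" using ns(2) by simp
  then obtain L :: "nat \<Rightarrow> (nat \<Rightarrow> nat) ring" where "\<And>i. i \<in> {..<length ns} \<Longrightarrow> local_CK F (ns ! i) (L i)" by metis
  then have "\<exists>R :: (nat \<Rightarrow> nat) ring. CK_domain (\<Sum>i\<in>{..<length ns}. ns ! i) q R \<and> primefree R"
    using ns(1) by (intro CK_domain_exists[OF F]) auto
  then show ?thesis by (simp add: sum_list_sum_nth atLeast0LessThan)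
qed

text \<open>The equation for \<open>n\<close> is the orbit count with the denominator
  \<open>card k - 1\<close> cleared. As there are \<open>s\<close> orders of atoms,
  \<open>n > s\<close> says that each order carries more than one class.\<close>

lemma (in truncated_series) local_CK_L:
  assumes F: "h \<in> ring_hom F (R\<lparr>carrier := k\<rparr>)"
    and n: "s * ((card (carrier R) - 1) * card (carrier R) ^ (s - 1)) = n * (card k - 1)"
    and k1: "card k > 1" and big: "n > s"
  shows "local_CK F n L"
proof -
  define N where "N = card (orbit ` leads)"
  have "(card k - 1) * (s * N) = (card k - 1) * n"
    using card_orbits n unfolding N_def card_leads by (simp add: ac_simps)
  then have N: "s * N = n" using k1 by simp
  then have N1: "N > 1" using big s by (cases N; cases "N - 1") auto
  show ?thesis unfolding local_CK_def
  proof (intro conjI allI impI)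
    show "domain L" by (rule L.domain_axioms)
    show "uncountable (Units L)" by (rule uncountable_Units_L)
    show "n > 0" using big by simp
    show "has_exactly_atoms L n" using has_exactly_atoms_L N unfolding N_def by simp
    show "\<exists>x\<in>carrier L. x \<noteq> \<zero>\<^bsub>L\<^esub> \<and> \<not> p divides\<^bsub>L\<^esub> x \<and> p divides\<^bsub>L\<^esub> x \<otimes>\<^bsub>L\<^esub> x" if "atom L p" for p
      using atom_L_not_prime[OF N1[unfolded N_def] that] .
    \<comment> \<open>The order of vanishing serves as length, although atoms may have any length
      from \<open>s\<close> to \<open>2 * s - 1\<close>.\<close>
    show "\<exists>l. (\<forall>a\<in>carrier L - {\<zero>\<^bsub>L\<^esub>}. \<forall>b\<in>carrier L - {\<zero>\<^bsub>L\<^esub>}. l (a \<otimes>\<^bsub>L\<^esub> b) = l a + (l b :: nat)) \<and>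
        (\<forall>a\<in>carrier L - {\<zero>\<^bsub>L\<^esub>}. l a = 0 \<longleftrightarrow> a \<in> Units L)"
      using val_mult Units_L_val by (intro exI[of _ val]) (simp del: series_from_simps(1))
    show "\<exists>h. h \<in> ring_hom F L" using ring_hom_trans[OF F const_hom] by blast
  qed
qed

section \<open>Local rings over towers of finite fields\<close>

lemma subfield_fixed_field_tower:
  assumes K: "field K" and p: "prime (p :: nat)" "[p] \<cdot>\<^bsub>K\<^esub> \<one>\<^bsub>K\<^esub> = \<zero>\<^bsub>K\<^esub>" and ij: "i dvd j"
  shows "subfield (fixed_field K (p ^ i)) (K\<lparr>carrier := fixed_field K (p ^ j)\<rparr>)"
proof -
  interpret K: field K by fact
  have i: "subfield (fixed_field K (p ^ i)) K" and j: "subfield (fixed_field K (p ^ j)) K"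
    using K.subfield_fixed_field[OF p] by blast+
  interpret Kj: field "K\<lparr>carrier := fixed_field K (p ^ j)\<rparr>" using K.subfield_iff(2)[OF j] .
  show ?thesis
    by (rule Kj.subfield_iff(1)) (use K.subfield_iff(2)[OF i] K.fixed_field_mono[OF ij] in simp_all)
qed

text \<open>The exponents \<open>r\<close>, \<open>i\<close> and \<open>j\<close> belong to the
  scalars, to \<open>k\<close> and to the coefficient field. Keeping \<open>r\<close> apart from
  \<open>i\<close> allows scalars smaller than \<open>k\<close>.\<close>

lemma local_CK_fixed_field:
  fixes K :: "'a ring"
  assumes K: "field K" "finite (carrier K)" and p: "prime (p :: nat)" "[p] \<cdot>\<^bsub>K\<^esub> \<one>\<^bsub>K\<^esub> = \<zero>\<^bsub>K\<^esub>"
    and dvd: "r dvd i" "i dvd j" and pos: "i > 0" "s > 0"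
    and card: "card (fixed_field K (p ^ i)) = p ^ i" "card (fixed_field K (p ^ j)) = p ^ j"
    and n: "s * ((p ^ j - 1) * (p ^ j) ^ (s - 1)) = n * (p ^ i - 1)" "n > s"
  shows "\<exists>L :: (nat \<Rightarrow> 'a) ring. local_CK (K\<lparr>carrier := fixed_field K (p ^ r)\<rparr>) n L"
proof -
  interpret K: field K by fact
  let ?k = "fixed_field K (p ^ i)" and ?Kj = "K\<lparr>carrier := fixed_field K (p ^ j)\<rparr>"
  interpret truncated_series ?Kj ?k s
  proof (rule truncated_series.intro)
    show "field ?Kj" using K.subfield_iff(2)[OF K.subfield_fixed_field[OF p]] .
    show "truncated_series_axioms ?Kj ?k s"
      using K(2) pos subfield_fixed_field_tower[OF K(1) p dvd(2)]
      by (intro truncated_series_axioms.intro) (simp_all add: fixed_field_def)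
  qed
  have "(\<lambda>x. x) \<in> ring_hom (K\<lparr>carrier := fixed_field K (p ^ r)\<rparr>) (?Kj\<lparr>carrier := ?k\<rparr>)"
    using K.fixed_field_mono[OF dvd(1)] by (auto simp: ring_hom_def)
  then have "local_CK (K\<lparr>carrier := fixed_field K (p ^ r)\<rparr>) n L"
  proof (rule local_CK_L)
    show "card ?k > 1" unfolding card(1) using prime_gt_1_nat[OF p(1)] pos(1) by (rule one_less_power)
  qed (use n card in simp_all)
  then show ?thesis by blast
qed

section \<open>The numbers of atoms\<close>

text \<open>Choose \<open>x\<close> between 0 and \<open>b - 1\<close> with \<open>a * x\<close>
  congruent to \<open>n\<close> modulo \<open>b\<close>. If \<open>a * x\<close> exceeded
  \<open>n\<close>, it would do so by at least \<open>b\<close>, so that \<open>n\<close> would be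
  at most \<open>a * (b - 1) - b\<close>, which is below the bound.\<close>

lemma coin_problem:
  fixes a b :: nat
  assumes "coprime a b" "a > 0" "b > 0" and n: "n \<ge> (a - 1) * (b - 1)"
  shows "\<exists>x y. n = x * a + y * b"
proof -
  obtain x0 where x0: "[a * x0 = n] (mod b)"
  proof -
    obtain x where "[a * x = 1] (mod b)" using cong_solve_coprime_nat[OF assms(1)] by auto
    then have "[a * x * n = 1 * n] (mod b)" by (rule cong_scalar_right)
    then show ?thesis using that[of "x * n"] by (simp add: mult.assoc)
  qed
  define x where "x = x0 mod b"
  have xb: "x \<le> b - 1" using assms(3) by (simp add: x_def Suc_leI le_diff_conv2 less_eq_Suc_le[symmetric])
  have cong: "[a * x = n] (mod b)" using x0 unfolding x_def cong_def by (metis mod_mult_right_eq)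
  have "a * x \<le> n"
  proof (rule ccontr)
    assume less: "\<not> a * x \<le> n"
    then have "b dvd a * x - n" using cong by (metis cong_altdef_nat nat_le_linear)
    then have "b \<le> a * x - n" using less by (intro dvd_imp_le) auto
    then have "n + b \<le> a * x" using less by simp
    moreover have "a * x \<le> a * (b - 1)" using xb by simp
    moreover have "a * (b - 1) = (a - 1) * (b - 1) + (b - 1)" using assms(2) by (cases a) auto
    ultimately show False using n assms(3) by linarith
  qed
  then have "b dvd n - a * x" using cong by (metis cong_altdef_nat cong_sym)
  then obtain y where "n - a * x = b * y" by blast
  then have "n = x * a + y * b" using \<open>a * x \<le> n\<close> by (simp add: mult.commute)
  then show ?thesis by blast
qed

lemma CK_domain_combination:
  fixes F :: "nat ring"
  assumes F: "field F" "finite (carrier F)" "card (carrier F) = q"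
    and N: "\<And>n. n \<in> N \<Longrightarrow> \<exists>L :: (nat \<Rightarrow> nat) ring. local_CK F n L"
    and abc: "a \<in> N" "b \<in> N" "c \<in> N" and n: "n = x * a + y * b + z * c" "n > 0"
  shows "\<exists>R :: (nat \<Rightarrow> nat) ring. CK_domain n q R \<and> primefree R"
proof -
  let ?ns = "replicate x a @ replicate y b @ replicate z c"
  have "?ns \<noteq> []" using n by auto
  moreover have "\<exists>L :: (nat \<Rightarrow> nat) ring. local_CK F m L" if "m \<in> set ?ns" for m
    using that N abc by (auto split: if_splits)
  moreover have "sum_list ?ns = n" by (simp add: n(1) sum_list_replicate)
  ultimately show ?thesis using CK_domain_sum_list[OF F, of ?ns] by simp
qed

lemma primefree_CK_domains:
  assumes p: "prime (p :: nat)" and r: "r > 0" and q: "q = p ^ r"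
    and n: "n = x * (q + 1) + y * (2 * q) + z * (q\<^sup>2 + q + 1)" "n > 0"
  shows "\<exists>R :: (nat \<Rightarrow> nat) ring. CK_domain n q R \<and> primefree R"
proof -
  \<comment> \<open>\<open>6 * r\<close> is a common multiple of \<open>2 * r\<close> and
    \<open>3 * r\<close>, so one field contains those with q, q^2 and q^3 elements.\<close>
  obtain K :: "nat ring" where K: "field K" "finite (carrier K)" "[p] \<cdot>\<^bsub>K\<^esub> \<one>\<^bsub>K\<^esub> = \<zero>\<^bsub>K\<^esub>"
    "\<And>j. j > 0 \<Longrightarrow> j dvd 6 * r \<Longrightarrow> card (fixed_field K (p ^ j)) = p ^ j"
    using finite_field_tower[OF p, of "6 * r"] r by auto
  interpret K: field K by fact
  let ?F = "K\<lparr>carrier := fixed_field K (p ^ r)\<rparr>"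
  have F: "field ?F" using K.subfield_iff(2)[OF K.subfield_fixed_field[OF p K(3)]] .
  have c: "card (fixed_field K (p ^ r)) = p ^ r" "card (fixed_field K (p ^ (2 * r))) = p ^ (2 * r)"
    "card (fixed_field K (p ^ (3 * r))) = p ^ (3 * r)"
    using K(4) r by auto
  have q2: "q \<ge> 2" unfolding q using prime_ge_2_nat[OF p] r self_le_power[of p r] prime_ge_1_nat[OF p] by linarith
  then obtain q' where q': "q = Suc (Suc q')" by (metis add_2_eq_Suc le_Suc_ex)
  have pw: "p ^ (2 * r) = q\<^sup>2" "p ^ (3 * r) = q ^ 3" unfolding q by (simp_all add: power_mult[symmetric] mult.commute)
  note local = local_CK_fixed_field[OF K(1,2) p K(3), of r]
  \<comment> \<open>A quadratic extension without a gap: (q^2 - 1) / (q - 1) classes, all of order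
    1.\<close>
  have "\<exists>L :: (nat \<Rightarrow> nat) ring. local_CK ?F (q + 1) L"
  proof (rule local[of r "2 * r" 1])
    show "1 * ((p ^ (2 * r) - 1) * (p ^ (2 * r)) ^ (1 - 1)) = (q + 1) * (p ^ r - 1)"
      unfolding pw(1) unfolding q[symmetric] by (simp add: q' power2_eq_square)
  qed (use r c q2 in simp_all)
  \<comment> \<open>No extension, but a gap: atoms have order 2 or 3, with q classes each.\<close>
  moreover have "\<exists>L :: (nat \<Rightarrow> nat) ring. local_CK ?F (2 * q) L"
    by (rule local[of r r 2]) (use r c q2 q in auto)
  \<comment> \<open>A cubic extension without a gap: (q^3 - 1) / (q - 1) classes.\<close>
  moreover have "\<exists>L :: (nat \<Rightarrow> nat) ring. local_CK ?F (q\<^sup>2 + q + 1) L"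
  proof (rule local[of r "3 * r" 1])
    show "1 * ((p ^ (3 * r) - 1) * (p ^ (3 * r)) ^ (1 - 1)) = (q\<^sup>2 + q + 1) * (p ^ r - 1)"
      unfolding pw(2) unfolding q[symmetric] by (simp add: q' power2_eq_square power3_eq_cube algebra_simps)
  qed (use r c q2 in simp_all)
  ultimately show ?thesis
    using CK_domain_combination[of ?F q "{q + 1, 2 * q, q\<^sup>2 + q + 1}" "q + 1" "2 * q" "q\<^sup>2 + q + 1" n x y z]
      F c(1) K(2) n q by (auto simp: fixed_field_def)
qed

lemma primefree_CK_domains_2:
  assumes n: "n \<ge> 3"
  shows "\<exists>R :: (nat \<Rightarrow> nat) ring. CK_domain n 2 R \<and> primefree R"
proof -
  have two: "prime (2 :: nat)" by simp
  obtain K :: "nat ring" where K: "field K" "finite (carrier K)" "[(2 :: nat)] \<cdot>\<^bsub>K\<^esub> \<one>\<^bsub>K\<^esub> = \<zero>\<^bsub>K\<^esub>"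
    "\<And>j. j > 0 \<Longrightarrow> j dvd 4 \<Longrightarrow> card (fixed_field K (2 ^ j)) = 2 ^ j"
    using finite_field_tower[OF two, of 4] by auto
  interpret K: field K by fact
  let ?F = "K\<lparr>carrier := fixed_field K (2 ^ 1)\<rparr>"
  have F: "field ?F" using K.subfield_iff(2)[OF K.subfield_fixed_field[OF two K(3)]] .
  have d2: "(2 :: nat) dvd 4" by presburger
  have c: "card (fixed_field K (2 ^ 1)) = 2 ^ 1" "card (fixed_field K (2 ^ 2)) = 2 ^ 2"
    "card (fixed_field K (2 ^ 4)) = 2 ^ 4"
    using K(4)[of 1] K(4)[of 2] K(4)[of 4] d2 by auto
  note local = local_CK_fixed_field[OF K(1,2) two K(3), of 1]
  have "\<exists>L :: (nat \<Rightarrow> nat) ring. local_CK ?F 3 L"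
    by (rule local[of 1 2 1]) (use c in auto)
  moreover have "\<exists>L :: (nat \<Rightarrow> nat) ring. local_CK ?F 4 L"
    by (rule local[of 1 1 2]) (use c in auto)
  \<comment> \<open>Here 5 = 15 / 3, from a field with 16 elements over one with 4; only the
    subfield with 2 elements is used as scalars.\<close>
  moreover have "\<exists>L :: (nat \<Rightarrow> nat) ring. local_CK ?F 5 L"
    by (rule local[of 2 4 1]) (use c d2 in auto)
  moreover obtain x y z where "n = x * 3 + y * 4 + z * 5"
  proof -
    \<comment> \<open>One case for each residue modulo 3; \<open>n \<ge> 3\<close> makes the
      truncated difference \<open>n div 3 - 1\<close> a genuine one.\<close>
    have "n = (n div 3) * 3 + 0 * 4 + 0 * 5 \<or> n = (n div 3 - 1) * 3 + 1 * 4 + 0 * 5 \<or> n = (n div 3 - 1) * 3 + 0 * 4 + 1 * 5"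
      using n by presburger
    then show ?thesis using that by blast
  qed
  moreover have "finite (carrier ?F)" "card (carrier ?F) = 2" using c(1) K(2) by (simp_all add: fixed_field_def)
  ultimately show ?thesis
    using n by (intro CK_domain_combination[of ?F 2 "{3, 4, 5}" 3 4 5 n x y z] F) auto
qed

text \<open>For even \<open>q\<close> the numbers \<open>q + 1\<close> and \<open>2 * q\<close> are
  coprime, and the bound of \<open>coin_problem\<close> becomes
  \<open>q * (2 * q - 1)\<close>.\<close>

lemma even_representation:
  assumes "even q" "q > 0" "n \<ge> 2 * q\<^sup>2 - q"
  shows "\<exists>x y. n = x * (q + 1) + y * (2 * q :: nat)"
proof (rule coin_problem)
  have "coprime (q + 1) q" by simp
  moreover have "coprime (q + 1) 2" using assms(1) by simp
  ultimately show "coprime (q + 1) (2 * q)" by simp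
  have "(q + 1 - 1) * (2 * q - 1) = 2 * q\<^sup>2 - q" by (simp add: power2_eq_square diff_mult_distrib2)
  then show "n \<ge> (q + 1 - 1) * (2 * q - 1)" using assms(3) by simp
qed (use assms in auto)

text \<open>Even totals are handled by halving the two even coins, odd ones by first spending a
  single coin \<open>q\<^sup>2 + q + 1\<close>, which leaves an even remainder.\<close>

lemma odd_representation:
  assumes q: "odd q" "q > 0" and n: "n \<ge> 2 * q\<^sup>2 - q + 1"
  shows "\<exists>x y z. n = x * (q + 1) + y * (2 * q) + z * (q\<^sup>2 + q + 1 :: nat)"
proof -
  obtain h where h: "q = 2 * h + 1" using q oddE by blast
  \<comment> \<open>The halved coins are h + 1 and 2 h + 1, with bound 2 h^2. Doubled, this is (q -
    1)^2, written here without subtraction.\<close>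
  have even_case: "\<exists>x y. m = x * (q + 1) + y * (2 * q)" if m: "even m" "m + 2 * q \<ge> q\<^sup>2 + 1" for m
  proof -
    obtain l where l: "m = 2 * l" using m by blast
    have "coprime (h + 1) (2 * h + 1)"
    proof -
      have "coprime (h + 1) h" by simp
      then have "coprime (h + 1) ((h + 1) + h)" by (metis coprime_iff_gcd_eq_1 gcd_add2)
      then show ?thesis by (simp add: mult_2)
    qed
    moreover have "(h + 1 - 1) * (2 * h + 1 - 1) \<le> l"
      using m(2) unfolding l h by (simp add: power2_eq_square algebra_simps)
    ultimately obtain x y where "l = x * (h + 1) + y * (2 * h + 1)" using coin_problem by (metis add_gr_0 zero_less_one)
    then have "m = x * (q + 1) + y * (2 * q)" unfolding l h by (simp add: algebra_simps)
    then show ?thesis by blast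
  qed
  have sq: "q \<le> q\<^sup>2" by (simp add: power2_eq_square)
  have n': "n + q \<ge> 2 * q\<^sup>2 + 1" using n sq by linarith
  show ?thesis
  proof (cases "even n")
    case True
    have "n + 2 * q \<ge> q\<^sup>2 + 1" using n' sq by linarith
    then obtain x y where "n = x * (q + 1) + y * (2 * q)" using even_case True by blast
    then have "n = x * (q + 1) + y * (2 * q) + 0 * (q\<^sup>2 + q + 1)" by simp
    then show ?thesis by blast
  next
    case False
    \<comment> \<open>The bound 2 q^2 - q + 1 is even, so an odd \<open>n\<close> exceeds it by at
      least one. This is just enough for the remainder to reach (q - 1)^2.\<close>
    have "even (n + q)" "odd (2 * q\<^sup>2 + 1)" using q False by simp_all
    then have "n + q \<noteq> 2 * q\<^sup>2 + 1" by metis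
    then have n2: "n + q \<ge> 2 * q\<^sup>2 + 2" using n' by linarith
    have "q\<^sup>2 + q + 1 \<le> n" using n2 sq q unfolding h by (simp add: power2_eq_square algebra_simps)
    then obtain m where m: "n = m + (q\<^sup>2 + q + 1)" by (metis add.commute le_Suc_ex)
    have "even m" using False q unfolding m by simp
    moreover have "m + 2 * q \<ge> q\<^sup>2 + 1" using n2 unfolding m by linarith
    ultimately obtain x y where "m = x * (q + 1) + y * (2 * q)" using even_case by blast
    then have "n = x * (q + 1) + y * (2 * q) + 1 * (q\<^sup>2 + q + 1)" unfolding m by simp
    then show ?thesis by blast
  qed
qed

theorem theorem1p11:
  fixes q :: nat
  assumes "primepow q"
  shows "(\<forall>R :: ('a, 'm) ring_scheme.
            domain R \<and> atomic R \<and> primefree R \<and> Fq_algebra q R \<and> \<not> field R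
            \<longrightarrow> has_at_least_atoms R (q + 1))
       \<and> (\<forall>n\<ge>3. \<exists>R :: (nat \<Rightarrow> nat) ring. CK_domain n 2 R \<and> primefree R)
       \<and> (even q \<longrightarrow> (\<forall>n \<ge> 2 * q^2 - q. \<exists>R :: (nat \<Rightarrow> nat) ring. CK_domain n q R \<and> primefree R))
       \<and> (odd q \<longrightarrow> (\<forall>n \<ge> 2 * q^2 - q + 1. \<exists>R :: (nat \<Rightarrow> nat) ring. CK_domain n q R \<and> primefree R))"
proof -
  obtain p r where pr: "prime p" "r > 0" "q = p ^ r"
    using assms unfolding primepow_def by blast
  have q: "q > 1" using primepow_gt_Suc_0[OF assms] by simp
  \<comment> \<open>Positivity of the bound excludes \<open>n = 0\<close>, which would be an empty
    gluing.\<close>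
  then have pos: "2 * q\<^sup>2 - q > 0" by (simp add: power2_eq_square)
  show ?thesis
  proof (intro conjI allI impI)
    fix n assume "even q" "n \<ge> 2 * q\<^sup>2 - q"
    then obtain x y where n: "n = x * (q + 1) + y * (2 * q)" using even_representation q by fastforce
    show "\<exists>R :: (nat \<Rightarrow> nat) ring. CK_domain n q R \<and> primefree R"
      by (rule primefree_CK_domains[OF pr, of n x y 0]) (use n \<open>n \<ge> 2 * q\<^sup>2 - q\<close> pos in auto)
  next
    fix n assume "odd q" "n \<ge> 2 * q\<^sup>2 - q + 1"
    then obtain x y z where n: "n = x * (q + 1) + y * (2 * q) + z * (q\<^sup>2 + q + 1)"
      using odd_representation[of q n] q by auto
    show "\<exists>R :: (nat \<Rightarrow> nat) ring. CK_domain n q R \<and> primefree R"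
      by (rule primefree_CK_domains[OF pr n]) (use \<open>n \<ge> 2 * q\<^sup>2 - q + 1\<close> in auto)
  qed (use atoms_lower_bound primefree_CK_domains_2 in blast)+
qed

end
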